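(* There exists a randomized algorithm in the dynamic graph stream model that, for an input graph on $n$ nodes and any $0<\epsilon<1/2$, returns a $(1+\epsilon)$-approximation of the maximum density $d^*$ of the final graph with high probability. The algorithm uses $O(\epsilon^{-2} n \,\mathrm{polylog}\, n)$ space and $O(\mathrm{polylog}\, n)$ (worst-case) time to process each stream update, and its post-processing time is polynomial in $n$.
   Context: In the dynamic graph stream model, the node set $V$ with $|V|=n$ is fixed and known, and the input is an arbitrary sequence of edge insertions and deletions (each deletion removes an edge currently present) defining a final simple undirected graph $G=(V,E)$; the algorithm reads this sequence once, in order, with limited working memory. For nonempty $U\subseteq V$, $G_U$ denotes the subgraph induced on $U$ and its density is $d(G_U)=|E(G_U)|/|U|$, where $E(G_U)$ is the set of edges of $G$ with both endpoints in $U$. The maximum density is $d^*=\max_{U\subseteq V} d(G_U)$. A $(1+\epsilon)$-approximation means an output value within a factor $(1+\epsilon)$ of $d^*$. "With high probability" means with probability at least $1-n^{-c'}$ for some constant $c'>0$. *)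

theory Defs
  imports "HOL-Probability.Probability" "HOL-Library.Log_Nat"
begin

section \<open>Dynamic graph streams and maximum density\<close>

text \<open>The node set is \<open>{..<n}\<close>; an undirected edge is a two-element set \<open>{u, v}\<close>.\<close>

datatype update = Ins (src: nat) (tgt: nat) | Del (src: nat) (tgt: nat)

fun is_ins :: "update \<Rightarrow> bool" where
  "is_ins (Ins u v) = True"
| "is_ins (Del u v) = False"

definition multiplicity_change :: "update \<Rightarrow> nat set \<Rightarrow> int" where
  "multiplicity_change a e =
     (if {src a, tgt a} = e then (if is_ins a then 1 else - 1) else 0)"

definition edge_multiplicity :: "update list \<Rightarrow> nat set \<Rightarrow> int" where
  "edge_multiplicity \<sigma> e = (\<Sum>a\<leftarrow>\<sigma>. multiplicity_change a e)"

text \<open>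
  Only the final graph has to be simple: an edge may temporarily be present several times,
  as long as every deletion removes an edge that is present at that moment.
\<close>

definition valid_stream :: "nat \<Rightarrow> update list \<Rightarrow> bool" where
  "valid_stream n \<sigma> \<longleftrightarrow>
     (\<forall>a\<in>set \<sigma>. src a < n \<and> tgt a < n \<and> src a \<noteq> tgt a) \<and>
     (\<forall>i<length \<sigma>. \<not> is_ins (\<sigma> ! i) \<longrightarrow>
        0 < edge_multiplicity (take i \<sigma>) {src (\<sigma> ! i), tgt (\<sigma> ! i)}) \<and>
     (\<forall>e. edge_multiplicity \<sigma> e \<le> 1)"

definition final_edges :: "update list \<Rightarrow> nat set set" where
  "final_edges \<sigma> = {e. edge_multiplicity \<sigma> e = 1}"

definition density :: "nat set set \<Rightarrow> nat set \<Rightarrow> real" where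
  "density E U = real (card {e \<in> E. e \<subseteq> U}) / real (card U)"

definition max_density :: "nat \<Rightarrow> nat set set \<Rightarrow> real" where
  "max_density n E = Max (density E ` {U. U \<subseteq> {..<n} \<and> U \<noteq> {}})"

definition approximates :: "real \<Rightarrow> real \<Rightarrow> real \<Rightarrow> bool" where
  "approximates \<epsilon> d x \<longleftrightarrow> d / (1 + \<epsilon>) \<le> x \<and> x \<le> (1 + \<epsilon>) * d"


section \<open>Randomized random access machines with logarithmic cost\<close>

text \<open>
  Registers hold natural numbers of arbitrary size; time and space are charged by the bit
  lengths of all numbers and register addresses involved.  Hence no word size has to be
  fixed, and both resources are measured in bits (bit operations).
\<close>

type_synonym memory = "nat \<Rightarrow> nat"

abbreviation bits :: "nat \<Rightarrow> nat" where
  "bits x \<equiv> floorlog 2 x"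

text \<open>
  A memory is charged as a list of pairs of an address and a nonzero content.  Only finitely
  many registers are ever nonzero, because all runs start from such memories.
\<close>

definition memory_bits :: "memory \<Rightarrow> nat" where
  "memory_bits m = (\<Sum>r | m r \<noteq> 0. bits r + bits (m r))"

datatype binop = Plus | Minus | Times | Div | Mod

fun apply_op :: "binop \<Rightarrow> nat \<Rightarrow> nat \<Rightarrow> nat" where
  "apply_op Plus x y = x + y"
| "apply_op Minus x y = x - y"
| "apply_op Times x y = x * y"
| "apply_op Div x y = x div y"
| "apply_op Mod x y = x mod y"

datatype expr = Const nat | Reg expr | Op binop expr expr

fun eval_expr :: "expr \<Rightarrow> memory \<Rightarrow> nat" where
  "eval_expr (Const k) m = k"
| "eval_expr (Reg e) m = m (eval_expr e m)"
| "eval_expr (Op f e1 e2) m = apply_op f (eval_expr e1 m) (eval_expr e2 m)"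

fun expr_time :: "expr \<Rightarrow> memory \<Rightarrow> nat" where
  "expr_time (Const k) m = 1 + bits k"
| "expr_time (Reg e) m = 1 + expr_time e m + bits (eval_expr e m) + bits (m (eval_expr e m))"
| "expr_time (Op f e1 e2) m =
     1 + expr_time e1 m + expr_time e2 m + bits (eval_expr e1 m) + bits (eval_expr e2 m)"

text \<open>
  \<open>Assign a e\<close> stores the value of \<open>e\<close> in the register whose address is the value of \<open>a\<close>;
  \<open>Flip a\<close> stores a fair random bit there.  Conditions are true when nonzero.
\<close>

datatype com =
    Skip
  | Assign expr expr
  | Flip expr
  | Seq com com
  | If expr com com
  | While expr com

text \<open>
  \<open>exec c m xs t s m'\<close>: started in memory \<open>m\<close>, the program \<open>c\<close> terminates in memory \<open>m'\<close>
  after consuming exactly the coin flips \<open>xs\<close>, with running time \<open>t\<close> and peak space \<open>s\<close>.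
  Intermediate values of expressions are not charged as space; since the expressions of a
  program are fixed, they only contribute a constant factor.
\<close>

inductive exec :: "com \<Rightarrow> memory \<Rightarrow> bool list \<Rightarrow> nat \<Rightarrow> nat \<Rightarrow> memory \<Rightarrow> bool" where
  Skip: "exec Skip m [] 1 (memory_bits m) m"
| Assign: "\<lbrakk>r = eval_expr a m; x = eval_expr e m; m' = m(r := x)\<rbrakk> \<Longrightarrow>
     exec (Assign a e) m [] (1 + expr_time a m + expr_time e m + bits r + bits x)
       (max (memory_bits m) (memory_bits m')) m'"
| Flip: "\<lbrakk>r = eval_expr a m; m' = m(r := of_bool b)\<rbrakk> \<Longrightarrow>
     exec (Flip a) m [b] (2 + expr_time a m + bits r)
       (max (memory_bits m) (memory_bits m')) m'"
| Seq: "\<lbrakk>exec c1 m xs1 t1 s1 m1; exec c2 m1 xs2 t2 s2 m2\<rbrakk> \<Longrightarrow>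
     exec (Seq c1 c2) m (xs1 @ xs2) (t1 + t2) (max s1 s2) m2"
| IfTrue: "\<lbrakk>eval_expr e m \<noteq> 0; exec c1 m xs t s m'\<rbrakk> \<Longrightarrow>
     exec (If e c1 c2) m xs (1 + expr_time e m + bits (eval_expr e m) + t) s m'"
| IfFalse: "\<lbrakk>eval_expr e m = 0; exec c2 m xs t s m'\<rbrakk> \<Longrightarrow>
     exec (If e c1 c2) m xs (1 + expr_time e m + t) s m'"
| WhileFalse: "eval_expr e m = 0 \<Longrightarrow>
     exec (While e c) m [] (1 + expr_time e m) (memory_bits m) m"
| WhileTrue: "\<lbrakk>eval_expr e m \<noteq> 0; exec c m xs1 t1 s1 m1; exec (While e c) m1 xs2 t2 s2 m2\<rbrakk> \<Longrightarrow>
     exec (While e c) m (xs1 @ xs2)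
       (1 + expr_time e m + bits (eval_expr e m) + t1 + t2) (max s1 s2) m2"


section \<open>Streaming algorithms\<close>

text \<open>
  One fixed program triple serves all inputs.  Between updates nothing but the memory survives,
  so all randomness that is reused has to be stored and is charged as space.
\<close>

datatype streaming_algorithm =
  Streaming_Algorithm (init_prog: com) (update_prog: com) (post_prog: com)

definition initial_memory :: "nat \<Rightarrow> nat \<Rightarrow> memory" where
  "initial_memory n q = (\<lambda>_. 0)(0 := n, 1 := q)"

definition load_update :: "update \<Rightarrow> memory \<Rightarrow> memory" where
  "load_update a m = m(2 := of_bool (is_ins a), 3 := src a, 4 := tgt a)"

text \<open>The time component is the maximum, not the sum, over the updates of the stream.\<close>

inductive exec_updates ::
  "com \<Rightarrow> memory \<Rightarrow> update list \<Rightarrow> bool list \<Rightarrow> nat \<Rightarrow> nat \<Rightarrow> memory \<Rightarrow> bool"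
where
  Nil: "exec_updates c m [] [] 0 (memory_bits m) m"
| Cons: "\<lbrakk>exec c (load_update a m) xs t s m1; exec_updates c m1 \<sigma> xs' t' s' m2\<rbrakk> \<Longrightarrow>
     exec_updates c m (a # \<sigma>) (xs @ xs') (max t t') (max s s') m2"

text \<open>
  \<open>run A n q \<sigma> xs tu tp s m\<close>: on \<open>n\<close> nodes, accuracy parameter \<open>q\<close> and stream \<open>\<sigma>\<close>, the
  algorithm consumes exactly the coin flips \<open>xs\<close> and ends in memory \<open>m\<close>; \<open>tu\<close> is the
  worst update time, \<open>tp\<close> the post-processing time and \<open>s\<close> the peak space over all phases.
  The initialization has to terminate and is charged for space, but not for time.
\<close>

inductive run ::
  "streaming_algorithm \<Rightarrow> nat \<Rightarrow> nat \<Rightarrow> update list \<Rightarrow> bool list \<Rightarrow> nat \<Rightarrow> nat \<Rightarrow> nat \<Rightarrow> memory \<Rightarrow> bool"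
where
  "\<lbrakk>exec (init_prog A) (initial_memory n q) xs1 ti s1 m1;
    exec_updates (update_prog A) m1 \<sigma> xs2 tu s2 m2;
    exec (post_prog A) m2 xs3 tp s3 m3\<rbrakk> \<Longrightarrow>
   run A n q \<sigma> (xs1 @ xs2 @ xs3) tu tp (max s1 (max s2 s3)) m3"

text \<open>
  The real parameter \<open>\<epsilon>\<close> is presented to the machine as the integer \<open>\<lceil>1/\<epsilon>\<rceil>\<close>, which
  determines it up to a constant factor: \<open>2/3 * \<epsilon> \<le> 1/\<lceil>1/\<epsilon>\<rceil> \<le> \<epsilon>\<close> for \<open>0 < \<epsilon> < 1/2\<close>.
\<close>

definition accuracy_parameter :: "real \<Rightarrow> nat" where
  "accuracy_parameter \<epsilon> = nat \<lceil>1 / \<epsilon>\<rceil>"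

text \<open>The output is the rational number with numerator in register 0 and denominator in register 1.\<close>

definition outputs_approximation :: "real \<Rightarrow> real \<Rightarrow> memory \<Rightarrow> bool" where
  "outputs_approximation \<epsilon> d m \<longleftrightarrow> m 1 \<noteq> 0 \<and> approximates \<epsilon> d (real (m 0) / real (m 1))"

definition coin_space :: "bool stream measure" where
  "coin_space = stream_space (measure_pmf (bernoulli_pmf (1 / 2)))"

text \<open>The summand 1 keeps the bounds meaningful at \<open>n = 1\<close>; it is immaterial for \<open>n \<ge> 2\<close>.\<close>

definition polylog :: "nat \<Rightarrow> nat \<Rightarrow> real" where
  "polylog k n = (1 + log 2 (real n)) ^ k"


section \<open>Determinism\<close>

text \<open>For a given infinite sequence of coins there is at most one run.\<close>

lemma exec_deterministic:
  "exec c m xs t s m' \<Longrightarrow> exec c m ys t' s' m'' \<Longrightarrow> xs @ us = ys @ vs \<Longrightarrow>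
   xs = ys \<and> t = t' \<and> s = s' \<and> m' = m''"
proof (induction arbitrary: ys t' s' m'' us vs rule: exec.induct)
  case (Seq c1 m xs1 t1 s1 m1 c2 xs2 t2 s2 m2)
  from Seq.prems(1) show ?case
  proof cases
    case S: (Seq ys1 t1' s1' m1' ys2 t2' s2')
    have *: "xs1 = ys1 \<and> t1 = t1' \<and> s1 = s1' \<and> m1 = m1'"
      by (rule Seq.IH(1)[where us = "xs2 @ us" and vs = "ys2 @ vs"]) (use S Seq.prems in auto)
    have "xs2 = ys2 \<and> t2 = t2' \<and> s2 = s2' \<and> m2 = m''"
      by (rule Seq.IH(2)[where us = us and vs = vs]) (use * S Seq.prems in auto)
    with * S show ?thesis by auto
  qed
next
  case (WhileTrue e m c xs1 t1 s1 m1 xs2 t2 s2 m2)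
  from WhileTrue.prems(1) show ?case
  proof cases
    case S: WhileFalse
    then show ?thesis
      using WhileTrue.hyps by simp
  next
    case S: (WhileTrue ys1 t1' s1' m1' ys2 t2' s2')
    have *: "xs1 = ys1 \<and> t1 = t1' \<and> s1 = s1' \<and> m1 = m1'"
      by (rule WhileTrue.IH(1)[where us = "xs2 @ us" and vs = "ys2 @ vs"])
        (use S WhileTrue.prems in auto)
    have "xs2 = ys2 \<and> t2 = t2' \<and> s2 = s2' \<and> m2 = m''"
      by (rule WhileTrue.IH(2)[where us = us and vs = vs]) (use * S WhileTrue.prems in auto)
    with * S show ?thesis by auto
  qed
next
  case (IfTrue e m c1 xs t s m' c2)
  from IfTrue.prems(1) show ?case
  proof cases
    case S: (IfTrue u)
    show ?thesis
      using IfTrue.IH[OF S(3) IfTrue.prems(2)] S(1) by simp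
  next
    case S: IfFalse
    then show ?thesis
      using IfTrue.hyps by simp
  qed
next
  case (IfFalse e m c2 xs t s m' c1)
  from IfFalse.prems(1) show ?case
  proof cases
    case S: IfTrue
    then show ?thesis
      using IfFalse.hyps by simp
  next
    case S: (IfFalse u)
    show ?thesis
      using IfFalse.IH[OF S(3) IfFalse.prems(2)] S(1) by simp
  qed
next
  case (Skip m)
  from Skip.prems(1) show ?case
    by cases auto
next
  case (Assign r a m x e m')
  from Assign.prems(1) Assign.hyps show ?case
    by cases auto
next
  case (Flip r a m m' b)
  from Flip.prems(1) Flip.prems(2) Flip.hyps show ?case
    by cases auto
next
  case (WhileFalse e m c)
  from WhileFalse.prems(1) WhileFalse.hyps show ?case
    by cases auto
qed

lemma exec_updates_deterministic:
  "exec_updates c m \<sigma> xs t s m' \<Longrightarrow> exec_updates c m \<sigma> ys t' s' m'' \<Longrightarrow> xs @ us = ys @ vs \<Longrightarrow>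
   xs = ys \<and> t = t' \<and> s = s' \<and> m' = m''"
proof (induction arbitrary: ys t' s' m'' us vs rule: exec_updates.induct)
  case (Cons c a m xs1 t1 s1 m1 \<sigma> xs2 t2 s2 m2)
  from Cons.prems(1) show ?case
  proof cases
    case S: (Cons ys1 t1' s1' m1' ys2 t2' s2')
    have *: "xs1 = ys1 \<and> t1 = t1' \<and> s1 = s1' \<and> m1 = m1'"
      by (rule exec_deterministic[OF Cons.hyps(1) S(4), where us = "xs2 @ us" and vs = "ys2 @ vs"])
        (use S Cons.prems in auto)
    have "xs2 = ys2 \<and> t2 = t2' \<and> s2 = s2' \<and> m2 = m''"
      by (rule Cons.IH[where us = us and vs = vs]) (use * S Cons.prems in auto)
    with * S show ?thesis by auto
  qed
next
  case (Nil c m)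
  from Nil.prems(1) show ?case
    by cases auto
qed

lemma run_deterministic:
  assumes "run A n q \<sigma> (stake j \<omega>) tu tp s m" "run A n q \<sigma> (stake j' \<omega>) tu' tp' s' m'"
  shows "j = j' \<and> tu = tu' \<and> tp = tp' \<and> s = s' \<and> m = m'"
proof -
  have "stake j \<omega> @ stake j' (sdrop j \<omega>) = stake j' \<omega> @ stake j (sdrop j' \<omega>)"
    by (simp add: stake_add add.commute)
  moreover obtain xs1 ti s1 m1 xs2 s2 m2 xs3 s3 where a: "stake j \<omega> = xs1 @ xs2 @ xs3"
      "s = max s1 (max s2 s3)" "exec (init_prog A) (initial_memory n q) xs1 ti s1 m1"
      "exec_updates (update_prog A) m1 \<sigma> xs2 tu s2 m2" "exec (post_prog A) m2 xs3 tp s3 m"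
    using assms(1) by (auto elim: run.cases)
  moreover obtain ys1 ti' s1' m1' ys2 s2' m2' ys3 s3' where b: "stake j' \<omega> = ys1 @ ys2 @ ys3"
      "s' = max s1' (max s2' s3')" "exec (init_prog A) (initial_memory n q) ys1 ti' s1' m1'"
      "exec_updates (update_prog A) m1' \<sigma> ys2 tu' s2' m2'" "exec (post_prog A) m2' ys3 tp' s3' m'"
    using assms(2) by (auto elim: run.cases)
  ultimately have eq: "xs1 @ xs2 @ xs3 @ stake j' (sdrop j \<omega>) = ys1 @ ys2 @ ys3 @ stake j (sdrop j' \<omega>)"
    by simp
  note 1 = exec_deterministic[OF a(3) b(3) eq]
  have "exec_updates (update_prog A) m1 \<sigma> ys2 tu' s2' m2'" using 1 b(4) by simp
  note 2 = exec_updates_deterministic[OF a(4) this, where us = "xs3 @ stake j' (sdrop j \<omega>)"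
      and vs = "ys3 @ stake j (sdrop j' \<omega>)"]
  have 2: "xs2 = ys2 \<and> tu = tu' \<and> s2 = s2' \<and> m2 = m2'" using 2 1 eq by simp
  have "exec (post_prog A) m2 ys3 tp' s3' m'" using 2 b(5) by simp
  note 3 = exec_deterministic[OF a(5) this, where us = "stake j' (sdrop j \<omega>)"
      and vs = "stake j (sdrop j' \<omega>)"]
  have 3: "xs3 = ys3 \<and> tp = tp' \<and> s3 = s3' \<and> m = m'" using 3 2 1 eq by simp
  have "length (stake j \<omega>) = length (stake j' \<omega>)" using a(1) b(1) 1 2 3 by simp
  then show ?thesis using 1 2 3 a(2) b(2) by simp
qed

end

(*
  Colour every vertex at random with w bits.  On level j keep the edges whose endpoints agree in the
  last j bits, i.e. each edge with probability p = 2^-j.  Given the colour of a vertex u, the edges at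
  u are kept independently, so a Chernoff bound per vertex applies.  No union bound over vertex sets is
  needed.  From above, the edges of the graph can be split fractionally between their endpoints
  such that every vertex receives at most d* (up to a negligible error); this certificate survives
  the sampling up to a factor 1 + delta.  From below, every vertex of an optimal set U has degree at
  least d* inside U, and all these degrees shrink by a factor of at least (1 - delta) p.

  The kept edges of each level are stored in a linear sketch: they are hashed into buckets, several
  times independently, and each bucket stores the sum of the codes N + id of its edges modulo M.  The
  final multiplicities are 0 or 1, so the sum reveals the number of edges in the bucket, and the id
  itself if there is only one.  A counter per level tells whether all edges have been decoded.  On the
  first level with this property, the exact maximum density is found by local search: b = n^4 units of
  weight per edge are moved from heavier to lighter endpoints until all loads along an edge are
  balanced.  Then the maximum load L satisfies (L - n) / b <= d <= L / b, and d is the only fraction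
  with denominator at most n in this interval.
*)

theory Submission
  imports Defs
begin

section \<open>Averages over coin sequences\<close>

text \<open>Stored randomness shapes the construction: reused coins count as space, so the edges
  cannot have random bits of their own. Colours and hash values are indexed by vertices, which makes
  edges around a cycle dependent; only the star of one vertex is tractable, so both density bounds
  are phrased through stars. With \<delta> = 1/(3q) and \<tau> = 180 q^2 l, a star sum with mean
  about \<tau> deviates with probability at most exp(-5l), since \<tau> \<delta>^2 / 4 = 5l. The
  level J aimed at is the first with d / 2^J < 2 \<tau>, where d is the maximum density. Fewer than
  4 n \<tau> edges then remain, and more than 8 n \<tau> = 1440 n q^2 l buckets make an edge collide
  with probability at most 1/2 per repetition. The program does not know J and may stop earlier, so
  concentration is needed on all levels from 1 to J. Sums are kept modulo M because multiplicities
  can grow without bound during the stream. The accuracy q is capped at n, so that the word length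
  depends on n only; when the cap is active, success means that level 0 decodes and the answer is
  exact.\<close>

primrec avg :: "nat \<Rightarrow> (bool list \<Rightarrow> real) \<Rightarrow> real" where
  "avg 0 F = F []"
| "avg (Suc k) F = (avg k (\<lambda>xs. F (True # xs)) + avg k (\<lambda>xs. F (False # xs))) / 2"

lemma avg_mono: "(\<And>xs. length xs = k \<Longrightarrow> F xs \<le> G xs) \<Longrightarrow> avg k F \<le> avg k G"
proof (induction k arbitrary: F G)
  case (Suc k)
  have "avg k (\<lambda>xs. F (b # xs)) \<le> avg k (\<lambda>xs. G (b # xs))" for b
    by (rule Suc.IH) (simp add: Suc.prems)
  then show ?case by (simp add: add_mono)
qed simp

lemma avg_cong: "(\<And>xs. length xs = k \<Longrightarrow> F xs = G xs) \<Longrightarrow> avg k F = avg k G"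
  by (intro antisym avg_mono) auto

lemma avg_const [simp]: "avg k (\<lambda>_. c) = c"
  by (induction k) auto

lemma avg_add: "avg k (\<lambda>xs. F xs + G xs) = avg k F + avg k G"
  by (induction k arbitrary: F G) (auto simp: field_simps)

lemma avg_mult_left: "avg k (\<lambda>xs. c * F xs) = c * avg k F"
  by (induction k arbitrary: F) (auto simp: field_simps)

lemma avg_mult_right: "avg k (\<lambda>xs. F xs * c) = avg k F * c"
  using avg_mult_left[of k c F] by (simp add: mult.commute)

lemma avg_sum: "avg k (\<lambda>xs. \<Sum>i\<in>I. F i xs) = (\<Sum>i\<in>I. avg k (F i))"
  by (induction I rule: infinite_finite_induct) (auto simp: avg_add)

lemma avg_append: "avg (k + l) F = avg k (\<lambda>xs. avg l (\<lambda>ys. F (xs @ ys)))"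
  by (induction k arbitrary: F) auto

lemma avg_snoc: "avg (Suc k) F = avg k (\<lambda>xs. (F (xs @ [True]) + F (xs @ [False])) / 2)"
  using avg_append[of k 1 F] by simp

lemma avg_swap: "avg k (\<lambda>xs. avg l (\<lambda>ys. F xs ys)) = avg l (\<lambda>ys. avg k (\<lambda>xs. F xs ys))"
proof (induction k arbitrary: F)
  case (Suc k)
  have *: "avg l (\<lambda>ys. (G ys + H ys) / 2) = (avg l G + avg l H) / 2" for G H
    using avg_mult_right[of l "\<lambda>ys. G ys + H ys" "1/2"] by (simp add: avg_add)
  show ?case by (simp add: Suc *)
qed simp

text \<open>Disjoint blocks of coins are independent, so the expectation of a product factors. This
  one fact yields both the independent table entries and the independent repetitions of the
  hashing.\<close>

lemma avg_blocks:
  "avg (c * l) (\<lambda>xs. \<Prod>i<c. g i (take l (drop (i * l) xs))) = (\<Prod>i<c. avg l (g i))"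
proof (induction c)
  case (Suc c)
  have "avg (Suc c * l) (\<lambda>xs. \<Prod>i<Suc c. g i (take l (drop (i * l) xs))) =
      avg (c * l) (\<lambda>xs. avg l (\<lambda>ys. (\<Prod>i<c. g i (take l (drop (i * l) xs))) * g c ys))"
    unfolding mult_Suc add.commute[of l "c * l"] avg_append
  proof (intro avg_cong)
    fix xs ys :: "bool list" assume l: "length xs = c * l" "length ys = l"
    have "take l (drop (i * l) (xs @ ys)) = take l (drop (i * l) xs)" if "i < c" for i
    proof -
      have "Suc i * l \<le> c * l" using that by (intro mult_right_mono) auto
      then show ?thesis using l by simp
    qed
    then have "(\<Prod>i<c. g i (take l (drop (i * l) (xs @ ys)))) =
        (\<Prod>i<c. g i (take l (drop (i * l) xs)))"
      by (intro prod.cong) (auto simp del: drop_append take_append)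
    then show "(\<Prod>i<Suc c. g i (take l (drop (i * l) (xs @ ys)))) =
        (\<Prod>i<c. g i (take l (drop (i * l) xs))) * g c ys"
      using l by simp
  qed
  then show ?case by (simp add: avg_mult_left avg_mult_right Suc)
qed simp

text \<open>Any function that dominates the indicator will do: an exponential gives Chernoff bounds,
  a sum of indicators gives union bounds.\<close>

lemma avg_Markov:
  assumes "\<And>xs. length xs = k \<Longrightarrow> 0 \<le> F xs" "\<And>xs. length xs = k \<Longrightarrow> P xs \<Longrightarrow> 1 \<le> F xs"
  shows "avg k (\<lambda>xs. of_bool (P xs)) \<le> avg k F"
  by (rule avg_mono) (use assms in \<open>auto simp: of_bool_def\<close>)

section \<open>Transfer between infinite coin sequences and finite averages\<close>

interpretation coins: prob_space coin_space
  unfolding coin_space_def by (rule prob_space.prob_space_stream_space[OF prob_space_measure_pmf])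

lemma sets_coin_space: "sets coin_space = sets (stream_space (count_space UNIV))"
  unfolding coin_space_def by (rule sets_stream_space_cong) simp

lemma space_coin_space [simp]: "space coin_space = UNIV"
  unfolding coin_space_def by (simp add: space_stream_space)

lemma measurable_stake_coin_space: "stake k \<in> measurable coin_space (count_space UNIV)"
proof -
  have "measurable coin_space (count_space UNIV) =
      measurable (stream_space (count_space (UNIV :: bool set))) (count_space (UNIV :: bool list set))"
    by (rule measurable_cong_sets) (simp_all add: sets_coin_space)
  then show ?thesis using measurable_stake by simp
qed

lemma sets_stake: "{\<omega>. P (stake k \<omega>)} \<in> sets coin_space"
  using measurable_sets[OF measurable_stake_coin_space, of "{xs. P xs}" k] by (simp add: vimage_def)

text \<open>\<open>prob_stream_space\<close> splits off the first coin, which is exactly the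
  recursion of \<open>avg\<close>. This is the only bridge from the stream measure to finite
  averages.\<close>

lemma measure_stake: "measure coin_space {\<omega>. P (stake k \<omega>)} = avg k (\<lambda>xs. of_bool (P xs))"
proof (induction k arbitrary: P)
  case 0
  then show ?case using coins.prob_space by (simp add: of_bool_def)
next
  case (Suc k)
  have "ennreal (measure coin_space {\<omega>. P (stake (Suc k) \<omega>)}) =
    (\<integral>\<^sup>+b. ennreal (measure coin_space {\<omega>. P (stake (Suc k) (b ## \<omega>))}) \<partial>measure_pmf (bernoulli_pmf (1 / 2)))"
    using prob_space.prob_stream_space[OF prob_space_measure_pmf[of "bernoulli_pmf (1 / 2)"],
        where P = "\<lambda>\<omega>. P (stake (Suc k) \<omega>)"]
      sets_stake[of P "Suc k"]
    unfolding coin_space_def by (simp add: space_stream_space)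
  also have "\<dots> = ennreal (avg (Suc k) (\<lambda>xs. of_bool (P xs)))"
  proof -
    have "ennreal x * inverse 2 + ennreal y * inverse 2 = ennreal ((x + y) / 2)" if "0 \<le> x" "0 \<le> y" for x y
    proof -
      have "ennreal ((x + y) / 2) = ennreal (x + y) / ennreal 2" using that by (intro divide_ennreal[symmetric]) auto
      then show ?thesis using that by (simp add: divide_ennreal_def distrib_right)
    qed
    then show ?thesis
      by (simp add: Suc[of "\<lambda>xs. P (True # xs)", symmetric] Suc[of "\<lambda>xs. P (False # xs)", symmetric])
  qed
  finally show ?case
    by (simp add: Suc[of "\<lambda>xs. P (True # xs)", symmetric] Suc[of "\<lambda>xs. P (False # xs)", symmetric]
      del: stake.simps)
qed

section \<open>Maximum density and balanced orientations\<close>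

text \<open>The index type is arbitrary because the theory is applied twice: to vertex pairs with
  \<open>fst\<close> and \<open>snd\<close> in the sampling analysis, and to positions of the
  decoded list in the program.\<close>

definition inner_edges :: "'i set \<Rightarrow> ('i \<Rightarrow> nat) \<Rightarrow> ('i \<Rightarrow> nat) \<Rightarrow> nat set \<Rightarrow> 'i set" where
  "inner_edges I s t U = {i \<in> I. s i \<in> U \<and> t i \<in> U}"

definition max_dens :: "nat \<Rightarrow> 'i set \<Rightarrow> ('i \<Rightarrow> nat) \<Rightarrow> ('i \<Rightarrow> nat) \<Rightarrow> real" where
  "max_dens n I s t = Max ((\<lambda>U. real (card (inner_edges I s t U)) / real (card U)) `
     {U. U \<subseteq> {..<n} \<and> U \<noteq> {}})"

lemma finite_vertex_sets: "finite {U. U \<subseteq> {..<n :: nat} \<and> U \<noteq> {}}"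
  by (rule finite_subset[of _ "Pow {..<n}"]) auto

lemma max_dens_le_iff:
  assumes "n \<ge> 1"
  shows "max_dens n I s t \<le> x \<longleftrightarrow>
    (\<forall>U. U \<subseteq> {..<n} \<longrightarrow> U \<noteq> {} \<longrightarrow> real (card (inner_edges I s t U)) \<le> x * real (card U))"
proof -
  have "{..<n} \<noteq> {}" using assms by (simp add: lessThan_empty_iff)
  then have "{U. U \<subseteq> {..<n} \<and> U \<noteq> {}} \<noteq> {}" by blast
  moreover have "real (card (inner_edges I s t U)) / real (card U) \<le> x \<longleftrightarrow>
      real (card (inner_edges I s t U)) \<le> x * real (card U)" if "U \<subseteq> {..<n}" "U \<noteq> {}" for U
    using that finite_subset[of U "{..<n}"] by (subst divide_le_eq) (auto simp: card_gt_0_iff)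
  ultimately show ?thesis
    unfolding max_dens_def using finite_vertex_sets[of n] by (subst Max_le_iff) auto
qed

lemma max_dens_obtain:
  assumes "n \<ge> 1"
  obtains U where "U \<subseteq> {..<n}" "U \<noteq> {}"
    "max_dens n I s t = real (card (inner_edges I s t U)) / real (card U)"
proof -
  have "{..<n} \<noteq> {}" using assms by (simp add: lessThan_empty_iff)
  then have "{U. U \<subseteq> {..<n} \<and> U \<noteq> {}} \<noteq> {}" by blast
  then have "max_dens n I s t \<in> (\<lambda>U. real (card (inner_edges I s t U)) / real (card U)) `
     {U. U \<subseteq> {..<n} \<and> U \<noteq> {}}"
    unfolding max_dens_def by (intro Max_in) (use finite_vertex_sets[of n] in auto)
  then show ?thesis using that by blast
qed

lemma max_dens_ge:
  assumes "n \<ge> 1" "U \<subseteq> {..<n}" "U \<noteq> {}"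
  shows "real (card (inner_edges I s t U)) \<le> max_dens n I s t * real (card U)"
  using max_dens_le_iff[OF assms(1), of I s t "max_dens n I s t"] assms by blast

lemma max_dens_nonneg: "n \<ge> 1 \<Longrightarrow> 0 \<le> max_dens n I s t"
  by (rule max_dens_obtain[of n I s t]) auto

lemma max_dens_cong:
  assumes "bij_betw h I J" "\<And>i. i \<in> I \<Longrightarrow> s i = s' (h i) \<and> t i = t' (h i)"
  shows "max_dens n I s t = max_dens n J s' t'"
proof -
  have "card (inner_edges I s t U) = card (inner_edges J s' t' U)" for U
  proof (rule bij_betw_same_card)
    show "bij_betw h (inner_edges I s t U) (inner_edges J s' t' U)"
      using assms unfolding inner_edges_def bij_betw_def inj_on_def by (auto simp: image_iff)
  qed
  then show ?thesis by (simp add: max_dens_def)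
qed

text \<open>
  Each edge carries \<open>b\<close> units of weight, \<open>X i\<close> of them assigned to the endpoint \<open>s i\<close> and the
  other ones to \<open>t i\<close>.
\<close>

definition load :: "'i set \<Rightarrow> ('i \<Rightarrow> nat) \<Rightarrow> ('i \<Rightarrow> nat) \<Rightarrow> nat \<Rightarrow> ('i \<Rightarrow> nat) \<Rightarrow> nat \<Rightarrow> nat" where
  "load I s t b X w = (\<Sum>i\<in>I. (if s i = w then X i else 0) + (if t i = w then b - X i else 0))"

text \<open>The tolerance 1 is what local search can achieve: moving a unit lowers the sum of
  squared loads only across a gap of at least two.\<close>

definition stable :: "'i set \<Rightarrow> ('i \<Rightarrow> nat) \<Rightarrow> ('i \<Rightarrow> nat) \<Rightarrow> nat \<Rightarrow> ('i \<Rightarrow> nat) \<Rightarrow> bool" where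
  "stable I s t b X \<longleftrightarrow> (\<forall>i\<in>I.
     (X i > 0 \<longrightarrow> load I s t b X (s i) \<le> load I s t b X (t i) + 1) \<and>
     (X i < b \<longrightarrow> load I s t b X (t i) \<le> load I s t b X (s i) + 1))"

definition balance :: "'i set \<Rightarrow> ('i \<Rightarrow> nat) \<Rightarrow> ('i \<Rightarrow> nat) \<Rightarrow> nat \<Rightarrow> 'i \<Rightarrow> ('i \<Rightarrow> nat) \<Rightarrow> 'i \<Rightarrow> nat" where
  "balance I s t b i X =
    (if X i > 0 \<and> load I s t b X (s i) > load I s t b X (t i) + 1 then X(i := X i - 1)
     else if X i < b \<and> load I s t b X (t i) > load I s t b X (s i) + 1 then X(i := X i + 1)
     else X)"

locale edge_family =
  fixes I :: "'i set" and s t :: "'i \<Rightarrow> nat" and n :: nat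
  assumes finite_I: "finite I" and n_pos: "n \<ge> 1"
    and edge: "\<And>i. i \<in> I \<Longrightarrow> s i < n \<and> t i < n \<and> s i \<noteq> t i"
begin

lemma sum_load:
  assumes "U \<subseteq> {..<n}"
  shows "(\<Sum>w\<in>U. load I s t b X w) =
    (\<Sum>i\<in>I. (if s i \<in> U then X i else 0) + (if t i \<in> U then b - X i else 0))"
proof -
  have fU: "finite U" using assms finite_subset by blast
  have "(\<Sum>w\<in>U. load I s t b X w) =
      (\<Sum>i\<in>I. \<Sum>w\<in>U. (if s i = w then X i else 0) + (if t i = w then b - X i else 0))"
    unfolding load_def by (rule sum.swap)
  then show ?thesis using fU by (simp add: sum.distrib)
qed

text \<open>An edge inside \<open>U\<close> has both of its shares counted, that is all
  \<open>b\<close> units. This is weak duality between orientations and densities.\<close>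

lemma inner_edges_le_load:
  assumes "\<And>i. i \<in> I \<Longrightarrow> X i \<le> b" "U \<subseteq> {..<n}"
  shows "b * card (inner_edges I s t U) \<le> (\<Sum>w\<in>U. load I s t b X w)"
proof -
  have "b * card (inner_edges I s t U) = (\<Sum>i\<in>I. if s i \<in> U \<and> t i \<in> U then b else 0)"
    using finite_I by (simp add: inner_edges_def sum.If_cases Int_def)
  also have "\<dots> \<le> (\<Sum>w\<in>U. load I s t b X w)"
    unfolding sum_load[OF assms(2)] by (rule sum_mono) (use assms(1) in auto)
  finally show ?thesis .
qed

lemma total_load:
  assumes "\<And>i. i \<in> I \<Longrightarrow> X i \<le> b"
  shows "(\<Sum>w<n. load I s t b X w) = b * card I"
proof -
  have "(\<Sum>w<n. load I s t b X w) = (\<Sum>i\<in>I. b)"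
    unfolding sum_load[OF order_refl] by (rule sum.cong) (use edge assms in auto)
  then show ?thesis by simp
qed

lemma load_le:
  assumes "\<And>i. i \<in> I \<Longrightarrow> X i \<le> b" "w < n"
  shows "load I s t b X w \<le> b * card I"
proof -
  have "load I s t b X w \<le> (\<Sum>w<n. load I s t b X w)"
    by (rule member_le_sum) (use assms(2) in auto)
  then show ?thesis using total_load[OF assms(1)] by simp
qed

text \<open>
  Some level set \<open>S = {w. load w \<ge> L - k}\<close> with \<open>k < n\<close> does not grow when \<open>k\<close> increases by one.
  By stability all units assigned to vertices of \<open>S\<close> then come from edges inside \<open>S\<close>.
\<close>

lemma stable_dense_set:
  assumes X: "\<And>i. i \<in> I \<Longrightarrow> X i \<le> b" and st: "stable I s t b X"
    and L: "L = Max (load I s t b X ` {..<n})"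
  obtains S where "S \<subseteq> {..<n}" "S \<noteq> {}" "(L - n) * card S \<le> b * card (inner_edges I s t S)"
proof -
  define l where "l = load I s t b X"
  define S where "S k = {w. w < n \<and> L \<le> l w + k}" for k
  have fin: "finite (S k)" for k by (auto simp: S_def)
  have mono: "S k \<subseteq> S (Suc k)" for k by (auto simp: S_def)
  have "L \<in> l ` {..<n}"
    unfolding L l_def by (rule Max_in) (use n_pos in \<open>auto simp: lessThan_empty_iff\<close>)
  then obtain w0 where w0: "w0 < n" "l w0 = L" by auto
  have ne: "w0 \<in> S k" for k using w0 by (auto simp: S_def)
  have "\<exists>k<n. S k = S (Suc k)"
  proof (rule ccontr)
    assume *: "\<not> (\<exists>k<n. S k = S (Suc k))"
    \<comment> \<open>Strict growth in all \<open>n\<close> steps would give \<open>S n\<close> more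
      than \<open>n\<close> vertices.\<close>
    have "k \<le> n \<Longrightarrow> k < card (S k)" for k
    proof (induction k)
      case 0
      then show ?case using ne[of 0] fin[of 0] by (auto simp: card_gt_0_iff)
    next
      case (Suc k)
      then have "S k \<subset> S (Suc k)" using * mono[of k] by auto
      from psubset_card_mono[OF fin this] Suc show ?case by simp
    qed
    moreover have "card (S n) \<le> card {..<n}" by (rule card_mono) (auto simp: S_def)
    ultimately show False by force
  qed
  then obtain k where k: "k < n" "S k = S (Suc k)" by blast
  have SU: "S k \<subseteq> {..<n}" by (auto simp: S_def)
  have closed: "(if s i \<in> S k then X i else 0) + (if t i \<in> S k then b - X i else 0)
      \<le> (if s i \<in> S k \<and> t i \<in> S k then b else 0)" if i: "i \<in> I" for i
  proof -
    have "t i \<in> S (Suc k)" if "s i \<in> S k" "X i > 0"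
      using that st i edge[OF i] by (fastforce simp: S_def stable_def l_def)
    moreover have "s i \<in> S (Suc k)" if "t i \<in> S k" "X i < b"
      using that st i edge[OF i] by (fastforce simp: S_def stable_def l_def)
    ultimately show ?thesis using k(2) X[OF i] by (cases "X i = 0"; cases "X i < b") auto
  qed
  have "(L - n) * card (S k) = (\<Sum>w\<in>S k. L - n)" by simp
  also have "\<dots> \<le> (\<Sum>w\<in>S k. l w)" by (rule sum_mono) (use k(1) in \<open>auto simp: S_def\<close>)
  also have "\<dots> \<le> (\<Sum>i\<in>I. if s i \<in> S k \<and> t i \<in> S k then b else 0)"
    unfolding l_def sum_load[OF SU] by (rule sum_mono) (rule closed)
  also have "\<dots> = b * card (inner_edges I s t (S k))"
    using finite_I by (simp add: inner_edges_def sum.If_cases Int_def)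
  finally show ?thesis using that[OF SU _] ne[of k] by blast
qed

text \<open>The set of \<open>stable_dense_set\<close> bounds the density from below. From above, no
  load exceeds \<open>L\<close>, and summing the loads over any vertex set bounds its inner
  edges.\<close>

lemma stable_max_dens:
  assumes X: "\<And>i. i \<in> I \<Longrightarrow> X i \<le> b" and st: "stable I s t b X" and b: "b > 0"
    and L: "L = Max (load I s t b X ` {..<n})"
  shows "real (L - n) \<le> real b * max_dens n I s t" "real b * max_dens n I s t \<le> real L"
proof -
  obtain S where S: "S \<subseteq> {..<n}" "S \<noteq> {}" "(L - n) * card S \<le> b * card (inner_edges I s t S)"
    using stable_dense_set[OF X st L] by blast
  have cS: "card S > 0" using S(1,2) finite_subset[of S "{..<n}"] by (auto simp: card_gt_0_iff)
  have "real (L - n) * real (card S) \<le> real b * real (card (inner_edges I s t S))"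
    using S(3) unfolding of_nat_mult[symmetric] of_nat_le_iff .
  also have "\<dots> \<le> real b * (max_dens n I s t * real (card S))"
    using max_dens_ge[OF n_pos S(1,2)] by (intro mult_left_mono) auto
  finally show "real (L - n) \<le> real b * max_dens n I s t" using cS by simp
next
  have "real (card (inner_edges I s t U)) \<le> real L / real b * real (card U)"
    if U: "U \<subseteq> {..<n}" for U
  proof -
    have "b * card (inner_edges I s t U) \<le> (\<Sum>w\<in>U. load I s t b X w)"
      by (rule inner_edges_le_load[OF X U])
    also have "\<dots> \<le> (\<Sum>w\<in>U. L)" by (rule sum_mono) (use U in \<open>auto simp: L\<close>)
    finally have "b * card (inner_edges I s t U) \<le> card U * L" by simp
    then have "real b * real (card (inner_edges I s t U)) \<le> real (card U) * real L"
      unfolding of_nat_mult[symmetric] of_nat_le_iff .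
    then show ?thesis using b by (simp add: field_simps)
  qed
  then have "max_dens n I s t \<le> real L / real b" using max_dens_le_iff[OF n_pos] by blast
  then show "real b * max_dens n I s t \<le> real L" using b by (simp add: field_simps)
qed

lemma load_dec:
  assumes i: "i \<in> I" "0 < X i" "X i \<le> b"
  shows "load I s t b (X(i := X i - 1)) =
    (load I s t b X)(s i := load I s t b X (s i) - 1, t i := load I s t b X (t i) + 1)"
proof
  fix w
  have rest: "(\<Sum>j\<in>I - {i}. (if s j = w then (X(i := X i - 1)) j else 0) + (if t j = w then b - (X(i := X i - 1)) j else 0)) =
      (\<Sum>j\<in>I - {i}. (if s j = w then X j else 0) + (if t j = w then b - X j else 0))"
    by (rule sum.cong) auto
  have "load I s t b (X(i := X i - 1)) w =
      (if s i = w then X i - 1 else 0) + (if t i = w then b - (X i - 1) else 0) +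
      (\<Sum>j\<in>I - {i}. (if s j = w then X j else 0) + (if t j = w then b - X j else 0))"
    unfolding load_def sum.remove[OF finite_I i(1)] rest by simp
  moreover have "load I s t b X w =
      (if s i = w then X i else 0) + (if t i = w then b - X i else 0) +
      (\<Sum>j\<in>I - {i}. (if s j = w then X j else 0) + (if t j = w then b - X j else 0))"
    unfolding load_def by (rule sum.remove[OF finite_I i(1)])
  ultimately show "load I s t b (X(i := X i - 1)) w =
    ((load I s t b X)(s i := load I s t b X (s i) - 1, t i := load I s t b X (t i) + 1)) w"
    using i edge[OF i(1)] by auto
qed

lemma load_inc:
  assumes i: "i \<in> I" "X i < b"
  shows "load I s t b (X(i := X i + 1)) =
    (load I s t b X)(s i := load I s t b X (s i) + 1, t i := load I s t b X (t i) - 1)"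
proof
  fix w
  have rest: "(\<Sum>j\<in>I - {i}. (if s j = w then (X(i := X i + 1)) j else 0) + (if t j = w then b - (X(i := X i + 1)) j else 0)) =
      (\<Sum>j\<in>I - {i}. (if s j = w then X j else 0) + (if t j = w then b - X j else 0))"
    by (rule sum.cong) auto
  have "load I s t b (X(i := X i + 1)) w =
      (if s i = w then X i + 1 else 0) + (if t i = w then b - (X i + 1) else 0) +
      (\<Sum>j\<in>I - {i}. (if s j = w then X j else 0) + (if t j = w then b - X j else 0))"
    unfolding load_def sum.remove[OF finite_I i(1)] rest by simp
  moreover have "load I s t b X w =
      (if s i = w then X i else 0) + (if t i = w then b - X i else 0) +
      (\<Sum>j\<in>I - {i}. (if s j = w then X j else 0) + (if t j = w then b - X j else 0))"
    unfolding load_def by (rule sum.remove[OF finite_I i(1)])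
  ultimately show "load I s t b (X(i := X i + 1)) w =
    ((load I s t b X)(s i := load I s t b X (s i) + 1, t i := load I s t b X (t i) - 1)) w"
    using i edge[OF i(1)] by auto
qed

section \<open>Termination of local search by a quadratic potential\<close>

definition potential :: "nat \<Rightarrow> ('i \<Rightarrow> nat) \<Rightarrow> nat" where
  "potential b X = (\<Sum>w<n. (load I s t b X w)\<^sup>2)"

lemma square_sum_move:
  fixes l :: "nat \<Rightarrow> nat"
  assumes "x < n" "y < n" "x \<noteq> y" "l x > l y + 1"
  shows "(\<Sum>w<n. ((l(x := l x - 1, y := l y + 1)) w)\<^sup>2) < (\<Sum>w<n. (l w)\<^sup>2)"
proof -
  define R where "R = (\<Sum>w\<in>{..<n} - {x} - {y}. (l w)\<^sup>2)"
  have split: "(\<Sum>w<n. (f w)\<^sup>2) = (f x)\<^sup>2 + ((f y)\<^sup>2 + (\<Sum>w\<in>{..<n} - {x} - {y}. (f w)\<^sup>2))" for f :: "nat \<Rightarrow> nat"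
    using assms by (subst sum.remove[of _ x], simp, simp, subst sum.remove[of _ y]) auto
  have "(\<Sum>w\<in>{..<n} - {x} - {y}. ((l(x := l x - 1, y := l y + 1)) w)\<^sup>2) = R"
    unfolding R_def by (rule sum.cong) auto
  \<comment> \<open>The gap between the two loads is \<open>a + 2\<close>, so moving one unit
    changes the sum of squares by \<open>- 2 * (a + 1)\<close>.\<close>
  moreover obtain a where "l x = a + l y + 2" using that[of "l x - l y - 2"] assms(4) by simp
  ultimately show ?thesis
    unfolding split[of l] split[of "l(x := l x - 1, y := l y + 1)"] R_def[symmetric]
    using assms(3) by (simp add: power2_eq_square algebra_simps)
qed

lemma balance_le:
  assumes "\<And>i. i \<in> I \<Longrightarrow> X i \<le> b" "j \<in> I"
  shows "balance I s t b i X j \<le> b"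
  using assms(1)[OF assms(2)] by (cases "j = i") (auto simp: balance_def)

lemma potential_balance:
  assumes i: "i \<in> I" and X: "\<And>i. i \<in> I \<Longrightarrow> X i \<le> b"
  shows "balance I s t b i X = X \<or> potential b (balance I s t b i X) < potential b X"
proof -
  have e: "s i < n" "t i < n" "s i \<noteq> t i" using edge[OF i] by auto
  have "potential b (X(i := X i - 1)) < potential b X"
    if "X i > 0" "load I s t b X (s i) > load I s t b X (t i) + 1"
    unfolding potential_def load_dec[of i X b, OF i that(1) X[OF i]]
    using square_sum_move[OF e(1,2,3)] that(2) by blast
  moreover have "potential b (X(i := X i + 1)) < potential b X"
    if "X i < b" "load I s t b X (t i) > load I s t b X (s i) + 1"
    unfolding potential_def load_inc[of i X b, OF i that(1)]
    using square_sum_move[OF e(2,1) e(3)[symmetric]] that(2) by (simp add: fun_upd_twist[OF e(3)])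
  ultimately show ?thesis unfolding balance_def by auto
qed

lemma stable_iff_balance:
  assumes "\<And>i. i \<in> I \<Longrightarrow> X i \<le> b"
  shows "stable I s t b X \<longleftrightarrow> (\<forall>i\<in>I. balance I s t b i X = X)"
proof
  assume "stable I s t b X"
  then show "\<forall>i\<in>I. balance I s t b i X = X" by (auto simp: stable_def balance_def)
next
  assume *: "\<forall>i\<in>I. balance I s t b i X = X"
  show "stable I s t b X"
    unfolding stable_def
  proof (intro ballI)
    fix i assume "i \<in> I"
    with * have "balance I s t b i X i = X i" by simp
    then show "(X i > 0 \<longrightarrow> load I s t b X (s i) \<le> load I s t b X (t i) + 1) \<and>
     (X i < b \<longrightarrow> load I s t b X (t i) \<le> load I s t b X (s i) + 1)"
      by (auto simp: balance_def split: if_splits)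
  qed
qed

text \<open>A minimiser of the potential is stable. The sampling analysis uses this existence
  statement with a huge \<open>b\<close>; the program relies on the iteration bound of
  \<open>iterate_balance_stable\<close> instead.\<close>

lemma ex_stable:
  obtains X where "\<And>i. i \<in> I \<Longrightarrow> X i \<le> b" "stable I s t b X"
proof -
  define P where "P X \<longleftrightarrow> (\<forall>i\<in>I. X i \<le> b)" for X :: "'i \<Rightarrow> nat"
  have "P (\<lambda>_. b)" by (simp add: P_def)
  then obtain X where X: "P X" "\<And>Y. P Y \<Longrightarrow> potential b X \<le> potential b Y"
    using ex_has_least_nat[of P "\<lambda>_. b" "potential b"] by blast
  have "balance I s t b i X = X" if "i \<in> I" for i
  proof -
    have "P (balance I s t b i X)" using X(1) balance_le[of X b] by (auto simp: P_def)
    from X(2)[OF this] show ?thesis using potential_balance[OF that, of X b] X(1) by (auto simp: P_def)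
  qed
  then show ?thesis using that[of X] stable_iff_balance[of X b] X(1) by (auto simp: P_def)
qed

lemma fold_balance_le:
  "(\<And>i. i \<in> I \<Longrightarrow> X i \<le> b) \<Longrightarrow> j \<in> I \<Longrightarrow> fold (balance I s t b) js X j \<le> b"
  by (induction js arbitrary: X) (auto intro!: balance_le)

text \<open>No step raises the potential, so equality after a whole sweep forces every step to have
  been idle, and then each \<open>balance\<close> acted on \<open>X\<close> itself.\<close>

lemma potential_fold_balance:
  "(\<And>i. i \<in> I \<Longrightarrow> X i \<le> b) \<Longrightarrow> set js \<subseteq> I \<Longrightarrow>
    potential b (fold (balance I s t b) js X) \<le> potential b X \<and>
    (potential b (fold (balance I s t b) js X) = potential b X \<longrightarrow> (\<forall>i\<in>set js. balance I s t b i X = X))"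
proof (induction js arbitrary: X)
  case (Cons i js)
  let ?Y = "balance I s t b i X"
  have "?Y = X \<or> potential b ?Y < potential b X" using Cons.prems potential_balance by auto
  moreover have "potential b (fold (balance I s t b) js ?Y) \<le> potential b ?Y \<and>
    (potential b (fold (balance I s t b) js ?Y) = potential b ?Y \<longrightarrow> (\<forall>i\<in>set js. balance I s t b i ?Y = ?Y))"
    by (rule Cons.IH) (use Cons.prems balance_le in auto)
  ultimately show ?case by auto
qed simp

lemma fold_balance_stable:
  "(\<And>i. i \<in> set js \<Longrightarrow> balance I s t b i X = X) \<Longrightarrow> fold (balance I s t b) js X = X"
  by (induction js) auto

text \<open>A sweep that starts from an unstable state costs at least one unit of potential, so the
  initial potential bounds the number of sweeps.\<close>

lemma iterate_balance_stable:
  assumes X: "\<And>i. i \<in> I \<Longrightarrow> X i \<le> b" and js: "set js = I" and k: "potential b X \<le> k"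
  shows "stable I s t b ((fold (balance I s t b) js ^^ k) X)"
proof -
  let ?f = "fold (balance I s t b) js"
  have le: "(?f ^^ j) X i \<le> b" if "i \<in> I" for i j
    using that X by (induction j arbitrary: i) (auto intro!: fold_balance_le)
  have "stable I s t b ((?f ^^ j) X) \<or> potential b ((?f ^^ j) X) + j \<le> potential b X" for j
  proof (induction j)
    case (Suc j)
    let ?Y = "(?f ^^ j) X"
    have Y: "\<And>i. i \<in> I \<Longrightarrow> ?Y i \<le> b" by (rule le)
    show ?case
    proof (cases "stable I s t b ?Y")
      case True
      then have "?f ?Y = ?Y" using stable_iff_balance[OF Y] js by (intro fold_balance_stable) auto
      then show ?thesis using True by simp
    next
      case False
      then have "\<not> (\<forall>i\<in>set js. balance I s t b i ?Y = ?Y)" using stable_iff_balance[OF Y] js by auto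
      then have "potential b (?f ?Y) < potential b ?Y"
        using potential_fold_balance[of ?Y b js, OF Y] js by force
      then show ?thesis using Suc False by auto
    qed
  qed simp
  from this[of k] show ?thesis
  proof
    \<comment> \<open>The whole potential is spent, so all loads are zero and stability is
      immediate.\<close>
    assume "potential b ((?f ^^ k) X) + k \<le> potential b X"
    then have "potential b ((?f ^^ k) X) = 0" using k by simp
    then have "load I s t b ((?f ^^ k) X) w = 0" if "w < n" for w
      using that by (auto simp: potential_def)
    then show ?thesis using edge by (auto simp: stable_def)
  qed
qed

lemma potential_le:
  assumes "\<And>i. i \<in> I \<Longrightarrow> X i \<le> b"
  shows "potential b X \<le> (b * card I)\<^sup>2"
proof -
  have "potential b X \<le> (\<Sum>w<n. load I s t b X w * (b * card I))"
    unfolding potential_def power2_eq_square by (intro sum_mono mult_left_mono load_le[OF assms]) auto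
  also have "\<dots> = (b * card I)\<^sup>2"
    unfolding power2_eq_square sum_distrib_right[symmetric] using total_load[OF assms] by simp
  finally show ?thesis .
qed

lemma max_dens_fraction: "\<exists>e k. 1 \<le> k \<and> k \<le> n \<and> max_dens n I s t = real e / real k"
proof -
  obtain U where U: "U \<subseteq> {..<n}" "U \<noteq> {}"
    "max_dens n I s t = real (card (inner_edges I s t U)) / real (card U)"
    using max_dens_obtain[OF n_pos] by blast
  have "card U \<le> n" using card_mono[OF finite_lessThan U(1)] by simp
  moreover have "card U > 0" using U(1,2) finite_subset[of U "{..<n}"] by (auto simp: card_gt_0_iff)
  ultimately show ?thesis using U(3) by (intro exI[of _ "card (inner_edges I s t U)"] exI[of _ "card U"]) auto
qed

text \<open>The two endpoints of a single edge form the witness.\<close>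

lemma max_dens_pos:
  assumes "I \<noteq> {}"
  shows "1 / 2 \<le> max_dens n I s t"
proof -
  obtain i where i: "i \<in> I" using assms by blast
  have "i \<in> inner_edges I s t {s i, t i}" using i by (simp add: inner_edges_def)
  then have "1 \<le> card (inner_edges I s t {s i, t i})"
    using finite_I by (simp add: Suc_le_eq card_gt_0_iff inner_edges_def) blast
  moreover have "real (card (inner_edges I s t {s i, t i})) \<le> max_dens n I s t * real (card {s i, t i})"
    by (rule max_dens_ge[OF n_pos]) (use edge[OF i] in auto)
  ultimately show ?thesis using edge[OF i] by simp
qed

end

text \<open>Multiplying the difference by both denominators gives an integer of absolute value at
  most \<open>n ^ 3 / N\<close>, which is below 1.\<close>

lemma fractions_close:
  fixes a e k k' n N :: nat
  assumes "1 \<le> k" "k \<le> n" "1 \<le> k'" "k' \<le> n" "n ^ 3 < N"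
    and "\<bar>real a / real k - real e / real k'\<bar> \<le> real n / real N"
  shows "real a / real k = real e / real k'"
proof -
  have "real n * real n * real n < real N"
    using assms(5) unfolding of_nat_mult[symmetric] of_nat_less_iff power3_eq_cube .
  moreover have "\<bar>real a * real k' - real e * real k\<bar> = \<bar>real a / real k - real e / real k'\<bar> * (real k * real k')"
  proof -
    have "real a * real k' - real e * real k = (real a / real k - real e / real k') * (real k * real k')"
      using assms by (simp add: field_simps)
    then show ?thesis by (simp add: abs_mult)
  qed
  moreover have "\<dots> \<le> real n / real N * (real n * real n)"
    using assms by (intro mult_mono) auto
  moreover have "real n / real N * (real n * real n) < 1 "
    using calculation(1) assms by (simp add: field_simps)
  ultimately have "\<bar>real a * real k' - real e * real k\<bar> < 1" by linarith
  then have "\<bar>real_of_int (int a * int k' - int e * int k)\<bar> < 1" by simp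
  then have "\<bar>int a * int k' - int e * int k\<bar> < 1"
    by linarith
  then have "a * k' = e * k" by (simp flip: of_nat_mult)
  then show ?thesis using assms by (simp add: field_simps flip: of_nat_mult)
qed

text \<open>Two distinct fractions with denominators at most \<open>n\<close> differ by at least \<open>1 / n\<^sup>2\<close>.\<close>

lemma rounding:
  fixes L N n k k' e :: nat
  assumes N: "n ^ 3 < N" and k': "1 \<le> k'" "k' \<le> n" and d: "d = real e / real k'"
    and lo: "real (L - n) \<le> real N * d" and hi: "real N * d \<le> real L"
  shows "L * k' \<le> L * k' div N * N + n * k'"
    and "1 \<le> k \<Longrightarrow> k \<le> n \<Longrightarrow> L * k \<le> L * k div N * N + n * k \<Longrightarrow> real (L * k div N) / real k = d"
proof -
  have N0: "N > 0" using N by simp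
  have "real N * real e \<le> real L * real k'" using hi k' by (simp add: d field_simps)
  then have "N * e \<le> L * k'" unfolding of_nat_mult[symmetric] of_nat_le_iff .
  then have "e \<le> L * k' div N" using N0 by (simp add: less_eq_div_iff_mult_less_eq mult.commute)
  then have e1: "e * N \<le> L * k' div N * N" by simp
  have "real (L - n) * real k' \<le> real N * real e" using lo k' by (simp add: d field_simps)
  then have "(L - n) * k' \<le> N * e" unfolding of_nat_mult[symmetric] of_nat_le_iff .
  then have "L * k' \<le> N * e + n * k'" by (simp add: diff_mult_distrib)
  then show "L * k' \<le> L * k' div N * N + n * k'" using e1 unfolding mult.commute[of N e] by linarith
next
  assume k: "1 \<le> k" "k \<le> n" and le: "L * k \<le> L * k div N * N + n * k"
  have N0: "N > 0" using N by simp
  define a where "a = L * k div N"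
  have "a * N \<le> L * k" by (simp add: a_def)
  then have "real a * real N \<le> real L * real k" unfolding of_nat_mult[symmetric] of_nat_le_iff .
  then have 1: "real a / real k \<le> real L / real N" using k N0 by (simp add: field_simps)
  have "real (L * k) \<le> real (a * N + n * k)" using le unfolding a_def of_nat_le_iff .
  then have 2: "real L / real N - real n / real N \<le> real a / real k" using k N0 by (simp add: field_simps)
  have 3: "d \<le> real L / real N" using hi N0 by (simp add: field_simps)
  have "real L - real n \<le> real N * d" using lo by linarith
  then have 4: "real L / real N - real n / real N \<le> d" using N0 by (simp add: field_simps)
  \<comment> \<open>Both fractions lie between \<open>(L - n) / N\<close> and
    \<open>L / N\<close>.\<close>
  have "\<bar>real a / real k - real e / real k'\<bar> \<le> real n / real N"
    using 1 2 3 4 unfolding d[symmetric] by linarith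
  from fractions_close[OF k k' N this] show "real (L * k div N) / real k = d" by (simp add: a_def d)
qed

section \<open>Sampling edges by random vertex colours\<close>

lemma avg_Ex:
  assumes "finite I"
  shows "avg k (\<lambda>xs. of_bool (\<exists>i\<in>I. P i xs)) \<le> (\<Sum>i\<in>I. avg k (\<lambda>xs. of_bool (P i xs)))"
  unfolding avg_sum[symmetric]
proof (rule avg_Markov)
  fix xs assume "\<exists>i\<in>I. P i xs"
  then obtain i where "i \<in> I" "P i xs" by blast
  then show "1 \<le> (\<Sum>i\<in>I. of_bool (P i xs) :: real)"
    using member_le_sum[of i I "\<lambda>i. of_bool (P i xs) :: real"] assms by simp
qed (auto intro: sum_nonneg)

text \<open>Horner evaluation with the leading bit first, the order in which
  \<open>build_table\<close> shifts fresh coins into a register.\<close>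

definition val :: "bool list \<Rightarrow> nat" where
  "val xs = foldl (\<lambda>x b. 2 * x + of_bool b) 0 xs"

lemma val_Nil [simp]: "val [] = 0"
  and val_snoc [simp]: "val (xs @ [b]) = 2 * val xs + of_bool b"
  by (simp_all add: val_def)

lemma val_less: "val xs < 2 ^ length xs"
  by (induction xs rule: rev_induct) (auto simp: of_bool_def)

lemma sum_lessThan_double: "(\<Sum>y<2 * m. h y) = (\<Sum>y<m. h (2 * y) + h (2 * y + 1 :: nat) :: real)"
  by (induction m) auto

lemma avg_val: "avg w (\<lambda>xs. h (val xs)) = (\<Sum>y<2 ^ w. h y) / 2 ^ w"
proof (induction w arbitrary: h)
  case (Suc w)
  show ?case
    unfolding avg_snoc using Suc[of "\<lambda>y. (h (2 * y + 1) + h (2 * y)) / 2"]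
    by (simp add: sum_lessThan_double sum_divide_distrib[symmetric] add.commute field_simps)
qed simp

text \<open>The coins of the initialization, read as a table of \<open>w\<close>-bit numbers:
  entries below \<open>n\<close> serve as vertex colours, later ones as hash values.\<close>

definition cell :: "nat \<Rightarrow> bool list \<Rightarrow> nat \<Rightarrow> nat" where
  "cell w xs i = val (take w (drop (i * w) xs))"

lemma avg_cells:
  "avg (c * w) (\<lambda>xs. \<Prod>i<c. g i (cell w xs i)) = (\<Prod>i<c. (\<Sum>y<2 ^ w. g i y) / 2 ^ w)"
  unfolding cell_def avg_blocks[of c w "\<lambda>i ys. g i (val ys)"] avg_val ..

lemma cell_update:
  assumes "length xs = i * w" "length ys = w" "length ys' = w"
  shows "cell w (xs @ ys @ zs) = (cell w (xs @ ys' @ zs))(i := val ys)"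
proof
  fix k
  consider "k < i" | "k = i" | "k > i" by linarith
  then show "cell w (xs @ ys @ zs) k = ((cell w (xs @ ys' @ zs))(i := val ys)) k"
  proof cases
    case 1
    then have "Suc k * w \<le> i * w" by (intro mult_right_mono) auto
    then show ?thesis using 1 assms by (simp add: cell_def)
  next
    case 3
    then have "Suc i * w \<le> k * w" by (intro mult_right_mono) auto
    then show ?thesis using 3 assms by (simp add: cell_def)
  qed (use assms in \<open>simp add: cell_def\<close>)
qed

text \<open>Deferred decision: the average does not change if entry \<open>i\<close> is drawn
  afresh, so one may average over this entry first with all others fixed.\<close>

lemma avg_resample:
  assumes "i < c"
  shows "avg (c * w) (\<lambda>xs. F (cell w xs)) =
    avg (c * w) (\<lambda>xs. (\<Sum>y<2 ^ w. F ((cell w xs)(i := y))) / 2 ^ w)"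
proof -
  obtain d where "c = i + Suc d" using assms less_iff_Suc_add by auto
  then have c: "c * w = i * w + (w + d * w)" by (simp add: algebra_simps)
  have *: "avg (c * w) (\<lambda>xs. G (cell w xs)) =
    avg (i * w) (\<lambda>xs. avg w (\<lambda>ys. avg (d * w) (\<lambda>zs. G (cell w (xs @ ys @ zs)))))" for G
    unfolding c avg_append ..
  have "avg (c * w) (\<lambda>xs. (\<Sum>y<2 ^ w. F ((cell w xs)(i := y))) / 2 ^ w) =
    avg (i * w) (\<lambda>xs. avg w (\<lambda>ys'. avg w (\<lambda>ys. avg (d * w) (\<lambda>zs. F ((cell w (xs @ ys' @ zs))(i := val ys))))))"
    unfolding *[of "\<lambda>\<phi>. (\<Sum>y<2 ^ w. F (\<phi>(i := y))) / 2 ^ w"]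
    unfolding avg_val[where h = "\<lambda>y. F ((cell w (_ @ _ @ _))(i := y))", symmetric]
    by (subst (3) avg_swap) (rule refl)
  also have "\<dots> = avg (i * w) (\<lambda>xs. avg w (\<lambda>ys'. avg w (\<lambda>ys. avg (d * w) (\<lambda>zs. F (cell w (xs @ ys @ zs))))))"
  proof (intro avg_cong)
    fix xs ys' ys zs :: "bool list"
    assume "length xs = i * w" "length ys' = w" "length ys = w" "length zs = d * w"
    then show "F ((cell w (xs @ ys' @ zs))(i := val ys)) = F (cell w (xs @ ys @ zs))"
      by (simp only: cell_update[of xs i w ys ys'])
  qed
  also have "\<dots> = avg (c * w) (\<lambda>xs. F (cell w xs))"
    unfolding *[of F] by simp
  finally show ?thesis ..
qed

lemma card_residue_class:
  assumes "r < 2 ^ j" "j \<le> w"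
  shows "card {y :: nat. y < 2 ^ w \<and> y mod 2 ^ j = r} = 2 ^ (w - j)"
proof -
  have p: "2 ^ w = (2 :: nat) ^ j * 2 ^ (w - j)" using assms(2) by (simp flip: power_add)
  have "{y. y < 2 ^ w \<and> y mod 2 ^ j = r} = (\<lambda>h. 2 ^ j * h + r) ` {..<2 ^ (w - j)}"
  proof (intro equalityI subsetI)
    fix y assume "y \<in> {y. y < 2 ^ w \<and> y mod 2 ^ j = r}"
    then have y: "y < 2 ^ j * 2 ^ (w - j)" "y mod 2 ^ j = r" by (auto simp: p)
    then have "y div 2 ^ j < 2 ^ (w - j)" by (simp add: div_less_iff_less_mult mult.commute)
    moreover have "y = 2 ^ j * (y div 2 ^ j) + r" using y(2) by (metis mult_div_mod_eq)
    ultimately show "y \<in> (\<lambda>h. 2 ^ j * h + r) ` {..<2 ^ (w - j)}" by blast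
  next
    fix y assume "y \<in> (\<lambda>h. 2 ^ j * h + r) ` {..<(2 :: nat) ^ (w - j)}"
    then obtain h where h: "h < 2 ^ (w - j)" "y = 2 ^ j * h + r" by blast
    have "y < 2 ^ j * Suc h" using h assms(1) by simp
    also have "\<dots> \<le> 2 ^ w" unfolding p using h by (intro mult_left_mono) auto
    finally show "y \<in> {y. y < 2 ^ w \<and> y mod 2 ^ j = r}" using h assms(1) by simp
  qed
  moreover have "inj_on (\<lambda>h. 2 ^ j * h + r) {..<(2 :: nat) ^ (w - j)}" by (auto simp: inj_on_def)
  ultimately show ?thesis by (simp add: card_image)
qed

text \<open>For \<open>a = exp (\<theta> * \<alpha> v)\<close> this is the moment generating
  function of a weight that is kept with probability \<open>1 / 2 ^ j\<close>; since
  \<open>j \<le> w\<close>, the residue classes all have the same size.\<close>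

lemma sum_residue_class:
  fixes x :: nat
  assumes "j \<le> w"
  shows "(\<Sum>y<2 ^ w. if y mod 2 ^ j = x mod 2 ^ j then a else 1 :: real) / 2 ^ w = 1 + (a - 1) / 2 ^ j"
proof -
  have "(\<Sum>y<2 ^ w. if y mod 2 ^ j = x mod 2 ^ j then a else 1 :: real) =
      (\<Sum>y<2 ^ w. 1 + (if y mod 2 ^ j = x mod 2 ^ j then a - 1 else 0))"
    by (rule sum.cong) auto
  also have "\<dots> = 2 ^ w + real (card {y :: nat. y < 2 ^ w \<and> y mod 2 ^ j = x mod 2 ^ j}) * (a - 1)"
    by (simp add: sum.distrib sum.If_cases Int_def)
  also have "\<dots> = 2 ^ w + 2 ^ (w - j) * (a - 1)"
    by (subst card_residue_class) (use assms in auto)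
  finally show ?thesis using assms by (simp add: power_diff field_simps)
qed

text \<open>For \<open>x = - y < 0\<close> the claim says that \<open>exp y\<close> times
  \<open>1 - y + y^2\<close> is at least 1. Already the quadratic Taylor polynomial of
  \<open>exp y\<close> achieves this, because the product has only nonnegative terms besides
  1.\<close>

lemma exp_le_quadratic:
  fixes x :: real
  assumes "\<bar>x\<bar> \<le> 1"
  shows "exp x \<le> 1 + x + x\<^sup>2"
proof (cases "x \<ge> 0")
  case False
  define y where "y = - x"
  have y: "0 \<le> y" "y \<le> 1" using False assms by (auto simp: y_def)
  have "1 \<le> (1 + y + y\<^sup>2 / 2) * (1 - y + y\<^sup>2)"
  proof -
    have "(1 + y + y\<^sup>2 / 2) * (1 - y + y\<^sup>2) = 1 + y\<^sup>2 / 2 + y ^ 3 / 2 + y ^ 4 / 2"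
      by (simp add: field_simps power2_eq_square power3_eq_cube power4_eq_xxxx)
    then show ?thesis using y by simp
  qed
  also have "\<dots> \<le> exp y * (1 - y + y\<^sup>2)"
    using y by (intro mult_right_mono exp_lower_Taylor_quadratic) (auto simp: power2_eq_square)
  finally show ?thesis by (simp add: y_def exp_minus field_simps)
qed (use assms exp_bound in auto)

text \<open>The part of the star of \<open>u\<close> that survives on level \<open>j\<close>.
  Weights are needed because \<alpha> is once a share of a fractional orientation (upper bound) and
  once adjacency inside an optimal set (lower bound).\<close>

definition class_weight :: "nat \<Rightarrow> nat \<Rightarrow> (nat \<Rightarrow> nat) \<Rightarrow> (nat \<Rightarrow> real) \<Rightarrow> nat \<Rightarrow> real" where
  "class_weight n j \<phi> \<alpha> u = (\<Sum>v\<in>{..<n} - {u}. if \<phi> v mod 2 ^ j = \<phi> u mod 2 ^ j then \<alpha> v else 0)"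

text \<open>Conditioned on the value at \<open>u\<close>, the events that \<open>v\<close> is in the class of \<open>u\<close> are independent.\<close>

lemma avg_exp_class_weight:
  fixes \<alpha> :: "nat \<Rightarrow> real"
  assumes u: "u < n" and j: "j \<le> w" and \<theta>: "\<bar>\<theta>\<bar> \<le> 1" and \<alpha>: "\<And>v. 0 \<le> \<alpha> v" "\<And>v. \<alpha> v \<le> 1"
  shows "avg (n * w) (\<lambda>xs. exp (\<theta> * class_weight n j (cell w xs) \<alpha> u)) \<le>
    exp ((\<theta> + \<theta>\<^sup>2) * (\<Sum>v\<in>{..<n} - {u}. \<alpha> v) / 2 ^ j)"
proof -
  \<comment> \<open>The factor at \<open>u\<close> selects the colour \<open>x\<close>. Summing over
    \<open>x\<close> turns the conditioning on the colour of \<open>u\<close> into a sum of products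
    over all entries, to which \<open>avg_cells\<close> applies.\<close>
  define g :: "nat \<Rightarrow> nat \<Rightarrow> nat \<Rightarrow> real" where "g x v y =
    (if v = u then of_bool (y = x) else if y mod 2 ^ j = x mod 2 ^ j then exp (\<theta> * \<alpha> v) else 1)" for x v y
  have ins: "{..<n} = insert u ({..<n} - {u})" using u by auto
  have split: "(\<Prod>v<n. h v) = h u * (\<Prod>v\<in>{..<n} - {u}. h v)" for h :: "nat \<Rightarrow> real"
    by (subst ins, subst prod.insert) auto
  have "avg (n * w) (\<lambda>xs. exp (\<theta> * class_weight n j (cell w xs) \<alpha> u)) =
      avg (n * w) (\<lambda>xs. \<Sum>x<2 ^ w. \<Prod>v<n. g x v (cell w xs v))"
  proof (rule avg_cong)
    fix xs :: "bool list"
    let ?c = "cell w xs"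
    have lt: "?c u < 2 ^ w"
    proof -
      have "?c u < 2 ^ length (take w (drop (u * w) xs))" unfolding cell_def by (rule val_less)
      also have "\<dots> \<le> 2 ^ w" by (intro power_increasing) auto
      finally show ?thesis .
    qed
    have "exp (\<theta> * class_weight n j ?c \<alpha> u) =
      (\<Prod>v\<in>{..<n} - {u}. if ?c v mod 2 ^ j = ?c u mod 2 ^ j then exp (\<theta> * \<alpha> v) else 1)"
      unfolding class_weight_def sum_distrib_left exp_sum[OF finite_Diff[OF finite_lessThan]]
      by (rule prod.cong) auto
    moreover have "(\<Prod>v<n. g x v (?c v)) = (if x = ?c u then
        \<Prod>v\<in>{..<n} - {u}. if ?c v mod 2 ^ j = ?c u mod 2 ^ j then exp (\<theta> * \<alpha> v) else 1 else 0)" for x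
    proof -
      have "(\<Prod>v\<in>{..<n} - {u}. g x v (?c v)) =
        (\<Prod>v\<in>{..<n} - {u}. if ?c v mod 2 ^ j = x mod 2 ^ j then exp (\<theta> * \<alpha> v) else 1)"
        by (rule prod.cong) (auto simp: g_def)
      then show ?thesis unfolding split[of "\<lambda>v. g x v (?c v)"] by (simp add: g_def)
    qed
    ultimately show "exp (\<theta> * class_weight n j ?c \<alpha> u) = (\<Sum>x<2 ^ w. \<Prod>v<n. g x v (?c v))"
      using lt by simp
  qed
  also have "\<dots> = (\<Sum>x<2 ^ w :: nat. \<Prod>v<n. (\<Sum>y<2 ^ w. g x v y) / 2 ^ w)"
    unfolding avg_sum avg_cells ..
  also have "\<dots> = (\<Sum>x<2 ^ w :: nat. 1 / 2 ^ w * (\<Prod>v\<in>{..<n} - {u}. 1 + (exp (\<theta> * \<alpha> v) - 1) / 2 ^ j))"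
  proof (rule sum.cong)
    fix x :: nat assume "x \<in> {..<2 ^ w}"
    then have "(\<Sum>y<2 ^ w. g x u y) = 1" by (simp add: g_def of_bool_def)
    moreover have "(\<Prod>v\<in>{..<n} - {u}. (\<Sum>y<2 ^ w. g x v y) / 2 ^ w) =
        (\<Prod>v\<in>{..<n} - {u}. 1 + (exp (\<theta> * \<alpha> v) - 1) / 2 ^ j)"
      by (rule prod.cong) (auto simp: g_def sum_residue_class[OF j])
    ultimately show "(\<Prod>v<n. (\<Sum>y<2 ^ w. g x v y) / 2 ^ w) =
        1 / 2 ^ w * (\<Prod>v\<in>{..<n} - {u}. 1 + (exp (\<theta> * \<alpha> v) - 1) / 2 ^ j)"
      unfolding split[of "\<lambda>v. (\<Sum>y<2 ^ w. g x v y) / 2 ^ w"] by simp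
  qed simp
  also have "\<dots> = (\<Prod>v\<in>{..<n} - {u}. 1 + (exp (\<theta> * \<alpha> v) - 1) / 2 ^ j)"
    by simp
  also have "\<dots> \<le> (\<Prod>v\<in>{..<n} - {u}. exp ((\<theta> + \<theta>\<^sup>2) * \<alpha> v / 2 ^ j))"
  proof (rule prod_mono, intro conjI)
    fix v
    have "\<bar>\<theta> * \<alpha> v\<bar> \<le> 1" using \<theta> \<alpha>[of v] by (simp add: abs_mult mult_le_one)
    then have "exp (\<theta> * \<alpha> v) \<le> 1 + \<theta> * \<alpha> v + (\<theta> * \<alpha> v)\<^sup>2" by (rule exp_le_quadratic)
    \<comment> \<open>As weights are at most 1, the second moment is bounded by the mean.\<close>
    also have "(\<theta> * \<alpha> v)\<^sup>2 \<le> \<theta>\<^sup>2 * \<alpha> v"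
      unfolding power_mult_distrib power2_eq_square[of "\<alpha> v"]
      using \<alpha>[of v] by (intro mult_left_mono) (auto simp: mult_left_le)
    finally have "(exp (\<theta> * \<alpha> v) - 1) / 2 ^ j \<le> ((\<theta> + \<theta>\<^sup>2) * \<alpha> v) / 2 ^ j"
      by (intro divide_right_mono) (auto simp: algebra_simps)
    then show "1 + (exp (\<theta> * \<alpha> v) - 1) / 2 ^ j \<le> exp ((\<theta> + \<theta>\<^sup>2) * \<alpha> v / 2 ^ j)"
      using exp_ge_add_one_self[of "(\<theta> + \<theta>\<^sup>2) * \<alpha> v / 2 ^ j"] by linarith
    have "0 \<le> exp (\<theta> * \<alpha> v) / 2 ^ j + (1 - 1 / 2 ^ j)" by (intro add_nonneg_nonneg) auto
    then show "0 \<le> 1 + (exp (\<theta> * \<alpha> v) - 1) / 2 ^ j" unfolding diff_divide_distrib by linarith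
  qed
  also have "\<dots> = exp ((\<theta> + \<theta>\<^sup>2) * (\<Sum>v\<in>{..<n} - {u}. \<alpha> v) / 2 ^ j)"
    by (simp add: exp_sum[symmetric] sum_divide_distrib sum_distrib_left)
  finally show ?thesis .
qed

text \<open>The choice \<open>\<theta> = \<delta> / 2\<close> minimises the exponent factor
  \<theta>^2 - \<theta> \<delta>, with value - \<delta>^2 / 4. \<open>D\<close> may be any upper
  bound on the total weight, as the factor \<open>\<theta> + \<theta>^2\<close> is
  nonnegative.\<close>

lemma class_weight_upper_tail:
  fixes \<alpha> :: "nat \<Rightarrow> real"
  assumes "u < n" "j \<le> w" "\<And>v. 0 \<le> \<alpha> v" "\<And>v. \<alpha> v \<le> 1" and \<delta>: "0 \<le> \<delta>" "\<delta> \<le> 1"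
    and D: "(\<Sum>v\<in>{..<n} - {u}. \<alpha> v) \<le> D" and E: "E \<le> D / 2 ^ j * \<delta>\<^sup>2 / 4"
  shows "avg (n * w) (\<lambda>xs. of_bool (class_weight n j (cell w xs) \<alpha> u > (1 + \<delta>) * (D / 2 ^ j))) \<le> exp (- E)"
proof -
  define \<theta> where "\<theta> = \<delta> / 2"
  define t where "t = (1 + \<delta>) * (D / 2 ^ j)"
  let ?X = "\<lambda>xs. class_weight n j (cell w xs) \<alpha> u"
  have "avg (n * w) (\<lambda>xs. of_bool (?X xs > t)) \<le> avg (n * w) (\<lambda>xs. exp (- (\<theta> * t)) * exp (\<theta> * ?X xs))"
    by (rule avg_Markov) (use \<delta> in \<open>auto simp: \<theta>_def intro: mult_left_mono simp flip: exp_add\<close>)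
  also have "\<dots> = exp (- (\<theta> * t)) * avg (n * w) (\<lambda>xs. exp (\<theta> * ?X xs))" by (rule avg_mult_left)
  also have "\<dots> \<le> exp (- (\<theta> * t)) * exp ((\<theta> + \<theta>\<^sup>2) * (\<Sum>v\<in>{..<n} - {u}. \<alpha> v) / 2 ^ j)"
    by (intro mult_left_mono avg_exp_class_weight) (use assms in \<open>auto simp: \<theta>_def\<close>)
  also have "\<dots> \<le> exp (- (\<theta> * t)) * exp ((\<theta> + \<theta>\<^sup>2) * D / 2 ^ j)"
    using D \<delta> by (auto simp: \<theta>_def intro!: mult_left_mono divide_right_mono)
  also have "\<dots> = exp (- (D / 2 ^ j * \<delta>\<^sup>2 / 4))"
    by (simp add: t_def \<theta>_def power2_eq_square field_simps flip: exp_add)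
  also have "\<dots> \<le> exp (- E)" using E by simp
  finally show ?thesis by (simp add: t_def)
qed

text \<open>The mirror image with \<open>\<theta> = - \<delta> / 2\<close>. Now
  \<open>\<theta> + \<theta>^2\<close> is at most 0, so \<open>D\<close> is the total weight itself
  and not just an upper bound.\<close>

lemma class_weight_lower_tail:
  fixes \<alpha> :: "nat \<Rightarrow> real"
  assumes "u < n" "j \<le> w" "\<And>v. 0 \<le> \<alpha> v" "\<And>v. \<alpha> v \<le> 1" and \<delta>: "0 \<le> \<delta>" "\<delta> \<le> 1"
    and D: "D = (\<Sum>v\<in>{..<n} - {u}. \<alpha> v)" and E: "E \<le> D / 2 ^ j * \<delta>\<^sup>2 / 4"
  shows "avg (n * w) (\<lambda>xs. of_bool (class_weight n j (cell w xs) \<alpha> u < (1 - \<delta>) * (D / 2 ^ j))) \<le> exp (- E)"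
proof -
  define \<theta> where "\<theta> = - \<delta> / 2"
  define t where "t = (1 - \<delta>) * (D / 2 ^ j)"
  let ?X = "\<lambda>xs. class_weight n j (cell w xs) \<alpha> u"
  have "avg (n * w) (\<lambda>xs. of_bool (?X xs < t)) \<le> avg (n * w) (\<lambda>xs. exp (- (\<theta> * t)) * exp (\<theta> * ?X xs))"
    by (rule avg_Markov) (use \<delta> in \<open>auto simp: \<theta>_def intro: mult_left_mono simp flip: exp_add\<close>)
  also have "\<dots> = exp (- (\<theta> * t)) * avg (n * w) (\<lambda>xs. exp (\<theta> * ?X xs))" by (rule avg_mult_left)
  also have "\<dots> \<le> exp (- (\<theta> * t)) * exp ((\<theta> + \<theta>\<^sup>2) * (\<Sum>v\<in>{..<n} - {u}. \<alpha> v) / 2 ^ j)"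
    by (intro mult_left_mono avg_exp_class_weight) (use assms in \<open>auto simp: \<theta>_def\<close>)
  also have "\<dots> = exp (- (D / 2 ^ j * \<delta>\<^sup>2 / 4))"
    unfolding D[symmetric] by (simp add: t_def \<theta>_def power2_eq_square field_simps flip: exp_add)
  also have "\<dots> \<le> exp (- E)" using E by simp
  finally show ?thesis by (simp add: t_def)
qed

definition same_class :: "nat \<Rightarrow> (nat \<Rightarrow> nat) \<Rightarrow> (nat \<times> nat) set \<Rightarrow> (nat \<times> nat) set" where
  "same_class j \<phi> A = {(u, v) \<in> A. \<phi> u mod 2 ^ j = \<phi> v mod 2 ^ j}"

text \<open>One factor \<open>1 + \<delta>\<close> pays for the inexact orientation, the other for
  sampling. The third conjunct bounds the number of sampled edges, which decides whether the sketch
  can hold the level.\<close>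

definition concentrated :: "nat \<Rightarrow> (nat \<times> nat) set \<Rightarrow> real \<Rightarrow> nat \<Rightarrow> (nat \<Rightarrow> nat) \<Rightarrow> bool" where
  "concentrated n A \<delta> j \<phi> \<longleftrightarrow>
    (1 - \<delta>) * max_dens n A fst snd \<le> 2 ^ j * max_dens n (same_class j \<phi> A) fst snd \<and>
    2 ^ j * max_dens n (same_class j \<phi> A) fst snd \<le> (1 + \<delta>)\<^sup>2 * max_dens n A fst snd \<and>
    2 ^ j * real (card (same_class j \<phi> A)) \<le> real n * (1 + \<delta>)\<^sup>2 * max_dens n A fst snd"

lemma same_class_subset: "same_class j \<phi> A \<subseteq> A"
  by (auto simp: same_class_def)

lemma same_class_0 [simp]: "same_class 0 \<phi> A = A"
  by (auto simp: same_class_def)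

locale simple_graph =
  fixes n :: nat and A :: "(nat \<times> nat) set"
  assumes n1: "1 \<le> n" and A: "\<And>u v. (u, v) \<in> A \<Longrightarrow> u < v \<and> v < n"
begin

lemma finite_A: "finite A"
  by (rule finite_subset[of _ "{..<n} \<times> {..<n}"]) (use A in fastforce)+

lemma edge_family: "B \<subseteq> A \<Longrightarrow> edge_family B fst snd n"
  using finite_A n1 A by unfold_locales (auto dest: finite_subset, fastforce+)

lemma card_A: "card A \<le> n\<^sup>2"
proof -
  have "card A \<le> card ({..<n} \<times> {..<n})"
    by (rule card_mono) (use A in fastforce)+
  then show ?thesis by (simp add: power2_eq_square)
qed

text \<open>Sums over the edges at \<open>u\<close> become sums over the other vertices, the
  independent index set of \<open>class_weight\<close>. Edges carry the smaller endpoint first, so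
  each \<open>v\<close> is met in one orientation only.\<close>

lemma incidence_sum:
  fixes f g :: "nat \<times> nat \<Rightarrow> real"
  assumes B: "B \<subseteq> A" and u: "u < n"
  shows "(\<Sum>e\<in>B. (if fst e = u then f e else 0) + (if snd e = u then g e else 0)) =
    (\<Sum>v\<in>{..<n} - {u}. if (u, v) \<in> B then f (u, v) else if (v, u) \<in> B then g (v, u) else 0)"
proof -
  have fB: "finite B" using B finite_A finite_subset by blast
  have "(\<Sum>e\<in>B. if fst e = u then f e else 0) = (\<Sum>e\<in>{e \<in> B. fst e = u}. f e)"
    using fB by (simp add: sum.If_cases Int_def)
  also have "\<dots> = (\<Sum>v\<in>{v. v < n \<and> v \<noteq> u \<and> (u, v) \<in> B}. f (u, v))"
    by (rule sum.reindex_bij_witness[of _ "\<lambda>v. (u, v)" snd]) (use A B in fastforce)+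
  also have "\<dots> = (\<Sum>v\<in>{..<n} - {u}. if (u, v) \<in> B then f (u, v) else 0)"
    by (subst sum.inter_filter[symmetric]) (auto intro: sum.cong)
  finally have 1: "(\<Sum>e\<in>B. if fst e = u then f e else 0) = \<dots>" .
  have "(\<Sum>e\<in>B. if snd e = u then g e else 0) = (\<Sum>e\<in>{e \<in> B. snd e = u}. g e)"
    using fB by (simp add: sum.If_cases Int_def)
  also have "\<dots> = (\<Sum>v\<in>{v. v < n \<and> v \<noteq> u \<and> (v, u) \<in> B}. g (v, u))"
    by (rule sum.reindex_bij_witness[of _ "\<lambda>v. (v, u)" fst]) (use A B in fastforce)+
  also have "\<dots> = (\<Sum>v\<in>{..<n} - {u}. if (v, u) \<in> B then g (v, u) else 0)"
    by (subst sum.inter_filter[symmetric]) (auto intro: sum.cong)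
  finally have 2: "(\<Sum>e\<in>B. if snd e = u then g e else 0) = \<dots>" .
  have "\<not> ((u, v) \<in> B \<and> (v, u) \<in> B)" for v using A[of u v] A[of v u] B by (metis in_mono less_asym)
  then show ?thesis
    unfolding sum.distrib 1 2 by (subst sum.distrib[symmetric]) (rule sum.cong, auto)
qed

lemma degree_sum:
  assumes "B \<subseteq> A" "U \<subseteq> {..<n}" "\<And>e. e \<in> B \<Longrightarrow> fst e \<in> U \<and> snd e \<in> U"
  shows "(\<Sum>u\<in>U. \<Sum>e\<in>B. (if fst e = u then 1 else 0) + (if snd e = u then 1 else 0)) = 2 * real (card B)"
proof -
  have fU: "finite U" using assms(2) finite_subset by blast
  have "(\<Sum>u\<in>U. \<Sum>e\<in>B. (if fst e = u then 1 else 0) + (if snd e = u then 1 else 0)) =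
      (\<Sum>e\<in>B. \<Sum>u\<in>U. (if fst e = u then 1 else 0) + (if snd e = u then 1 else 0 :: real))"
    by (rule sum.swap)
  also have "\<dots> = (\<Sum>e\<in>B. 2)"
    by (rule sum.cong) (use assms fU in \<open>auto simp: sum.distrib\<close>)
  finally show ?thesis by simp
qed

text \<open>Without \<open>u\<close>, the set has at most \<open>d * (card U - 1)\<close> inner
  edges, so removing \<open>u\<close> destroys at least \<open>d\<close> of them.\<close>

lemma optimal_degree:
  assumes U: "U \<subseteq> {..<n}" "U \<noteq> {}"
    and opt: "max_dens n A fst snd = real (card (inner_edges A fst snd U)) / real (card U)"
    and pos: "0 < max_dens n A fst snd" and u: "u \<in> U"
  shows "max_dens n A fst snd \<le>
    (\<Sum>e\<in>inner_edges A fst snd U. (if fst e = u then 1 else 0) + (if snd e = u then 1 else 0))"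
proof -
  define B where "B = inner_edges A fst snd U"
  define d where "d = max_dens n A fst snd"
  have fU: "finite U" using U finite_subset by blast
  have fB: "finite B" using finite_A by (simp add: B_def inner_edges_def)
  have cU: "card U > 0" using U(2) fU by (simp add: card_gt_0_iff)
  have B1: "real (card B) = d * real (card U)" using opt cU by (simp add: B_def d_def)
  \<comment> \<open>Positive density yields an inner edge, so \<open>U\<close> keeps a vertex after
    the removal of \<open>u\<close> and \<open>max_dens_ge\<close> applies to the rest.\<close>
  have "0 < real (card B)" unfolding B1 using pos cU by (simp add: d_def)
  then have "card B > 0" by simp
  then obtain e where "e \<in> B" by (metis card.empty ex_in_conv less_irrefl)
  then have "fst e \<in> U" "snd e \<in> U" "fst e \<noteq> snd e"
    using A[of "fst e" "snd e"] by (auto simp: B_def inner_edges_def)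
  then have ne: "U - {u} \<noteq> {}" by (metis Diff_eq_empty_iff singletonD subset_eq)
  define B' where "B' = inner_edges A fst snd (U - {u})"
  have "real (card B') \<le> d * real (card (U - {u}))"
    unfolding B'_def d_def by (rule max_dens_ge[OF n1 _ ne]) (use U in auto)
  also have "\<dots> = d * real (card U) - d" using u fU cU by (simp add: of_nat_diff algebra_simps)
  finally have 1: "d \<le> real (card B) - real (card B')" using B1 by simp
  have sub: "B' \<subseteq> B" by (auto simp: B'_def B_def inner_edges_def)
  have "real (card B) - real (card B') = real (card (B - B'))"
    using card_Diff_subset[OF finite_subset[OF sub fB] sub] card_mono[OF fB sub] by (simp add: of_nat_diff)
  also have "\<dots> = (\<Sum>e\<in>B. if e \<notin> B' then 1 else 0)"
    using fB by (simp add: sum.If_cases set_diff_eq Int_def)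
  also have "\<dots> \<le> (\<Sum>e\<in>B. (if fst e = u then 1 else 0) + (if snd e = u then 1 else 0))"
    by (rule sum_mono) (auto simp: B_def B'_def inner_edges_def)
  finally show ?thesis using 1 by (simp add: d_def B_def)
qed

lemma max_dens_le_n: "max_dens n A fst snd \<le> real n"
proof -
  have "real (card (inner_edges A fst snd U)) \<le> real n * real (card U)" if U: "U \<subseteq> {..<n}" for U
  proof -
    have "card (inner_edges A fst snd U) \<le> card (U \<times> {..<n})"
      by (rule card_mono) (use U A finite_subset in \<open>fastforce simp: inner_edges_def\<close>)+
    then have "card (inner_edges A fst snd U) \<le> n * card U"
      by (simp add: card_cartesian_product mult.commute)
    then show ?thesis unfolding of_nat_mult[symmetric] of_nat_le_iff .
  qed
  then show ?thesis using max_dens_le_iff[OF n1] by blast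
qed

text \<open>Only \<open>2 * n\<close> star events occur: at each vertex an upper tail for its load
  in a fractional orientation, and at each vertex of an optimal set a lower tail for its degree.
  Outside them all three bounds follow deterministically.\<close>

lemma avg_not_concentrated:
  assumes ne: "A \<noteq> {}" and \<delta>: "0 < \<delta>" "\<delta> \<le> 1" and j: "j \<le> w"
    and E: "E \<le> max_dens n A fst snd / 2 ^ j * \<delta>\<^sup>2 / 4"
  shows "avg (n * w) (\<lambda>xs. of_bool (\<not> concentrated n A \<delta> j (cell w xs))) \<le> 2 * real n * exp (- E)"
proof -
  interpret edge_family A fst snd n by (rule edge_family) simp
  define d where "d = max_dens n A fst snd"
  have d: "1 / 2 \<le> d" unfolding d_def by (rule max_dens_pos[OF ne])
  \<comment> \<open>Enough units per edge that the error \<open>n / b\<close> of a stable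
    orientation is at most \<open>\<delta> * d\<close>.\<close>
  obtain b :: nat where b: "real n / (\<delta> * d) < real b" using reals_Archimedean2 by blast
  have b0: "b > 0" using b d \<delta> by (metis divide_nonneg_nonneg gr0I less_eq_real_def linorder_not_less mult_nonneg_nonneg of_nat_0 of_nat_0_le_iff zero_le_divide_1_iff order_trans zero_le_numeral)
  have nb: "real n / real b \<le> \<delta> * d" using b b0 d \<delta> by (simp add: field_simps)
  obtain X where X: "\<And>i. i \<in> A \<Longrightarrow> X i \<le> b" and st: "stable A fst snd b X"
    using ex_stable by blast
  define L where "L = Max (load A fst snd b X ` {..<n})"
  have "real L - real n \<le> real b * d"
    using stable_max_dens(1)[OF X st b0 L_def] unfolding d_def by linarith
  then have Lb: "real L / real b \<le> (1 + \<delta>) * d"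
    using nb b0 by (simp add: field_simps)
  define D where "D = (1 + \<delta>) * d"
  define f where "f e = real (X e) / real b" for e
  define g where "g e = real (b - X e) / real b" for e
  define \<alpha> where "\<alpha> u v = (if (u, v) \<in> A then f (u, v) else if (v, u) \<in> A then g (v, u) else 0)" for u v
  have \<alpha>01: "0 \<le> \<alpha> u v" "\<alpha> u v \<le> 1" for u v
    using X b0 by (auto simp: \<alpha>_def f_def g_def)
  have load_eq: "real (load B fst snd b X u) / real b =
      (\<Sum>v\<in>{..<n} - {u}. if (u, v) \<in> B then f (u, v) else if (v, u) \<in> B then g (v, u) else 0)"
    if "B \<subseteq> A" "u < n" for B u
    unfolding incidence_sum[OF that, symmetric]
    by (simp add: load_def sum_divide_distrib f_def g_def) (rule sum.cong, auto simp: f_def g_def add_divide_distrib)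
  have sum\<alpha>: "(\<Sum>v\<in>{..<n} - {u}. \<alpha> u v) \<le> D" if "u < n" for u
  proof -
    have "(\<Sum>v\<in>{..<n} - {u}. \<alpha> u v) = real (load A fst snd b X u) / real b"
      unfolding load_eq[OF order_refl that] by (simp add: \<alpha>_def)
    also have "\<dots> \<le> real L / real b"
      using that by (intro divide_right_mono) (auto simp: L_def)
    finally show ?thesis using Lb by (simp add: D_def)
  qed
  obtain U where U: "U \<subseteq> {..<n}" "U \<noteq> {}" "d = real (card (inner_edges A fst snd U)) / real (card U)"
    using max_dens_obtain[OF n1] unfolding d_def by blast
  define AU where "AU = inner_edges A fst snd U"
  define \<beta> where "\<beta> u v = (if (u, v) \<in> AU then 1 else if (v, u) \<in> AU then 1 else 0 :: real)" for u v
  define deg where "deg u = (\<Sum>v\<in>{..<n} - {u}. \<beta> u v)" for u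
  have AU: "AU \<subseteq> A" by (auto simp: AU_def inner_edges_def)
  have deg_eq: "deg u = (\<Sum>e\<in>AU. (if fst e = u then 1 else 0) + (if snd e = u then 1 else 0))" if "u < n" for u
    unfolding deg_def \<beta>_def incidence_sum[OF AU that] ..
  have deg: "d \<le> deg u" if "u \<in> U" for u
    using optimal_degree[OF U(1,2) U(3)[unfolded d_def] _ that] d U(1) that
    by (subst deg_eq) (auto simp: d_def AU_def)
  define bad where "bad u \<phi> \<longleftrightarrow> class_weight n j \<phi> (\<alpha> u) u > (1 + \<delta>) * (D / 2 ^ j)" for u \<phi>
  define bad' where "bad' u \<phi> \<longleftrightarrow> u \<in> U \<and> class_weight n j \<phi> (\<beta> u) u < (1 - \<delta>) * (deg u / 2 ^ j)" for u \<phi>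
  have conc: "concentrated n A \<delta> j \<phi>" if *: "\<And>u. u < n \<Longrightarrow> \<not> bad u \<phi> \<and> \<not> bad' u \<phi>" for \<phi>
  proof -
    define B where "B = same_class j \<phi> A"
    have B: "B \<subseteq> A" by (auto simp: B_def same_class_def)
    have XB: "\<And>i. i \<in> B \<Longrightarrow> X i \<le> b" using X B by auto
    interpret B: edge_family B fst snd n by (rule edge_family[OF B])
    \<comment> \<open>Restricted to the sampled edges, \<open>X\<close> is again an orientation, and
      its scaled loads are precisely the star sums controlled by \<open>bad\<close>.\<close>
    have le: "real (load B fst snd b X u) / real b \<le> (1 + \<delta>)\<^sup>2 * d / 2 ^ j" if u: "u < n" for u
    proof -
      have "real (load B fst snd b X u) / real b = class_weight n j \<phi> (\<alpha> u) u"
        unfolding load_eq[OF B u] class_weight_def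
        by (rule sum.cong) (auto simp: \<alpha>_def B_def same_class_def)
      also have "\<dots> \<le> (1 + \<delta>) * (D / 2 ^ j)" using *[OF u] by (simp add: bad_def)
      finally show ?thesis by (simp add: D_def power2_eq_square mult_ac)
    qed
    have upper: "2 ^ j * real (card (inner_edges B fst snd V)) \<le> (1 + \<delta>)\<^sup>2 * d * real (card V)"
      if V: "V \<subseteq> {..<n}" for V
    proof -
      have "real b * real (card (inner_edges B fst snd V)) \<le> real (\<Sum>u\<in>V. load B fst snd b X u)"
        unfolding of_nat_mult[symmetric] of_nat_le_iff by (rule B.inner_edges_le_load[OF XB V])
      then have "real (card (inner_edges B fst snd V)) \<le> (\<Sum>u\<in>V. real (load B fst snd b X u) / real b)"
        using b0 by (simp add: field_simps sum_divide_distrib[symmetric])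
      also have "\<dots> \<le> (\<Sum>u\<in>V. (1 + \<delta>)\<^sup>2 * d / 2 ^ j)"
        by (rule sum_mono) (use le V in auto)
      finally show ?thesis by (simp add: field_simps)
    qed
    have "max_dens n B fst snd \<le> (1 + \<delta>)\<^sup>2 * d / 2 ^ j"
      using upper unfolding max_dens_le_iff[OF n1] by (simp add: field_simps)
    then have 1: "2 ^ j * max_dens n B fst snd \<le> (1 + \<delta>)\<^sup>2 * d" by (simp add: field_simps)
    have "inner_edges B fst snd {..<n} = B" using B A by (fastforce simp: inner_edges_def)
    with upper[OF order_refl] have 2: "2 ^ j * real (card B) \<le> real n * (1 + \<delta>)\<^sup>2 * d"
      by (simp add: mult_ac)
    define BU where "BU = inner_edges B fst snd U"
    have BU: "BU \<subseteq> A" using B by (auto simp: BU_def inner_edges_def)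
    \<comment> \<open>Both ends of this chain are degree sums: adding the star bounds over
      \<open>U\<close> compares the edges inside \<open>U\<close> with the sampled ones, each
      counted twice.\<close>
    have "(1 - \<delta>) / 2 ^ j * (2 * real (card AU)) = (\<Sum>u\<in>U. (1 - \<delta>) * (deg u / 2 ^ j))"
    proof -
      have "2 * real (card AU) = (\<Sum>u\<in>U. deg u)"
      proof -
        have "(\<Sum>u\<in>U. deg u) = (\<Sum>u\<in>U. \<Sum>e\<in>AU. (if fst e = u then 1 else 0) + (if snd e = u then 1 else 0))"
          by (rule sum.cong) (use U(1) deg_eq in auto)
        also have "\<dots> = 2 * real (card AU)"
          by (rule degree_sum[OF AU U(1)]) (auto simp: AU_def inner_edges_def)
        finally show ?thesis ..
      qed
      then show ?thesis by (simp add: sum_distrib_left)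
    qed
    also have "\<dots> \<le> (\<Sum>u\<in>U. class_weight n j \<phi> (\<beta> u) u)"
      by (rule sum_mono) (use * U(1) in \<open>force simp: bad'_def\<close>)
    also have "\<dots> = 2 * real (card BU)"
    proof -
      have BU_iff: "(x, y) \<in> BU \<longleftrightarrow> (x, y) \<in> AU \<and> \<phi> x mod 2 ^ j = \<phi> y mod 2 ^ j" for x y
        by (auto simp: AU_def BU_def B_def same_class_def inner_edges_def)
      have "class_weight n j \<phi> (\<beta> u) u =
          (\<Sum>e\<in>BU. (if fst e = u then 1 else 0) + (if snd e = u then 1 else 0))" if "u \<in> U" for u
      proof -
        have "u < n" using that U(1) by auto
        show ?thesis unfolding class_weight_def incidence_sum[OF BU \<open>u < n\<close>]
          by (rule sum.cong) (auto simp: \<beta>_def BU_iff)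
      qed
      then have "(\<Sum>u\<in>U. class_weight n j \<phi> (\<beta> u) u) =
          (\<Sum>u\<in>U. \<Sum>e\<in>BU. (if fst e = u then 1 else 0) + (if snd e = u then 1 else 0))"
        by (intro sum.cong) auto
      also have "\<dots> = 2 * real (card BU)"
        by (rule degree_sum[OF BU U(1)]) (auto simp: BU_def inner_edges_def)
      finally show ?thesis .
    qed
    also have "\<dots> \<le> 2 * (max_dens n B fst snd * real (card U))"
      unfolding BU_def using max_dens_ge[OF n1 U(1,2)] by (intro mult_left_mono) auto
    finally have "(1 - \<delta>) * real (card AU) \<le> 2 ^ j * max_dens n B fst snd * real (card U)"
      by (simp add: field_simps)
    moreover have "real (card AU) = d * real (card U)"
      using U finite_subset[of U "{..<n}"] by (simp add: AU_def)
    moreover have "real (card U) > 0" using U(1,2) finite_subset[of U "{..<n}"] by (auto simp: card_gt_0_iff)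
    ultimately have 3: "(1 - \<delta>) * d \<le> 2 ^ j * max_dens n B fst snd" by (simp add: mult.assoc[symmetric])
    show ?thesis using 1 2 3 by (simp add: concentrated_def B_def d_def)
  qed
  have dD: "d \<le> D" using d \<delta> by (simp add: D_def)
  have E': "E \<le> x / 2 ^ j * \<delta>\<^sup>2 / 4" if "d \<le> x" for x
  proof -
    have "d / 2 ^ j * \<delta>\<^sup>2 / 4 \<le> x / 2 ^ j * \<delta>\<^sup>2 / 4"
      using that by (intro divide_right_mono mult_right_mono) auto
    then show ?thesis using E by (simp add: d_def)
  qed
  have t1: "avg (n * w) (\<lambda>xs. of_bool (bad u (cell w xs))) \<le> exp (- E)" if "u < n" for u
    unfolding bad_def
    by (rule class_weight_upper_tail[OF that j]) (use \<alpha>01 \<delta> sum\<alpha>[OF that] E'[OF dD] in auto)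
  have t2: "avg (n * w) (\<lambda>xs. of_bool (bad' u (cell w xs))) \<le> exp (- E)" if "u < n" for u
  proof (cases "u \<in> U")
    case True
    then have "avg (n * w) (\<lambda>xs. of_bool (bad' u (cell w xs))) =
        avg (n * w) (\<lambda>xs. of_bool (class_weight n j (cell w xs) (\<beta> u) u < (1 - \<delta>) * (deg u / 2 ^ j)))"
      by (simp add: bad'_def)
    also have "\<dots> \<le> exp (- E)"
      by (rule class_weight_lower_tail[OF that j])
        (use \<delta> E'[OF deg[OF True]] in \<open>auto simp: \<beta>_def deg_def\<close>)
    finally show ?thesis .
  qed (simp add: bad'_def)
  have "avg (n * w) (\<lambda>xs. of_bool (\<not> concentrated n A \<delta> j (cell w xs))) \<le>
      avg (n * w) (\<lambda>xs. (\<Sum>u<n. of_bool (bad u (cell w xs))) + (\<Sum>u<n. of_bool (bad' u (cell w xs))))"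
  proof (rule avg_Markov)
    fix xs assume "\<not> concentrated n A \<delta> j (cell w xs)"
    then obtain u where u: "u < n" "bad u (cell w xs) \<or> bad' u (cell w xs)" using conc by blast
    have "of_bool (bad u (cell w xs)) \<le> (\<Sum>u<n. of_bool (bad u (cell w xs)) :: real)"
      by (rule member_le_sum[where f = "\<lambda>u. of_bool (bad u (cell w xs))"]) (use u(1) in auto)
    moreover have "of_bool (bad' u (cell w xs)) \<le> (\<Sum>u<n. of_bool (bad' u (cell w xs)) :: real)"
      by (rule member_le_sum[where f = "\<lambda>u. of_bool (bad' u (cell w xs))"]) (use u(1) in auto)
    moreover have "0 \<le> (\<Sum>u<n. of_bool (bad u (cell w xs)) :: real)" "0 \<le> (\<Sum>u<n. of_bool (bad' u (cell w xs)) :: real)"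
      by (auto intro: sum_nonneg)
    ultimately show "1 \<le> (\<Sum>u<n. of_bool (bad u (cell w xs)) :: real) + (\<Sum>u<n. of_bool (bad' u (cell w xs)))"
      using u(2) by auto
  qed (auto intro!: add_nonneg_nonneg sum_nonneg)
  also have "\<dots> \<le> (\<Sum>u<n. exp (- E)) + (\<Sum>u<n. exp (- E))"
    unfolding avg_add avg_sum by (intro add_mono sum_mono) (auto intro: t1 t2)
  finally show ?thesis by simp
qed

end

section \<open>Isolation in hash buckets\<close>

text \<open>Block 0 of the table holds the colours; blocks \<open>2 * r + 1\<close> and
  \<open>2 * r + 2\<close> are two fresh vertex tables for repetition \<open>r\<close>. Adding one
  entry for each endpoint gives pairwise collision probability \<open>1 / K\<close> from
  \<open>2 * n\<close> random words.\<close>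

definition bucket :: "nat \<Rightarrow> nat \<Rightarrow> (nat \<Rightarrow> nat) \<Rightarrow> nat \<Rightarrow> nat \<times> nat \<Rightarrow> nat" where
  "bucket n K T r e = (T ((2 * r + 1) * n + fst e) + T ((2 * r + 2) * n + snd e)) mod K"

definition isolated :: "nat \<Rightarrow> nat \<Rightarrow> (nat \<Rightarrow> nat) \<Rightarrow> (nat \<times> nat) set \<Rightarrow> nat \<Rightarrow> nat \<times> nat \<Rightarrow> bool" where
  "isolated n K T B r e \<longleftrightarrow> (\<forall>e'\<in>B. bucket n K T r e' = bucket n K T r e \<longrightarrow> e' = e)"

text \<open>There is no peeling: each edge has to be alone in its bucket in some repetition, without
  prior removal of other edges.\<close>

definition decodable :: "nat \<Rightarrow> nat \<Rightarrow> nat \<Rightarrow> (nat \<Rightarrow> nat) \<Rightarrow> (nat \<times> nat) set \<Rightarrow> bool" where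
  "decodable n K R T B \<longleftrightarrow> (\<forall>e\<in>B. \<exists>r<R. isolated n K T B r e)"

lemma sum_shift_mod:
  fixes K :: nat
  assumes "0 < K"
  shows "(\<Sum>y<K. of_bool ((y + a) mod K = c mod K) :: real) = 1"
proof -
  \<comment> \<open>An additive inverse of \<open>a\<close> modulo \<open>K\<close>.\<close>
  define a' where "a' = K - a mod K"
  have a': "(x + a + a') mod K = x mod K" for x
  proof -
    have "x + a + a' = x + (a div K * K + K)"
      using mod_less_divisor[OF assms, of a] div_mult_mod_eq[of a K] unfolding a'_def by linarith
    then have "x + a + a' = x + (a div K + 1) * K" by simp
    then show ?thesis by (simp only: mod_mult_self1)
  qed
  have "(y + a) mod K = c mod K \<longleftrightarrow> y = (c + a') mod K" if "y < K" for y
  proof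
    assume "(y + a) mod K = c mod K"
    then have "(y + a + a') mod K = (c + a') mod K" by (metis mod_add_left_eq)
    then show "y = (c + a') mod K" using a'[of y] that by simp
  next
    assume "y = (c + a') mod K"
    then have "(y + a) mod K = (c + a' + a) mod K" by (simp add: mod_add_left_eq)
    then show "(y + a) mod K = c mod K" using a'[of c] by (simp add: add.commute add.left_commute)
  qed
  then have "(\<Sum>y<K. of_bool ((y + a) mod K = c mod K) :: real) = (\<Sum>y<K. of_bool (y = (c + a') mod K))"
    by (intro sum.cong) auto
  also have "\<dots> = 1" using assms by (simp add: of_bool_def)
  finally show ?thesis .
qed

lemma avg_collision:
  assumes "u < n" "u' < n" "v < n" "v' < n" "(u, v) \<noteq> (u', v')"
  shows "avg (2 * n * w) (\<lambda>xs. of_bool ((cell w xs u + cell w xs (n + v)) mod 2 ^ w =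
    (cell w xs u' + cell w xs (n + v')) mod 2 ^ w)) = 1 / 2 ^ w"
proof -
  define F where "F \<phi> = (of_bool ((\<phi> u + \<phi> (n + v)) mod 2 ^ w = (\<phi> u' + \<phi> (n + v')) mod 2 ^ w) :: real)"
    for \<phi> :: "nat \<Rightarrow> nat"
  \<comment> \<open>The resampled entry belongs to a coordinate in which the two pairs differ, so it
    occurs on one side of the equation only.\<close>
  have "\<exists>i<2 * n. \<forall>\<phi>. (\<Sum>y<2 ^ w. F (\<phi>(i := y))) = 1"
  proof (cases "u = u'")
    case False
    then have "(\<Sum>y<2 ^ w. F (\<phi>(u := y))) = 1" for \<phi>
      using assms sum_shift_mod[of "2 ^ w" "\<phi> (n + v)" "\<phi> u' + \<phi> (n + v')"] by (simp add: F_def)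
    then show ?thesis using assms by (intro exI[of _ u]) auto
  next
    case True
    then have "(\<Sum>y<2 ^ w. F (\<phi>(n + v := y))) = 1" for \<phi>
      using assms sum_shift_mod[of "2 ^ w" "\<phi> u" "\<phi> u' + \<phi> (n + v')"] by (simp add: F_def add.commute)
    then show ?thesis using assms by (intro exI[of _ "n + v"]) auto
  qed
  then obtain i where "i < 2 * n" "\<And>\<phi>. (\<Sum>y<2 ^ w. F (\<phi>(i := y))) = 1" by blast
  then show ?thesis using avg_resample[of i "2 * n" w F] by (simp add: F_def)
qed

lemma cell_append1: "length f = n * w \<Longrightarrow> i < n \<Longrightarrow> cell w (f @ zs) i = cell w f i"
proof -
  assume a: "length f = n * w" "i < n"
  have "Suc i * w \<le> n * w" using a(2) by (intro mult_right_mono) auto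
  then show ?thesis using a by (simp add: cell_def)
qed

lemma cell_append2: "length f = n * w \<Longrightarrow> cell w (f @ zs) (n + k) = cell w zs k"
  by (simp add: cell_def algebra_simps)

lemma cell_block:
  assumes "k < m"
  shows "cell w (take (m * w) (drop (r * (m * w)) zs)) k = cell w zs (r * m + k)"
proof -
  have "Suc k * w \<le> m * w" using assms by (intro mult_right_mono) auto
  then have "min w (m * w - k * w) = w" by simp
  then show ?thesis by (simp add: cell_def drop_take algebra_simps)
qed

context simple_graph
begin

lemma avg_not_isolated:
  assumes B: "B \<subseteq> A" and e: "e \<in> B" and c: "2 * card B \<le> 2 ^ w"
  shows "avg (2 * n * w) (\<lambda>ys. of_bool (\<exists>e'\<in>B - {e}.
      (cell w ys (fst e') + cell w ys (n + snd e')) mod 2 ^ w =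
      (cell w ys (fst e) + cell w ys (n + snd e)) mod 2 ^ w)) \<le> 1 / 2"
    (is "avg _ (\<lambda>ys. of_bool (\<exists>e'\<in>_. ?P e' ys)) \<le> _")
proof -
  have fB: "finite B" using B finite_A finite_subset by blast
  have "avg (2 * n * w) (\<lambda>ys. of_bool (\<exists>e'\<in>B - {e}. ?P e' ys)) \<le> (\<Sum>e'\<in>B - {e}. avg (2 * n * w) (\<lambda>ys. of_bool (?P e' ys)))"
    using fB by (intro avg_Ex) auto
  also have "\<dots> = (\<Sum>e'\<in>B - {e}. 1 / 2 ^ w)"
  proof (intro sum.cong avg_collision)
    fix e' assume e': "e' \<in> B - {e}"
    show "fst e' < n" "snd e' < n" "fst e < n" "snd e < n"
      using e' e B A[of "fst e'" "snd e'"] A[of "fst e" "snd e"] by auto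
    show "(fst e', snd e') \<noteq> (fst e, snd e)" using e' by auto
  qed simp
  also have "\<dots> \<le> real (card B) / 2 ^ w"
    using fB e by (simp add: card_Diff_singleton divide_right_mono of_nat_diff)
  also have "\<dots> \<le> 1 / 2"
  proof -
    have "real (2 * card B) \<le> real (2 ^ w)" using c unfolding of_nat_le_iff .
    then show ?thesis by (simp add: field_simps)
  qed
  finally show ?thesis .
qed

text \<open>The sampled edges depend on the first \<open>n\<close> entries only. With these fixed,
  the repetitions use disjoint coins, so an edge fails in all of them with probability at most
  \<open>1 / 2 ^ R\<close>. The size condition is part of the event because it is decided by the
  colours.\<close>

lemma avg_not_decodable:
  "avg ((2 * R + 1) * n * w) (\<lambda>xs. of_bool (2 * card (same_class j (cell w xs) A) \<le> 2 ^ w \<and>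
     \<not> decodable n (2 ^ w) R (cell w xs) (same_class j (cell w xs) A))) \<le> (real n)\<^sup>2 / 2 ^ R"
proof -
  define L where "L = 2 * n * w"
  define P where "P e B ys \<longleftrightarrow> (\<exists>e'\<in>B - {e}.
      (cell w ys (fst e') + cell w ys (n + snd e')) mod 2 ^ w =
      (cell w ys (fst e) + cell w ys (n + snd e)) mod 2 ^ w)" for e B ys
  define S where "S f = same_class j (cell w f) A" for f
  have len: "(2 * R + 1) * n * w = n * w + R * L" by (simp add: L_def algebra_simps)
  have main: "avg (R * L) (\<lambda>zs. of_bool (2 * card (same_class j (cell w (f @ zs)) A) \<le> 2 ^ w \<and>
     \<not> decodable n (2 ^ w) R (cell w (f @ zs)) (same_class j (cell w (f @ zs)) A))) \<le> (real n)\<^sup>2 / 2 ^ R"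
    if f: "length f = n * w" for f
  proof (cases "2 * card (S f) \<le> 2 ^ w")
    case False
    have "same_class j (cell w (f @ zs)) A = S f" for zs
      using A cell_append1[OF f] by (fastforce simp: same_class_def S_def)
    then show ?thesis using False by simp
  next
    case True
    have S: "same_class j (cell w (f @ zs)) A = S f" for zs
      using A cell_append1[OF f] by (fastforce simp: same_class_def S_def)
    have SA: "S f \<subseteq> A" by (auto simp: S_def same_class_def)
    have fin: "finite (S f)" using SA finite_A finite_subset by blast
    have bucket: "bucket n (2 ^ w) (cell w (f @ zs)) r e =
        (cell w (take L (drop (r * L) zs)) (fst e) + cell w (take L (drop (r * L) zs)) (n + snd e)) mod 2 ^ w"
      if e: "e \<in> S f" for r e zs
    proof -
      have en: "fst e < n" "snd e < n" using e SA A[of "fst e" "snd e"] by auto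
      have "(2 * r + 1) * n + fst e = n + (r * (2 * n) + fst e)"
        "(2 * r + 2) * n + snd e = n + (r * (2 * n) + (n + snd e))" by (simp_all add: algebra_simps)
      then show ?thesis
        unfolding bucket_def L_def using en
        by (simp only: cell_append2[OF f] cell_block[of "fst e" "2 * n"] cell_block[of "n + snd e" "2 * n"])
    qed
    have notdec: "\<not> decodable n (2 ^ w) R (cell w (f @ zs)) (S f) \<longleftrightarrow>
        (\<exists>e\<in>S f. \<forall>r<R. P e (S f) (take L (drop (r * L) zs)))" for zs
    proof -
      have "isolated n (2 ^ w) (cell w (f @ zs)) (S f) r e \<longleftrightarrow> \<not> P e (S f) (take L (drop (r * L) zs))"
        if "e \<in> S f" for r e
        using that unfolding isolated_def P_def by (simp add: bucket) blast
      then show ?thesis unfolding decodable_def by blast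
    qed
    have "avg (R * L) (\<lambda>zs. of_bool (\<exists>e\<in>S f. \<forall>r<R. P e (S f) (take L (drop (r * L) zs)))) \<le>
        (\<Sum>e\<in>S f. avg (R * L) (\<lambda>zs. of_bool (\<forall>r<R. P e (S f) (take L (drop (r * L) zs)))))"
      by (rule avg_Ex[OF fin])
    also have "\<dots> = (\<Sum>e\<in>S f. avg (R * L) (\<lambda>zs. \<Prod>r<R. of_bool (P e (S f) (take L (drop (r * L) zs)))))"
    proof -
      have "(of_bool (\<forall>r<R. Q r) :: real) = (\<Prod>r<R. of_bool (Q r))" for Q
        by (induction R) (auto simp: less_Suc_eq)
      then show ?thesis by simp
    qed
    also have "\<dots> = (\<Sum>e\<in>S f. (avg L (\<lambda>ys. of_bool (P e (S f) ys))) ^ R)"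
      unfolding avg_blocks[of R L "\<lambda>_ ys. of_bool (P _ (S f) ys)"] by simp
    also have "\<dots> \<le> (\<Sum>e\<in>S f. (1 / 2) ^ R)"
    proof (intro sum_mono power_mono)
      fix e assume "e \<in> S f"
      from avg_not_isolated[OF SA this True] show "avg L (\<lambda>ys. of_bool (P e (S f) ys)) \<le> 1 / 2"
        by (simp add: L_def P_def)
      have "avg L (\<lambda>_. 0) \<le> avg L (\<lambda>ys. of_bool (P e (S f) ys))" by (rule avg_mono) auto
      then show "0 \<le> avg L (\<lambda>ys. of_bool (P e (S f) ys))" by simp
    qed
    also have "\<dots> = real (card (S f)) / 2 ^ R" by (simp add: power_divide)
    also have "\<dots> \<le> (real n)\<^sup>2 / 2 ^ R"
    proof -
      have "card (S f) \<le> n\<^sup>2" using card_mono[OF finite_A SA] card_A by simp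
      then have "real (card (S f)) \<le> (real n)\<^sup>2" unfolding of_nat_power[symmetric] of_nat_le_iff .
      then show ?thesis by (intro divide_right_mono) auto
    qed
    finally show ?thesis using True by (simp add: S notdec)
  qed
  show ?thesis
    unfolding len avg_append by (rule order_trans[OF avg_mono[OF main]]) auto
qed

text \<open>The witness is the deterministic level \<open>J\<close>. The clause on \<open>d\<close>
  for positive levels is passed on so that \<open>outputs_if_sampled\<close> can conclude that the
  cap on the accuracy was inactive.\<close>

lemma avg_sampling_fails:
  fixes l q w :: nat
  assumes l: "n < 2 ^ l" and q: "1 \<le> q" and w: "1440 * n * q\<^sup>2 * l < 2 ^ w"
  defines "d \<equiv> max_dens n A fst snd"
  shows "avg ((2 * (5 * l) + 1) * n * w) (\<lambda>xs. of_bool (\<not> (\<exists>j<l.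
     (0 < j \<longrightarrow> 360 * real (q\<^sup>2 * l) \<le> d) \<and>
     decodable n (2 ^ w) (5 * l) (cell w xs) (same_class j (cell w xs) A) \<and>
     (\<forall>i. 0 < i \<and> i \<le> j \<longrightarrow> concentrated n A (1 / (3 * real q)) i (cell w xs))))) \<le> 1 / real n"
proof -
  \<comment> \<open>180 = 5 * 4 * 9, so that \<open>\<tau> * \<delta>^2 / 4\<close> equals
    \<open>5 * l\<close> for \<open>\<delta> = 1 / (3 * q)\<close>.\<close>
  define \<tau> where "\<tau> = 180 * real (q\<^sup>2 * l)"
  define \<delta> where "\<delta> = 1 / (3 * real q)"
  have l0: "0 < l" using l n1 by (cases l) auto
  have q2: "0 < q\<^sup>2" using q by simp
  then have \<tau>1: "1 \<le> q\<^sup>2 * l" using l0 by simp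
  have "1 \<le> real (q\<^sup>2 * l)" using \<tau>1 by linarith
  then have \<tau>: "1 \<le> \<tau>" unfolding \<tau>_def by linarith
  have \<delta>: "0 < \<delta>" "\<delta> \<le> 1 / 3" using q by (auto simp: \<delta>_def field_simps)
  have dn: "d \<le> real n" unfolding d_def by (rule max_dens_le_n)
  have d0: "0 \<le> d" unfolding d_def by (rule max_dens_nonneg[OF n1])
  have ex: "d / 2 ^ l < 2 * \<tau>"
  proof -
    have "real n < 2 ^ l" using l by simp
    then have "d < 2 ^ l" using dn by linarith
    then have "d / 2 ^ l < 1" by simp
    then show ?thesis using \<tau> by linarith
  qed
  \<comment> \<open>Minimality keeps \<open>d / 2 ^ J\<close> at least \<tau> if \<open>J\<close> is
    positive (concentration), while the defining inequality keeps it below \<open>2 * \<tau>\<close>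
    (few edges).\<close>
  define J where "J = (LEAST j. d / 2 ^ j < 2 * \<tau>)"
  have J1: "d / 2 ^ J < 2 * \<tau>" unfolding J_def by (rule LeastI[of _ l]) (rule ex)
  have J2: "2 * \<tau> \<le> d / 2 ^ (J - 1)" if "0 < J"
    using not_less_Least[of "J - 1" "\<lambda>j. d / 2 ^ j < 2 * \<tau>"] that unfolding J_def[symmetric] by auto
  have J3: "2 ^ J * \<tau> \<le> d" if "0 < J"
    using J2[OF that] power_Suc[of "2 :: real" "J - 1"] that by (simp add: field_simps)
  have Jn: "2 ^ J \<le> n"
  proof (cases "0 < J")
    case True
    have "real (2 ^ J) \<le> 2 ^ J * \<tau>" using \<tau> by simp
    also have "\<dots> \<le> real n" using J3[OF True] dn by simp
    finally show ?thesis unfolding of_nat_le_iff .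
  qed (use n1 in simp)
  have Jl: "J < l" using le_less_trans[OF Jn l] by simp
  have "n * 1 \<le> n * (1440 * (q\<^sup>2 * l))" using \<tau>1 by (intro mult_left_mono) auto
  also have "\<dots> = 1440 * n * q\<^sup>2 * l" by (simp add: mult_ac)
  also note w
  finally have nw: "n < 2 ^ w" by simp
  have Jw: "J \<le> w" using le_less_trans[OF Jn nw] by simp
  \<comment> \<open>With (4/3)^2 \<le> 2, twice the edge number is at most
    \<open>4 * n * (d / 2 ^ J)\<close>, which is bounded by
    \<open>8 * n * \<tau> = 1440 * n * q^2 * l\<close>.\<close>
  have card_J: "2 * card (same_class J \<phi> A) \<le> 2 ^ w"
    if "0 < J \<longrightarrow> concentrated n A \<delta> J \<phi>" for \<phi>
  proof -
    have "2 ^ J * real (card (same_class J \<phi> A)) \<le> real n * 2 * d"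
    proof (cases "0 < J")
      case True
      then have "2 ^ J * real (card (same_class J \<phi> A)) \<le> real n * (1 + \<delta>)\<^sup>2 * d"
        using that by (simp add: concentrated_def d_def)
      also have "(1 + \<delta>)\<^sup>2 \<le> (1 + 1 / 3)\<^sup>2" using \<delta> by (intro power_mono) auto
      then have "real n * (1 + \<delta>)\<^sup>2 * d \<le> real n * 2 * d"
        using d0 by (intro mult_right_mono mult_left_mono) (auto simp: power2_eq_square)
      finally show ?thesis .
    next
      case False
      have "inner_edges A fst snd {..<n} = A" using A by (fastforce simp: inner_edges_def)
      moreover have "{..<n} \<noteq> {}" using n1 by (simp add: lessThan_empty_iff)
      ultimately have "real (card A) \<le> d * real n" using max_dens_ge[OF n1, of "{..<n}" A fst snd] by (simp add: d_def)
      also have "\<dots> \<le> real n * 2 * d" using d0 by simp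
      finally show ?thesis using False by simp
    qed
    then have "2 * real (card (same_class J \<phi> A)) \<le> real n * 4 * (d / 2 ^ J)" by (simp add: field_simps)
    also have "\<dots> \<le> real n * 4 * (2 * \<tau>)" using J1 by (intro mult_left_mono) auto
    also have "\<dots> = real (1440 * n * q\<^sup>2 * l)" by (simp add: \<tau>_def)
    finally have "real (2 * card (same_class J \<phi> A)) \<le> real (1440 * n * q\<^sup>2 * l)" by simp
    then show ?thesis using w unfolding of_nat_le_iff by linarith
  qed
  have conc: "avg (n * w) (\<lambda>xs. of_bool (\<not> concentrated n A \<delta> i (cell w xs))) \<le> 2 * real n / 2 ^ (5 * l)"
    if i: "0 < i" "i \<le> J" for i
  proof -
    have J0: "0 < J" using i by simp
    have dpos: "0 < d" using J3[OF J0] \<tau> by (smt (verit) mult_pos_pos zero_less_power)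
    have "inner_edges {} fst snd U = {}" for U :: "nat set" by (simp add: inner_edges_def)
    then have "max_dens n {} fst snd \<le> 0" unfolding max_dens_le_iff[OF n1] by simp
    then have ne: "A \<noteq> {}" using dpos by (auto simp: d_def)
    have "\<tau> \<le> d / 2 ^ J" using J3[OF J0] by (simp add: field_simps)
    also have "\<dots> \<le> d / 2 ^ i" using i d0 by (intro divide_left_mono) (auto intro: power_increasing)
    finally have "\<tau> * \<delta>\<^sup>2 / 4 \<le> d / 2 ^ i * \<delta>\<^sup>2 / 4" by (intro divide_right_mono mult_right_mono) auto
    moreover have "\<tau> * \<delta>\<^sup>2 / 4 = real (5 * l)"
      using q by (simp add: \<tau>_def \<delta>_def power2_eq_square field_simps)
    ultimately have "avg (n * w) (\<lambda>xs. of_bool (\<not> concentrated n A \<delta> i (cell w xs))) \<le> 2 * real n * exp (- real (5 * l))"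
      using \<delta> i Jw by (intro avg_not_concentrated[OF ne]) (auto simp: d_def)
    also have "exp (- real (5 * l)) \<le> 1 / 2 ^ (5 * l)"
    proof -
      have "2 ^ (5 * l) \<le> exp (1 :: real) ^ (5 * l)" using exp_ge_add_one_self[of 1] by (intro power_mono) auto
      also have "\<dots> = exp (real (5 * l))" by (simp flip: exp_of_nat_mult)
      finally show ?thesis by (simp add: exp_minus field_simps)
    qed
    finally show ?thesis by (simp add: mult_left_mono)
  qed
  let ?N = "(2 * (5 * l) + 1) * n * w"
  \<comment> \<open>Concentration is a property of the colours, so the coins of the hash tables
    average out.\<close>
  have conc': "avg ?N (\<lambda>xs. of_bool (\<not> concentrated n A \<delta> i (cell w xs))) \<le> 2 * real n / 2 ^ (5 * l)"
    if i: "0 < i" "i \<le> J" for i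
  proof -
    have len: "?N = n * w + 10 * l * n * w" by (simp add: algebra_simps)
    have "avg ?N (\<lambda>xs. of_bool (\<not> concentrated n A \<delta> i (cell w xs))) =
      avg (n * w) (\<lambda>xs. avg (10 * l * n * w) (\<lambda>zs. of_bool (\<not> concentrated n A \<delta> i (cell w xs))))"
      unfolding len avg_append
    proof (intro avg_cong)
      fix f zs :: "bool list" assume f: "length f = n * w"
      have "same_class i (cell w (f @ zs)) A = same_class i (cell w f) A"
        using A cell_append1[OF f] by (fastforce simp: same_class_def)
      then show "(of_bool (\<not> concentrated n A \<delta> i (cell w (f @ zs))) :: real) = of_bool (\<not> concentrated n A \<delta> i (cell w f))"
        by (simp add: concentrated_def)
    qed
    then show ?thesis using conc[OF i] by simp
  qed
  let ?dec = "\<lambda>xs. decodable n (2 ^ w) (5 * l) (cell w xs) (same_class J (cell w xs) A)"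
  let ?c = "\<lambda>xs. 2 * card (same_class J (cell w xs) A) \<le> 2 ^ w"
  let ?I = "{i. 0 < i \<and> i \<le> J}"
  have fI: "finite ?I" by simp
  have cI: "card ?I = J" using card_greaterThanAtMost[of 0 J] by (simp add: greaterThanAtMost_def greaterThan_def atMost_def Int_def)
  have "avg ?N (\<lambda>xs. of_bool (\<not> (\<exists>j<l. (0 < j \<longrightarrow> 360 * real (q\<^sup>2 * l) \<le> d) \<and>
     decodable n (2 ^ w) (5 * l) (cell w xs) (same_class j (cell w xs) A) \<and>
     (\<forall>i. 0 < i \<and> i \<le> j \<longrightarrow> concentrated n A \<delta> i (cell w xs))))) \<le>
    avg ?N (\<lambda>xs. of_bool (\<exists>i\<in>?I. \<not> concentrated n A \<delta> i (cell w xs)) + of_bool (?c xs \<and> \<not> ?dec xs))"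
  proof (rule avg_Markov)
    fix xs assume *: "\<not> (\<exists>j<l. (0 < j \<longrightarrow> 360 * real (q\<^sup>2 * l) \<le> d) \<and>
     decodable n (2 ^ w) (5 * l) (cell w xs) (same_class j (cell w xs) A) \<and>
     (\<forall>i. 0 < i \<and> i \<le> j \<longrightarrow> concentrated n A \<delta> i (cell w xs)))"
    have "360 * real (q\<^sup>2 * l) \<le> d" if "0 < J"
    proof -
      have "2 * \<tau> \<le> 2 ^ J * \<tau>" using that \<tau> by (intro mult_right_mono) (auto intro: self_le_power)
      moreover have "360 * real (q\<^sup>2 * l) = 2 * \<tau>" by (simp add: \<tau>_def)
      ultimately show ?thesis using J3[OF that] by linarith
    qed
    then have "\<not> ?dec xs \<or> (\<exists>i\<in>?I. \<not> concentrated n A \<delta> i (cell w xs))" using * Jl by blast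
    moreover have "?c xs" if "\<not> (\<exists>i\<in>?I. \<not> concentrated n A \<delta> i (cell w xs))"
      using that by (intro card_J) auto
    ultimately show "1 \<le> of_bool (\<exists>i\<in>?I. \<not> concentrated n A \<delta> i (cell w xs)) + (of_bool (?c xs \<and> \<not> ?dec xs) :: real)"
      by (cases "\<exists>i\<in>?I. \<not> concentrated n A \<delta> i (cell w xs)") auto
  qed auto
  also have "\<dots> \<le> (\<Sum>i\<in>?I. 2 * real n / 2 ^ (5 * l)) + (real n)\<^sup>2 / 2 ^ (5 * l)"
    unfolding avg_add
    by (intro add_mono order_trans[OF avg_Ex[OF fI]] sum_mono avg_not_decodable) (use conc' in blast)
  also have "\<dots> = (2 * real n * real J + (real n)\<^sup>2) / 2 ^ (5 * l)"
    by (simp add: cI add_divide_distrib)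
  also have "\<dots> \<le> (3 * (real n)\<^sup>2) / 2 ^ (5 * l)"
  proof (intro divide_right_mono)
    have "J < 2 ^ J" by (rule less_exp)
    then have "real J \<le> real n" using Jn by linarith
    then show "2 * real n * real J + (real n)\<^sup>2 \<le> 3 * (real n)\<^sup>2" by (simp add: power2_eq_square mult_left_mono)
  qed simp
  also have "\<dots> \<le> 1 / real n"
  proof -
    \<comment> \<open>Five factors \<open>2 ^ l\<close> absorb the constant and
      \<open>n ^ 3\<close>: three exceed \<open>n\<close> each, the other two are at least
      2.\<close>
    have "3 * n ^ 3 \<le> 2\<^sup>2 * n ^ 3" by simp
    also have "\<dots> \<le> (2 ^ l)\<^sup>2 * (2 ^ l) ^ 3"
      using l n1 by (intro mult_mono power_mono) auto
    also have "\<dots> = 2 ^ (5 * l)" by (simp flip: power_mult power_add)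
    finally have "real (3 * n ^ 3) \<le> real (2 ^ (5 * l))" unfolding of_nat_le_iff .
    then show ?thesis using n1 by (simp add: field_simps power2_eq_square power3_eq_cube)
  qed
  finally show ?thesis by (simp add: \<delta>_def)
qed

end

section \<open>A Hoare logic with resource bounds\<close>

text \<open>An exponent: if all registers stay below \<open>W\<close>, the value of \<open>e\<close>
  stays below \<open>W ^ expr_size e\<close>. Constants are counted crudely, via k < 2^k.\<close>

fun expr_size :: "expr \<Rightarrow> nat" where
  "expr_size (Const k) = k + 1"
| "expr_size (Reg e) = 1"
| "expr_size (Op f e1 e2) = expr_size e1 + expr_size e2"

fun expr_cost :: "expr \<Rightarrow> nat" where
  "expr_cost (Const k) = k + 2"
| "expr_cost (Reg e) = 2 + expr_cost e + expr_size e"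
| "expr_cost (Op f e1 e2) = 1 + expr_cost e1 + expr_cost e2 + expr_size e1 + expr_size e2"

text \<open>A loop is counted with a single pass; the number of passes goes into the factor
  \<open>T\<close> of \<open>triple\<close>.\<close>

fun com_cost :: "com \<Rightarrow> nat" where
  "com_cost Skip = 1"
| "com_cost (Assign a e) = 1 + expr_cost a + expr_cost e + expr_size a + expr_size e"
| "com_cost (Flip a) = 2 + expr_cost a + expr_size a"
| "com_cost (Seq c1 c2) = com_cost c1 + com_cost c2"
| "com_cost (If e c1 c2) = 1 + expr_cost e + expr_size e + com_cost c1 + com_cost c2"
| "com_cost (While e c) = 1 + expr_cost e + expr_size e + com_cost c"

lemma expr_size_pos: "0 < expr_size e"
  by (induction e) auto

lemma bits_le_power:
  assumes "x < W ^ k"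
  shows "bits x \<le> k * bits W"
proof -
  have "W < 2 ^ bits W" using floorlog_bounds[of W 2] by (cases "W = 0") auto
  then have "W ^ k \<le> (2 ^ bits W) ^ k" by (intro power_mono) auto
  then have "x < 2 ^ (k * bits W)" using assms by (simp add: power_mult[symmetric] mult.commute)
  then show ?thesis by (simp add: floorlog_leI)
qed

lemma bits_pos: "2 \<le> W \<Longrightarrow> 1 \<le> bits W"
  using floorlog_eq_zero_iff[of 2 W] by (cases "bits W") auto

lemma eval_expr_less:
  assumes W: "2 \<le> W" and m: "\<And>r. m r < W"
  shows "eval_expr e m < W ^ expr_size e"
proof (induction e)
  case (Const k)
  have "k < 2 ^ k" by simp
  also have "\<dots> \<le> W ^ k" using W by (intro power_mono) auto
  also have "\<dots> \<le> W ^ (k + 1)" using W by (intro power_increasing) auto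
  finally show ?case by simp
next
  case (Op f e1 e2)
  let ?x = "eval_expr e1 m" and ?y = "eval_expr e2 m"
  let ?p = "W ^ expr_size e1" and ?q = "W ^ expr_size e2"
  have "W ^ 1 \<le> W ^ expr_size e" for e
    using W expr_size_pos[of e] by (intro power_increasing) auto
  then have pq: "2 \<le> ?p" "2 \<le> ?q" using W by (auto intro: order_trans)
  obtain p' q' where p': "?p = p' + 2" "?q = q' + 2" using pq by (metis add.commute le_Suc_ex)
  \<comment> \<open>Both bounds are at least 2, so a sum is covered by the product as well, and one
    exponent serves all operations.\<close>
  have "?p + ?q \<le> ?p * ?q" unfolding p' by (simp add: algebra_simps)
  then have *: "?x + ?y < ?p * ?q" using Op by linarith
  have **: "?x * ?y < ?p * ?q" using Op W by (intro mult_strict_mono) auto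
  have "apply_op f ?x ?y \<le> ?x + ?y \<or> apply_op f ?x ?y = ?x * ?y"
    by (cases f) (auto intro: le_trans[OF div_le_dividend] le_trans[OF mod_less_eq_dividend])
  then show ?case using * ** by (auto simp: power_add)
qed (use m in auto)

lemma expr_time_le:
  assumes W: "2 \<le> W" and m: "\<And>r. m r < W"
  shows "expr_time e m \<le> expr_cost e * bits W"
proof (induction e)
  case (Const k)
  have "bits k \<le> (k + 1) * bits W"
    using eval_expr_less[OF W m, of "Const k"] by (intro bits_le_power) auto
  then show ?case using bits_pos[OF W] by simp
next
  case (Reg e)
  have "bits (eval_expr e m) \<le> expr_size e * bits W"
    by (rule bits_le_power) (rule eval_expr_less[OF W m])
  moreover have "bits (m (eval_expr e m)) \<le> bits W"
    using m by (intro floorlog_mono) (simp add: less_imp_le)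
  ultimately show ?case using Reg bits_pos[OF W] by (simp add: algebra_simps)
next
  case (Op f e1 e2)
  have "bits (eval_expr e m) \<le> expr_size e * bits W" for e
    by (rule bits_le_power) (rule eval_expr_less[OF W m])
  from this[of e1] this[of e2] show ?case using Op bits_pos[OF W] by (simp add: algebra_simps)
qed

text \<open>The guard is a truncated subtraction, nonzero exactly while the counter is below the
  bound, which is evaluated anew before each pass.\<close>

definition For :: "nat \<Rightarrow> expr \<Rightarrow> com \<Rightarrow> com" where
  "For x b c = Seq (Assign (Const x) (Const 0))
     (While (Op Minus b (Reg (Const x)))
       (Seq c (Assign (Const x) (Op Plus (Reg (Const x)) (Const 1)))))"

text \<open>
  Throughout, \<open>W\<close> bounds the contents and \<open>D\<close> the addresses of all registers in use.  The first
  argument of an assertion is the list of all coins consumed so far.  Running times are measured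
  in multiples of \<open>bits W\<close> and of the syntactic cost of the program.
\<close>

locale ram =
  fixes W D :: nat
  assumes W: "2 \<le> W"
begin

definition ok :: "memory \<Rightarrow> bool" where
  "ok m \<longleftrightarrow> (\<forall>r. m r < W) \<and> (\<forall>r\<ge>D. m r = 0)"

definition space :: nat where
  "space = D * (bits D + bits W)"

lemma memory_bits_le:
  assumes "ok m"
  shows "memory_bits m \<le> space"
proof -
  have sub: "{r. m r \<noteq> 0} \<subseteq> {..<D}" using assms by (auto simp: ok_def intro: not_le_imp_less)
  have "memory_bits m \<le> (\<Sum>r | m r \<noteq> 0. bits D + bits W)"
    unfolding memory_bits_def
  proof (rule sum_mono)
    fix r assume "r \<in> {r. m r \<noteq> 0}"
    then have "r < D" "m r < W" using sub assms by (auto simp: ok_def)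
    then show "bits r + bits (m r) \<le> bits D + bits W" by (intro add_mono floorlog_mono) auto
  qed
  also have "\<dots> = card {r. m r \<noteq> 0} * (bits D + bits W)" by simp
  also have "\<dots> \<le> D * (bits D + bits W)"
    using card_mono[OF finite_lessThan sub] by (intro mult_right_mono) auto
  finally show ?thesis by (simp add: space_def)
qed

text \<open>Total correctness on every coin sequence. As \<open>com_cost\<close> is additive, the
  same factor \<open>T\<close> passes through sequencing and branching; only loops enlarge
  it.\<close>

definition triple ::
  "nat \<Rightarrow> (bool list \<Rightarrow> memory \<Rightarrow> bool) \<Rightarrow> com \<Rightarrow> (bool list \<Rightarrow> memory \<Rightarrow> bool) \<Rightarrow> bool" where
  "triple T P c Q \<longleftrightarrow> (\<forall>xs m \<omega>. ok m \<longrightarrow> P xs m \<longrightarrow>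
     (\<exists>j t s m'. exec c m (stake j \<omega>) t s m' \<and> t \<le> T * com_cost c * bits W \<and> s \<le> space \<and>
        ok m' \<and> Q (xs @ stake j \<omega>) m'))"

lemma tripleD:
  assumes "triple T P c Q" "ok m" "P xs m"
  obtains j t s m' where "exec c m (stake j \<omega>) t s m'" "t \<le> T * com_cost c * bits W" "s \<le> space"
    "ok m'" "Q (xs @ stake j \<omega>) m'"
  using assms unfolding triple_def by blast

lemma triple_conseq:
  assumes "triple T' P' c Q'" "\<And>xs m. ok m \<Longrightarrow> P xs m \<Longrightarrow> P' xs m" "T' \<le> T"
    "\<And>xs m. ok m \<Longrightarrow> Q' xs m \<Longrightarrow> Q xs m"
  shows "triple T P c Q"
proof -
  have "T' * com_cost c * bits W \<le> T * com_cost c * bits W" using assms(3) by (intro mult_right_mono) auto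
  then show ?thesis using assms(1,2,4) unfolding triple_def by (meson le_trans)
qed

lemma expr_time_ok: "ok m \<Longrightarrow> expr_time e m \<le> expr_cost e * bits W"
  by (rule expr_time_le[OF W]) (simp add: ok_def)

lemma bits_eval_ok: "ok m \<Longrightarrow> bits (eval_expr e m) \<le> expr_size e * bits W"
  by (rule bits_le_power, rule eval_expr_less[OF W]) (simp add: ok_def)

lemma triple_Skip:
  assumes T: "1 \<le> T"
  shows "triple T P Skip P"
  unfolding triple_def
proof (intro allI impI)
  fix xs m \<omega> assume m: "ok m" "P xs m"
  have "1 * 1 \<le> T * bits W" using T bits_pos[OF W] by (intro mult_mono) auto
  moreover have "exec Skip m (stake 0 \<omega>) 1 (memory_bits m) m" using exec.Skip by simp
  ultimately show "\<exists>j t s m'. exec Skip m (stake j \<omega>) t s m' \<and> t \<le> T * com_cost Skip * bits W \<and>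
      s \<le> space \<and> ok m' \<and> P (xs @ stake j \<omega>) m'"
    using m memory_bits_le[OF m(1)] by (intro exI[of _ 0] exI[of _ 1] exI[of _ "memory_bits m"] exI[of _ m]) auto
qed

lemma ok_upd: "ok m \<Longrightarrow> r < D \<Longrightarrow> x < W \<Longrightarrow> ok (m(r := x))"
  by (auto simp: ok_def)

lemma triple_Assign:
  assumes T: "1 \<le> T"
    and P: "\<And>xs m. ok m \<Longrightarrow> P xs m \<Longrightarrow>
      eval_expr a m < D \<and> eval_expr e m < W \<and> Q xs (m(eval_expr a m := eval_expr e m))"
  shows "triple T P (Assign a e) Q"
  unfolding triple_def
proof (intro allI impI)
  fix xs m \<omega> assume m: "ok m" "P xs m"
  let ?m = "m(eval_expr a m := eval_expr e m)"
  have okm: "ok ?m" using P[OF m] m by (intro ok_upd) auto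
  note * = expr_time_ok[OF m(1)] and ** = bits_eval_ok[OF m(1)]
  have "1 + expr_time a m + expr_time e m + bits (eval_expr a m) + bits (eval_expr e m) \<le>
      1 * com_cost (Assign a e) * bits W"
    using *[of a] *[of e] **[of a] **[of e] bits_pos[OF W] by (simp add: algebra_simps)
  also have "\<dots> \<le> T * com_cost (Assign a e) * bits W" using T by (intro mult_right_mono) auto
  finally have "1 + expr_time a m + expr_time e m + bits (eval_expr a m) + bits (eval_expr e m)
      \<le> T * com_cost (Assign a e) * bits W" .
  moreover have "exec (Assign a e) m (stake 0 \<omega>)
      (1 + expr_time a m + expr_time e m + bits (eval_expr a m) + bits (eval_expr e m))
      (max (memory_bits m) (memory_bits ?m)) ?m"
    using exec.Assign[OF refl refl refl] by simp
  moreover have "max (memory_bits m) (memory_bits ?m) \<le> space"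
    using memory_bits_le[OF m(1)] memory_bits_le[OF okm] by simp
  ultimately show "\<exists>j t s m'. exec (Assign a e) m (stake j \<omega>) t s m' \<and>
      t \<le> T * com_cost (Assign a e) * bits W \<and> s \<le> space \<and> ok m' \<and> Q (xs @ stake j \<omega>) m'"
    using okm P[OF m] by (metis append_Nil2 stake.simps(1))
qed

lemma triple_Flip:
  assumes T: "1 \<le> T"
    and P: "\<And>xs m. ok m \<Longrightarrow> P xs m \<Longrightarrow>
      eval_expr a m < D \<and> (\<forall>b. Q (xs @ [b]) (m(eval_expr a m := of_bool b)))"
  shows "triple T P (Flip a) Q"
  unfolding triple_def
proof (intro allI impI)
  fix xs m \<omega> assume m: "ok m" "P xs m"
  let ?m = "m(eval_expr a m := of_bool (shd \<omega>))"
  have okm: "ok ?m" using P[OF m] m W by (intro ok_upd) (auto simp: of_bool_def)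
  have "2 + expr_time a m + bits (eval_expr a m) \<le> 1 * com_cost (Flip a) * bits W"
    using expr_time_ok[OF m(1), of a] bits_eval_ok[OF m(1), of a] bits_pos[OF W] by (simp add: algebra_simps)
  also have "\<dots> \<le> T * com_cost (Flip a) * bits W" using T by (intro mult_right_mono) auto
  finally have "2 + expr_time a m + bits (eval_expr a m) \<le> T * com_cost (Flip a) * bits W" .
  moreover have "exec (Flip a) m (stake 1 \<omega>) (2 + expr_time a m + bits (eval_expr a m))
      (max (memory_bits m) (memory_bits ?m)) ?m"
    using exec.Flip[OF refl refl] by simp
  moreover have "max (memory_bits m) (memory_bits ?m) \<le> space"
    using memory_bits_le[OF m(1)] memory_bits_le[OF okm] by simp
  moreover have "Q (xs @ stake 1 \<omega>) ?m" using P[OF m] by simp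
  ultimately show "\<exists>j t s m'. exec (Flip a) m (stake j \<omega>) t s m' \<and>
      t \<le> T * com_cost (Flip a) * bits W \<and> s \<le> space \<and> ok m' \<and> Q (xs @ stake j \<omega>) m'"
    using okm by blast
qed

lemma triple_Seq:
  assumes 1: "triple T P c1 Q" and 2: "triple T Q c2 R"
  shows "triple T P (Seq c1 c2) R"
  unfolding triple_def
proof (intro allI impI)
  fix xs m \<omega> assume m: "ok m" "P xs m"
  obtain j t s m1 where e1: "exec c1 m (stake j \<omega>) t s m1" "t \<le> T * com_cost c1 * bits W" "s \<le> space"
    "ok m1" "Q (xs @ stake j \<omega>) m1"
    by (rule tripleD[OF 1 m, of \<omega>])
  obtain k t' s' m2 where e2: "exec c2 m1 (stake k (sdrop j \<omega>)) t' s' m2"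
    "t' \<le> T * com_cost c2 * bits W" "s' \<le> space" "ok m2" "R ((xs @ stake j \<omega>) @ stake k (sdrop j \<omega>)) m2"
    by (rule tripleD[OF 2 e1(4,5), of "sdrop j \<omega>"])
  have "exec (Seq c1 c2) m (stake (j + k) \<omega>) (t + t') (max s s') m2"
    using exec.Seq[OF e1(1) e2(1)] by (simp add: stake_add)
  moreover have "t + t' \<le> T * com_cost (Seq c1 c2) * bits W"
    using e1(2) e2(2) by (simp add: algebra_simps)
  moreover have "R (xs @ stake (j + k) \<omega>) m2" using e2(5) by (simp add: stake_add)
  ultimately show "\<exists>j t s m'. exec (Seq c1 c2) m (stake j \<omega>) t s m' \<and>
      t \<le> T * com_cost (Seq c1 c2) * bits W \<and> s \<le> space \<and> ok m' \<and> R (xs @ stake j \<omega>) m'"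
    using e1(3) e2(3,4) by (intro exI[of _ "j + k"] exI[of _ "max s s'"] exI conjI) auto
qed

lemma guard_cost:
  assumes "ok m"
  shows "1 + expr_time e m + bits (eval_expr e m) \<le> (1 + expr_cost e + expr_size e) * bits W"
  using expr_time_ok[OF assms, of e] bits_eval_ok[OF assms, of e] bits_pos[OF W]
  unfolding add_mult_distrib mult_1 by linarith

lemma triple_If:
  assumes T: "1 \<le> T" and 1: "triple T (\<lambda>xs m. P xs m \<and> eval_expr e m \<noteq> 0) c1 Q"
    and 2: "triple T (\<lambda>xs m. P xs m \<and> eval_expr e m = 0) c2 Q"
  shows "triple T P (If e c1 c2) Q"
  unfolding triple_def
proof (intro allI impI)
  fix xs m \<omega> assume m: "ok m" "P xs m"
  have "1 * (1 + expr_cost e + expr_size e) * bits W \<le> T * (1 + expr_cost e + expr_size e) * bits W"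
    by (intro mult_right_mono T) auto
  then have g: "1 + expr_time e m + bits (eval_expr e m) \<le> T * (1 + expr_cost e + expr_size e) * bits W"
    using guard_cost[OF m(1), of e] by linarith
  have cost: "com_cost (If e c1 c2) = (1 + expr_cost e + expr_size e) + com_cost c1 + com_cost c2" by simp
  show "\<exists>j t s m'. exec (If e c1 c2) m (stake j \<omega>) t s m' \<and>
      t \<le> T * com_cost (If e c1 c2) * bits W \<and> s \<le> space \<and> ok m' \<and> Q (xs @ stake j \<omega>) m'"
  proof (cases "eval_expr e m = 0")
    case False
    obtain j t s m1 where e1: "exec c1 m (stake j \<omega>) t s m1" "t \<le> T * com_cost c1 * bits W" "s \<le> space"
      "ok m1" "Q (xs @ stake j \<omega>) m1"
      by (rule tripleD[OF 1 m(1), of xs \<omega>]) (use m False in auto)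
    have "1 + expr_time e m + bits (eval_expr e m) + t \<le> T * com_cost (If e c1 c2) * bits W"
      using g e1(2) unfolding cost add_mult_distrib add_mult_distrib2 by linarith
    then show ?thesis using exec.IfTrue[OF False e1(1)] e1(3-5) by blast
  next
    case True
    obtain j t s m1 where e1: "exec c2 m (stake j \<omega>) t s m1" "t \<le> T * com_cost c2 * bits W" "s \<le> space"
      "ok m1" "Q (xs @ stake j \<omega>) m1"
      by (rule tripleD[OF 2 m(1), of xs \<omega>]) (use m True in auto)
    have "1 + expr_time e m + t \<le> T * com_cost (If e c1 c2) * bits W"
      using g e1(2) unfolding cost add_mult_distrib add_mult_distrib2 by linarith
    then show ?thesis using exec.IfFalse[OF True e1(1)] e1(3-5) by blast
  qed
qed

text \<open>The invariant is indexed by the number of finished passes, so the guard fixes that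
  number exactly. The additional 1 pays for the last, failing guard.\<close>

lemma triple_While:
  assumes T: "1 \<le> T"
    and guard: "\<And>i xs m. i \<le> N \<Longrightarrow> ok m \<Longrightarrow> Inv i xs m \<Longrightarrow> eval_expr e m \<noteq> 0 \<longleftrightarrow> i < N"
    and body: "\<And>i. i < N \<Longrightarrow> triple T (Inv i) c (Inv (Suc i))"
    and i: "i \<le> N"
  shows "triple ((N - i) * T + 1) (Inv i) (While e c) (Inv N)"
  using i
proof (induction "N - i" arbitrary: i)
  case 0
  then have [simp]: "i = N" by simp
  show ?case
    unfolding triple_def
  proof (intro allI impI)
    fix xs m \<omega> assume m: "ok m" "Inv i xs m"
    have e0: "eval_expr e m = 0" using guard[of i m xs] m by simp
    have "1 + expr_time e m \<le> (1 + expr_cost e + expr_size e) * bits W"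
      using guard_cost[OF m(1), of e] by linarith
    also have "\<dots> \<le> ((N - i) * T + 1) * com_cost (While e c) * bits W"
      by simp
    finally have "1 + expr_time e m \<le> ((N - i) * T + 1) * com_cost (While e c) * bits W" .
    moreover have "exec (While e c) m (stake 0 \<omega>) (1 + expr_time e m) (memory_bits m) m"
      using exec.WhileFalse[OF e0] by simp
    ultimately show "\<exists>j t s m'. exec (While e c) m (stake j \<omega>) t s m' \<and>
      t \<le> ((N - i) * T + 1) * com_cost (While e c) * bits W \<and> s \<le> space \<and> ok m' \<and> Inv N (xs @ stake j \<omega>) m'"
      using m memory_bits_le[OF m(1)] by (metis \<open>i = N\<close> append_Nil2 stake.simps(1))
  qed
next
  case (Suc k)
  then have lt: "i < N" by simp
  have IH: "triple ((N - Suc i) * T + 1) (Inv (Suc i)) (While e c) (Inv N)"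
    using Suc by simp
  have Nk: "N - i = Suc (N - Suc i)" using lt by simp
  show ?case
    unfolding triple_def
  proof (intro allI impI)
    fix xs m \<omega> assume m: "ok m" "Inv i xs m"
    have e0: "eval_expr e m \<noteq> 0" using guard[of i m xs] m lt by simp
    obtain j t s m1 where e1: "exec c m (stake j \<omega>) t s m1" "t \<le> T * com_cost c * bits W" "s \<le> space"
      "ok m1" "Inv (Suc i) (xs @ stake j \<omega>) m1"
      by (rule tripleD[OF body[OF lt], OF m, of \<omega>])
    obtain k t' s' m2 where e2: "exec (While e c) m1 (stake k (sdrop j \<omega>)) t' s' m2"
      "t' \<le> ((N - Suc i) * T + 1) * com_cost (While e c) * bits W" "s' \<le> space" "ok m2"
      "Inv N ((xs @ stake j \<omega>) @ stake k (sdrop j \<omega>)) m2"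
      by (rule tripleD[OF IH, OF e1(4,5), of "sdrop j \<omega>"])
    have "exec (While e c) m (stake (j + k) \<omega>) (1 + expr_time e m + bits (eval_expr e m) + t + t') (max s s') m2"
      using exec.WhileTrue[OF e0 e1(1) e2(1)] by (simp add: stake_add)
    moreover have "1 + expr_time e m + bits (eval_expr e m) + t + t' \<le>
        ((N - i) * T + 1) * com_cost (While e c) * bits W"
    proof -
      have "1 * (1 + expr_cost e + expr_size e) * bits W \<le> T * (1 + expr_cost e + expr_size e) * bits W"
        by (intro mult_right_mono T) auto
      then have "1 + expr_time e m + bits (eval_expr e m) + t \<le> T * com_cost (While e c) * bits W"
        using guard_cost[OF m(1), of e] e1(2) by (simp add: algebra_simps)
      moreover have "((N - i) * T + 1) * com_cost (While e c) * bits W =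
          T * com_cost (While e c) * bits W + ((N - Suc i) * T + 1) * com_cost (While e c) * bits W"
        unfolding Nk by (simp add: algebra_simps)
      ultimately show ?thesis using e2(2) by linarith
    qed
    moreover have "Inv N (xs @ stake (j + k) \<omega>) m2" using e2(5) by (simp add: stake_add)
    ultimately show "\<exists>j t s m'. exec (While e c) m (stake j \<omega>) t s m' \<and>
      t \<le> ((N - i) * T + 1) * com_cost (While e c) * bits W \<and> s \<le> space \<and> ok m' \<and> Inv N (xs @ stake j \<omega>) m'"
      using e1(3) e2(3,4) by (intro exI[of _ "j + k"] exI[of _ "max s s'"] exI conjI) auto
  qed
qed

text \<open>Updating the counter inside the invariant leaves its bookkeeping to the rule.
  \<open>Suc N * T\<close> covers the initial assignment and \<open>N * T + 1\<close> for the
  loop.\<close>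

lemma triple_For:
  assumes T: "1 \<le> T" and x: "x < D" and N: "N < W"
    and bound: "\<And>i xs m. i \<le> N \<Longrightarrow> ok m \<Longrightarrow> m x = i \<Longrightarrow> Inv i xs m \<Longrightarrow> eval_expr b m = N"
    and body: "\<And>i. i < N \<Longrightarrow> triple T (\<lambda>xs m. m x = i \<and> Inv i xs m) c
      (\<lambda>xs m. m x = i \<and> Inv (Suc i) xs (m(x := Suc i)))"
  shows "triple (Suc N * T) (\<lambda>xs m. Inv 0 xs (m(x := 0))) (For x b c) (\<lambda>xs m. m x = N \<and> Inv N xs m)"
  unfolding For_def
proof (rule triple_Seq)
  have T': "1 \<le> Suc N * T" using T by simp
  show "triple (Suc N * T) (\<lambda>xs m. Inv 0 xs (m(x := 0))) (Assign (Const x) (Const 0)) (\<lambda>xs m. m x = 0 \<and> Inv 0 xs m)"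
    by (rule triple_Assign[OF T']) (use x W in auto)
  show "triple (Suc N * T) (\<lambda>xs m. m x = 0 \<and> Inv 0 xs m)
    (While (Op Minus b (Reg (Const x))) (Seq c (Assign (Const x) (Op Plus (Reg (Const x)) (Const 1)))))
    (\<lambda>xs m. m x = N \<and> Inv N xs m)"
  proof (rule triple_conseq[where P' = "\<lambda>xs m. m x = 0 \<and> Inv 0 xs m" and Q' = "\<lambda>xs m. m x = N \<and> Inv N xs m"])
    show "triple ((N - 0) * T + 1) (\<lambda>xs m. m x = 0 \<and> Inv 0 xs m)
      (While (Op Minus b (Reg (Const x))) (Seq c (Assign (Const x) (Op Plus (Reg (Const x)) (Const 1)))))
      (\<lambda>xs m. m x = N \<and> Inv N xs m)"
    proof (rule triple_While[where Inv = "\<lambda>i xs m. m x = i \<and> Inv i xs m", OF T])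
      fix i assume i: "i < N"
      show "triple T (\<lambda>xs m. m x = i \<and> Inv i xs m) (Seq c (Assign (Const x) (Op Plus (Reg (Const x)) (Const 1))))
         (\<lambda>xs m. m x = Suc i \<and> Inv (Suc i) xs m)"
        by (rule triple_Seq[OF body[OF i]], rule triple_Assign[OF T]) (use i x N in auto)
    qed (use bound in auto)
    show "(N - 0) * T + 1 \<le> Suc N * T" using T by simp
  qed auto
qed

text \<open>Loops get \<open>False\<close>: this handles straight-line and branching code, while
  loops go through \<open>triple_For\<close>.\<close>

fun wp :: "com \<Rightarrow> (bool list \<Rightarrow> memory \<Rightarrow> bool) \<Rightarrow> bool list \<Rightarrow> memory \<Rightarrow> bool" where
  "wp Skip Q xs m = Q xs m"
| "wp (Assign a e) Q xs m =
    (eval_expr a m < D \<and> eval_expr e m < W \<and> Q xs (m(eval_expr a m := eval_expr e m)))"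
| "wp (Flip a) Q xs m = (eval_expr a m < D \<and> (\<forall>b. Q (xs @ [b]) (m(eval_expr a m := of_bool b))))"
| "wp (Seq c1 c2) Q xs m = wp c1 (wp c2 Q) xs m"
| "wp (If e c1 c2) Q xs m = (if eval_expr e m \<noteq> 0 then wp c1 Q xs m else wp c2 Q xs m)"
| "wp (While e c) Q xs m = False"

lemma triple_wp:
  assumes T: "1 \<le> T"
  shows "(\<And>xs m. ok m \<Longrightarrow> P xs m \<Longrightarrow> wp c Q xs m) \<Longrightarrow> triple T P c Q"
proof (induction c arbitrary: P Q)
  case Skip
  show ?case by (rule triple_conseq[OF triple_Skip[OF T, of P]]) (use Skip in simp_all)
next
  case (Seq c1 c2)
  show ?case
  proof (rule triple_Seq[of _ _ _ "wp c2 Q"])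
    show "triple T P c1 (wp c2 Q)" by (rule Seq.IH(1)) (use Seq.prems in simp)
    show "triple T (wp c2 Q) c2 Q" by (rule Seq.IH(2)) simp
  qed
next
  case (If e c1 c2)
  show ?case
  proof (rule triple_If[OF T])
    show "triple T (\<lambda>xs m. P xs m \<and> eval_expr e m \<noteq> 0) c1 Q"
      by (rule If.IH(1), frule If.prems, simp_all)
    show "triple T (\<lambda>xs m. P xs m \<and> eval_expr e m = 0) c2 Q"
      by (rule If.IH(2), frule If.prems, simp_all)
  qed
next
  case (While e c)
  have "\<not> P xs m" if "ok m" for xs m
  proof
    assume "P xs m"
    from While.prems[OF that this] show False by simp
  qed
  then show ?case by (simp add: triple_def)
next
  case (Assign a e)
  show ?case by (rule triple_Assign[OF T]) (drule (1) Assign, simp del: fun_upd_apply)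
next
  case (Flip a)
  show ?case by (rule triple_Flip[OF T]) (drule (1) Flip, simp del: fun_upd_apply)
qed

end

section \<open>Processing an update\<close>

abbreviation (input) eplus (infixl "[+]" 65) where "a [+] b \<equiv> Op Plus a b"
abbreviation (input) eminus (infixl "[-]" 65) where "a [-] b \<equiv> Op Minus a b"
abbreviation (input) etimes (infixl "[*]" 70) where "a [*] b \<equiv> Op Times a b"
abbreviation (input) ediv (infixl "[div]" 70) where "a [div] b \<equiv> Op Div a b"
abbreviation (input) emod (infixl "[mod]" 70) where "a [mod] b \<equiv> Op Mod a b"
abbreviation (input) V where "V k \<equiv> Reg (Const k)"
abbreviation (input) assign_reg (infix "[:=]" 55) where "k [:=] e \<equiv> Assign (Const k) e"
abbreviation (input) seq (infixr ";;" 51) where "c ;; d \<equiv> Seq c d"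

text \<open>
  Registers below 32 are scalars; from 32 on, eight arrays are interleaved: hash table (0),
  sketch cells (6), edge counters (2), decoded edges (3), orientation (4) and loads (5).
\<close>

definition addr :: "nat \<Rightarrow> nat \<Rightarrow> nat" where
  "addr k i = 32 + k + 8 * i"

definition arr :: "nat \<Rightarrow> expr \<Rightarrow> expr" where
  "arr k e = Const (32 + k) [+] Const 8 [*] e"

definition neq :: "expr \<Rightarrow> expr \<Rightarrow> expr" where
  "neq a b = (a [-] b) [+] (b [-] a)"

lemma eval_arr [simp]: "eval_expr (arr k e) m = addr k (eval_expr e m)"
  by (simp add: arr_def addr_def)

lemma eval_neq [simp]: "eval_expr (neq a b) m = 0 \<longleftrightarrow> eval_expr a m = eval_expr b m"
  by (auto simp: neq_def)

lemma addr_eq [simp]: "k < 8 \<Longrightarrow> k' < 8 \<Longrightarrow> addr k i = addr k' i' \<longleftrightarrow> k = k' \<and> i = i'"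
proof
  assume k: "k < 8" "k' < 8" and eq: "addr k i = addr k' i'"
  have "k = (8 * i + k) mod 8" using k by simp
  also have "8 * i + k = 8 * i' + k'" using eq by (simp add: addr_def)
  also have "(8 * i' + k') mod 8 = k'" using k by simp
  finally show "k = k' \<and> i = i'" using eq by (simp add: addr_def)
qed simp

lemma addr_neq_scalar [simp]: "x < 32 \<Longrightarrow> addr k i \<noteq> x" "x < 32 \<Longrightarrow> x \<noteq> addr k i"
  by (simp_all add: addr_def)

text \<open>Register map: 0 \<open>n\<close>, 5 \<open>l\<close>, 6 \<open>R\<close>, 7
  \<open>K\<close>, 8 \<open>R * K\<close>, 9 \<open>N\<close>, 10 \<open>M\<close>; 11 the level,
  12 its power of two, 13 the repetition, 15 and 16 the endpoints, 17 the signed edge code and 18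
  the sign modulo \<open>M\<close>, 19 the cell index.\<close>

definition cell_step :: com where
  "cell_step =
    19 [:=] V 11 [*] V 8 [+] (V 13 [*] V 7 [+]
      (Reg (arr 0 ((Const 2 [*] V 13 [+] Const 1) [*] V 0 [+] V 15)) [+]
       Reg (arr 0 ((Const 2 [*] V 13 [+] Const 2) [*] V 0 [+] V 16))) [mod] V 7) ;;
    Assign (arr 6 (V 19)) ((Reg (arr 6 (V 19)) [+] V 17) [mod] V 10)"

definition level_step :: com where
  "level_step =
    If (neq (Reg (arr 0 (V 15)) [mod] V 12) (Reg (arr 0 (V 16)) [mod] V 12))
      Skip
      (Assign (arr 2 (V 11)) ((Reg (arr 2 (V 11)) [+] V 18) [mod] V 10) ;;
       For 13 (V 6) cell_step) ;;
    12 [:=] Const 2 [*] V 12"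

text \<open>Registers hold naturals, so a deletion adds the residues \<open>M - x\<close> and
  \<open>M - 1\<close>. Sorting the endpoints gives both orientations of an edge the same
  code.\<close>

definition prepare_update :: com where
  "prepare_update =
    If (V 3 [-] V 4) (15 [:=] V 4 ;; 16 [:=] V 3) (15 [:=] V 3 ;; 16 [:=] V 4) ;;
    17 [:=] V 9 [+] (V 15 [*] V 0 [+] V 16) ;;
    If (V 2) (18 [:=] Const 1) (17 [:=] V 10 [-] V 17 ;; 18 [:=] V 10 [-] Const 1) ;;
    12 [:=] Const 1"

definition update_program :: com where
  "update_program = prepare_update ;; For 11 (V 5) level_step"

definition pairs :: "nat \<Rightarrow> (nat \<times> nat) set" where
  "pairs n = {(u, v). u < v \<and> v < n}"

lemma finite_pairs: "finite (pairs n)"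
  by (rule finite_subset[of _ "{..<n} \<times> {..<n}"]) (auto simp: pairs_def)

text \<open>A linear measurement of the multiplicity vector. Reducing modulo \<open>M\<close> bounds
  the register however large intermediate multiplicities become.\<close>

definition lsum :: "nat \<Rightarrow> nat \<Rightarrow> (nat \<times> nat \<Rightarrow> int) \<Rightarrow> (nat \<times> nat \<Rightarrow> int) \<Rightarrow> int" where
  "lsum n M g \<mu> = (\<Sum>e\<in>pairs n. \<mu> e * g e) mod int M"

lemma lsum_update:
  assumes "e \<in> pairs n" "int x = lsum n M g \<mu>" "int d = (c * g e) mod int M"
  shows "int ((x + d) mod M) = lsum n M g (\<mu>(e := \<mu> e + c))"
proof -
  have "(\<Sum>e'\<in>pairs n. (\<mu>(e := \<mu> e + c)) e' * g e') = (\<Sum>e'\<in>pairs n. \<mu> e' * g e' + (if e' = e then c * g e else 0))"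
    by (rule sum.cong) (auto simp: algebra_simps)
  also have "\<dots> = (\<Sum>e'\<in>pairs n. \<mu> e' * g e') + c * g e"
    using assms(1) finite_pairs by (simp add: sum.distrib)
  finally show ?thesis
    using assms(2,3) by (simp add: lsum_def zmod_int mod_add_eq)
qed

lemma lsum_update_0: "g e = 0 \<Longrightarrow> lsum n M g (\<mu>(e := c)) = lsum n M g \<mu>"
  unfolding lsum_def by (rule arg_cong[where f = "\<lambda>x. x mod int M"], rule sum.cong) auto

lemma (in ram) triple_vacuous: "(\<And>xs m. \<not> P xs m) \<Longrightarrow> triple T P c Q"
  unfolding triple_def by blast

text \<open>\<open>W\<close> exceeds 2^40 n^20, which covers every stored value, and still has only
  O(l) bits. Rounding up to the powers \<open>2 ^ l\<close> and \<open>2 ^ w\<close> costs at most a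
  factor 2, and \<open>q \<le> n\<close> keeps \<open>2 ^ w\<close> polynomial in
  \<open>n\<close>.\<close>

locale sketch = ram W D for W D +
  fixes n q l w :: nat
  assumes n1: "1 \<le> n" and l: "n < 2 ^ l" "2 ^ l \<le> 2 * n" and q: "1 \<le> q" "q \<le> n"
    and w: "1440 * n * q\<^sup>2 * l < 2 ^ w" "2 ^ w \<le> 2880 * n * q\<^sup>2 * l"
    and W_def: "W = 2 ^ (20 * l + 40)"
    and D_def: "D = 40 + 8 * (l * (5 * l * 2 ^ w) + (2 * (5 * l) + 1) * n)"
begin

definition K where "K = (2 :: nat) ^ w"
definition R where "R = 5 * l"
text \<open>\<open>N\<close> has two uses: as the radix that separates count and identifier in an
  edge code, since at most n^2 identifiers below n^2 sum to less than n^4, and as the number of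
  weight units per edge in local search.\<close>

definition N where "N = n ^ 4"
text \<open>Exceeds the sum of all edge codes: the counts contribute at most
  \<open>n^2 * N = n ^ 6\<close>, the identifiers less than \<open>N\<close>.\<close>

definition M where "M = 2 * n ^ 6"
definition cells where "cells = (2 * R + 1) * n"

lemma l0: "0 < l" using l n1 by (cases l) auto

lemma l_le_n: "l \<le> n"
proof -
  obtain k where k: "l = Suc k" using l0 by (cases l) auto
  have "k < 2 ^ k" by (rule less_exp)
  then have "Suc k \<le> 2 ^ k" by (rule Suc_leI)
  also have "2 ^ k \<le> n" using l(2) unfolding k by simp
  finally show ?thesis by (simp add: k)
qed

lemma less_W:
  assumes "x \<le> 2 ^ 40 * n ^ 20"
  shows "x < W"
proof -
  have "n ^ 20 < (2 ^ l) ^ 20" using l by (intro power_strict_mono) auto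
  then have "2 ^ 40 * n ^ 20 < 2 ^ 40 * (2 ^ l) ^ 20" by simp
  also have "\<dots> = W" by (simp add: W_def power_add power_mult[symmetric] mult.commute)
  finally show ?thesis using assms by simp
qed

lemma pow_le: "i \<le> j \<Longrightarrow> n ^ i \<le> n ^ j"
  using n1 by (intro power_increasing) auto

lemma less_W_pow: "x \<le> c * n ^ i \<Longrightarrow> c \<le> 2 ^ 40 \<Longrightarrow> i \<le> 20 \<Longrightarrow> x < W"
  using pow_le[of i 20] by (intro less_W) (rule order_trans, assumption, rule mult_le_mono)

lemma K0: "0 < K" by (simp add: K_def)

lemma K_le: "K \<le> 2880 * n ^ 4"
proof -
  have "n * q\<^sup>2 * l \<le> n * n\<^sup>2 * n" using q l_le_n by (intro mult_mono power_mono) auto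
  also have "\<dots> = n ^ 4" by (simp add: power2_eq_square power4_eq_xxxx)
  finally have "2880 * (n * q\<^sup>2 * l) \<le> 2880 * n ^ 4" by simp
  then show ?thesis using w(2) by (simp add: K_def mult_ac)
qed

lemma R0: "0 < R" using l0 by (simp add: R_def)

lemma R_le: "R \<le> 5 * n" using l_le_n by (simp add: R_def)

lemma RK_le: "R * K \<le> 14400 * n ^ 5"
proof -
  have "R * K \<le> (5 * n) * (2880 * n ^ 4)" by (intro mult_mono R_le K_le) auto
  also have "\<dots> = 14400 * (n * n ^ 4)" by simp
  also have "n * n ^ 4 = n ^ 5" by (simp add: eval_nat_numeral)
  finally show ?thesis .
qed

lemma lRK_le: "l * (R * K) \<le> 14400 * n ^ 6"
proof -
  have "l * (R * K) \<le> n * (14400 * n ^ 5)" by (intro mult_mono RK_le l_le_n) auto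
  also have "\<dots> = 14400 * (n * n ^ 5)" by simp
  also have "n * n ^ 5 = n ^ 6" by (simp add: eval_nat_numeral)
  finally show ?thesis .
qed

lemma cells_le: "cells \<le> 11 * n\<^sup>2"
proof -
  have "cells \<le> (10 * n + n) * n" unfolding cells_def using R_le n1 by (intro mult_mono) auto
  then show ?thesis by (simp add: power2_eq_square)
qed

lemma D_eq: "D = 40 + 8 * (l * (R * K) + cells)"
  by (simp add: D_def R_def K_def cells_def)

lemma D_le: "D \<le> 2 ^ 17 * n ^ 6"
proof -
  have "n\<^sup>2 \<le> n ^ 6" "n ^ 0 \<le> n ^ 6" by (rule pow_le; simp)+
  then show ?thesis using lRK_le cells_le unfolding D_eq by simp
qed

lemma D_less_W: "D < W" using D_le by (rule less_W_pow) auto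

lemma addr_less: "i \<le> l * (R * K) + cells \<Longrightarrow> k < 8 \<Longrightarrow> addr k i < D"
  by (simp add: addr_def D_eq)

lemma scalar_less: "x < 32 \<Longrightarrow> x < D" by (simp add: D_eq)

lemma index_less_W: "i \<le> l * (R * K) + cells \<Longrightarrow> i < W"
  using D_less_W by (simp add: D_eq)

lemma RK_le_index: "R * K \<le> l * (R * K)" using l0 by simp

lemma n_le_cells: "n \<le> cells" by (simp add: cells_def)

lemma M_less_W: "M < W" by (rule less_W_pow[of _ 2 6]) (auto simp: M_def)

lemma M0: "0 < M" using n1 by (simp add: M_def)

lemma N0: "0 < N" using n1 by (simp add: N_def)

lemma pow2_less_W: "2 ^ l < W" using l(2) by (intro less_W_pow[of _ 2 1]) auto

lemma N_n2_le_M: "N + n\<^sup>2 \<le> M"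
proof -
  have "n ^ 4 \<le> n ^ 6" "n\<^sup>2 \<le> n ^ 6" by (rule pow_le; simp)+
  then show ?thesis by (simp add: N_def M_def)
qed

definition wt :: "nat \<times> nat \<Rightarrow> nat" where
  "wt e = N + (fst e * n + snd e)"

lemma pair_id_less: "e \<in> pairs n \<Longrightarrow> fst e * n + snd e < n\<^sup>2"
proof -
  assume e: "e \<in> pairs n"
  then have "Suc (fst e) * n \<le> n * n" by (intro mult_right_mono) (auto simp: pairs_def)
  then show ?thesis using e by (auto simp: pairs_def power2_eq_square)
qed

lemma wt_less: "e \<in> pairs n \<Longrightarrow> wt e < M"
  using pair_id_less[of e] N_n2_le_M by (simp add: wt_def)

lemma wt_pos: "0 < wt e" using N0 by (simp add: wt_def)

definition in_level :: "(nat \<Rightarrow> nat) \<Rightarrow> nat \<Rightarrow> nat \<times> nat \<Rightarrow> bool" where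
  "in_level T j e \<longleftrightarrow> T (fst e) mod 2 ^ j = T (snd e) mod 2 ^ j"

definition count_weight :: "(nat \<Rightarrow> nat) \<Rightarrow> nat \<Rightarrow> nat \<times> nat \<Rightarrow> int" where
  "count_weight T j e = of_bool (in_level T j e)"

definition cell_weight :: "(nat \<Rightarrow> nat) \<Rightarrow> nat \<Rightarrow> nat \<Rightarrow> nat \<Rightarrow> nat \<times> nat \<Rightarrow> int" where
  "cell_weight T j r b e = of_bool (in_level T j e \<and> bucket n K T r e = b) * int (wt e)"

text \<open>The load array is required to be zero from the start because \<open>init_loads\<close>
  only adds to it.\<close>

definition env :: "(nat \<Rightarrow> nat) \<Rightarrow> memory \<Rightarrow> bool" where
  "env T m \<longleftrightarrow> m 0 = n \<and> m 5 = l \<and> m 6 = R \<and> m 7 = K \<and> m 8 = R * K \<and> m 9 = N \<and> m 10 = M \<and>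
    (\<forall>i<cells. m (addr 0 i) = T i) \<and> (\<forall>v<n. m (addr 5 v) = 0)"

text \<open>The multiplicities may differ from level to level, since in the middle of an update some
  levels are already updated.\<close>

definition counters_hold :: "(nat \<Rightarrow> nat) \<Rightarrow> (nat \<Rightarrow> nat \<times> nat \<Rightarrow> int) \<Rightarrow> memory \<Rightarrow> bool" where
  "counters_hold T g m \<longleftrightarrow> (\<forall>j<l. int (m (addr 2 j)) = lsum n M (count_weight T j) (g j))"

definition cells_hold :: "(nat \<Rightarrow> nat) \<Rightarrow> (nat \<Rightarrow> nat \<Rightarrow> nat \<times> nat \<Rightarrow> int) \<Rightarrow> memory \<Rightarrow> bool" where
  "cells_hold T g m \<longleftrightarrow> (\<forall>j<l. \<forall>r<R. \<forall>b<K.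
     int (m (addr 6 (j * (R * K) + (r * K + b)))) = lsum n M (cell_weight T j r b) (g j r))"

definition sketches :: "(nat \<Rightarrow> nat) \<Rightarrow> (nat \<times> nat \<Rightarrow> int) \<Rightarrow> memory \<Rightarrow> bool" where
  "sketches T \<mu> m \<longleftrightarrow> counters_hold T (\<lambda>_. \<mu>) m \<and> cells_hold T (\<lambda>_ _. \<mu>) m"

lemma counters_hold_upd_scalar [simp]:
  "x < 32 \<Longrightarrow> counters_hold T g (m(x := y)) = counters_hold T g m"
  by (simp add: counters_hold_def)

lemma counters_hold_upd_arr [simp]:
  "k \<in> {0, 3, 4, 5, 6} \<Longrightarrow> counters_hold T g (m(addr k i := y)) = counters_hold T g m"
  by (elim insertE emptyE; simp add: counters_hold_def)

lemma cells_hold_upd_scalar [simp]: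
  "x < 32 \<Longrightarrow> cells_hold T g (m(x := y)) = cells_hold T g m"
  by (simp add: cells_hold_def)

lemma cells_hold_upd_arr [simp]:
  "k \<in> {0, 2, 3, 4, 5} \<Longrightarrow> cells_hold T g (m(addr k i := y)) = cells_hold T g m"
  by (elim insertE emptyE; simp add: cells_hold_def)

lemma env_upd_scalar [simp]:
  "x \<in> {11..<32} \<Longrightarrow> env T (m(x := y)) = env T m"
  by (simp add: env_def)

lemma env_upd_arr [simp]:
  "k \<in> {2, 3, 4, 6} \<Longrightarrow> env T (m(addr k i := y)) = env T m"
  by (elim insertE emptyE; simp add: env_def)

lemma cell_index_eq:
  assumes "r < R" "b < K" "r' < R" "b' < K"
  shows "j * (R * K) + (r * K + b) = j' * (R * K) + (r' * K + b') \<longleftrightarrow> j = j' \<and> r = r' \<and> b = b'"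
proof
  have lt: "r * K + b < R * K" if "r < R" "b < K" for r b
  proof -
    have "Suc r * K \<le> R * K" using that by (intro mult_right_mono) auto
    then show ?thesis using that by simp
  qed
  assume eq: "j * (R * K) + (r * K + b) = j' * (R * K) + (r' * K + b')"
  have "j = (j * (R * K) + (r * K + b)) div (R * K)" using lt[OF assms(1,2)] by (subst div_mult_self3) (auto intro: ccontr)
  also have "\<dots> = j'" unfolding eq using lt[OF assms(3,4)] by (subst div_mult_self3) (auto intro: ccontr)
  finally have j: "j = j'" .
  then have eq': "r * K + b = r' * K + b'" using eq by simp
  have "r = (r * K + b) div K" using assms by simp
  also have "\<dots> = r'" unfolding eq' using assms by simp
  finally show "j = j' \<and> r = r' \<and> b = b'" using eq' j by simp
qed simp

lemma cell_index_less:
  assumes "j < l" "r < R" "b < K"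
  shows "j * (R * K) + (r * K + b) < l * (R * K)"
proof -
  have "Suc r * K \<le> R * K" using assms by (intro mult_right_mono) auto
  moreover have "Suc j * (R * K) \<le> l * (R * K)" using assms by (intro mult_right_mono) auto
  ultimately show ?thesis using assms by simp
qed

lemma bucket_less: "bucket n K T r e < K" using K0 by (simp add: bucket_def)

lemma table_index_less: "r < R \<Longrightarrow> u < n \<Longrightarrow> (2 * r + 1) * n + u < cells" "r < R \<Longrightarrow> u < n \<Longrightarrow> (2 * r + 2) * n + u < cells"
proof -
  assume a: "r < R" "u < n"
  have "(2 * r + 3) * n \<le> cells" unfolding cells_def using a by (intro mult_right_mono) auto
  then show "(2 * r + 1) * n + u < cells" "(2 * r + 2) * n + u < cells" using a by (simp_all add: algebra_simps)
qed

text \<open>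
  While level \<open>j\<close> is processed, its counter is updated before its cells; hence \<open>j0\<close> is \<open>j\<close> or \<open>j + 1\<close>.
\<close>

definition mid_update ::
  "(nat \<Rightarrow> nat) \<Rightarrow> (nat \<times> nat \<Rightarrow> int) \<Rightarrow> nat \<times> nat \<Rightarrow> int \<Rightarrow> nat \<Rightarrow> nat \<Rightarrow> nat \<Rightarrow> memory \<Rightarrow> bool" where
  "mid_update T \<mu> e c j0 j r m \<longleftrightarrow> env T m \<and> m 15 = fst e \<and> m 16 = snd e \<and>
    m 17 < M \<and> m 18 < M \<and> int (m 17) = (c * int (wt e)) mod int M \<and> int (m 18) = c mod int M \<and>
    counters_hold T (\<lambda>j'. if j' < j0 then \<mu>(e := \<mu> e + c) else \<mu>) m \<and>
    cells_hold T (\<lambda>j' r'. if j' < j \<or> j' = j \<and> r' < r then \<mu>(e := \<mu> e + c) else \<mu>) m"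

lemma mid_update_upd [simp]:
  "x \<in> {11, 12, 13, 14, 19} \<Longrightarrow> mid_update T \<mu> e c j0 j r (m(x := y)) = mid_update T \<mu> e c j0 j r m"
  by (elim insertE emptyE; simp add: mid_update_def)

lemma cells_hold_step:
  assumes e: "e \<in> pairs n" and j: "j < l" and r: "r < R" and lev: "in_level T j e"
    and x: "x = j * (R * K) + (r * K + bucket n K T r e)"
    and d: "int d = (c * int (wt e)) mod int M"
    and h: "cells_hold T (\<lambda>j' r'. if j' < j \<or> j' = j \<and> r' < r then \<mu>(e := \<mu> e + c) else \<mu>) m"
  shows "cells_hold T (\<lambda>j' r'. if j' < j \<or> j' = j \<and> r' < Suc r then \<mu>(e := \<mu> e + c) else \<mu>)
    (m(addr 6 x := (m (addr 6 x) + d) mod M))"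
  unfolding cells_hold_def
proof (intro allI impI)
  fix j' r' b assume b: "j' < l" "r' < R" "b < K"
  have old: "int (m (addr 6 (j' * (R * K) + (r' * K + b)))) = lsum n M (cell_weight T j' r' b)
      (if j' < j \<or> j' = j \<and> r' < r then \<mu>(e := \<mu> e + c) else \<mu>)"
    using h b by (simp add: cells_hold_def)
  show "int ((m(addr 6 x := (m (addr 6 x) + d) mod M)) (addr 6 (j' * (R * K) + (r' * K + b)))) =
      lsum n M (cell_weight T j' r' b) (if j' < j \<or> j' = j \<and> r' < Suc r then \<mu>(e := \<mu> e + c) else \<mu>)"
  proof (cases "j' * (R * K) + (r' * K + b) = x")
    case True
    then have eq: "j' = j" "r' = r" "b = bucket n K T r e"
      unfolding x using cell_index_eq[OF b(2,3) r bucket_less[of T r e]] by auto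
    have "int ((m (addr 6 x) + d) mod M) = lsum n M (cell_weight T j r b) (\<mu>(e := \<mu> e + c))"
    proof (rule lsum_update[OF e])
      show "int (m (addr 6 x)) = lsum n M (cell_weight T j r b) \<mu>"
        using old True eq by simp
      show "int d = c * cell_weight T j r b e mod int M"
        using lev eq d by (simp add: cell_weight_def)
    qed
    then show ?thesis using True eq by simp
  next
    case False
    \<comment> \<open>The other buckets of this repetition give \<open>e\<close> weight 0, so their
      old contents already fit the new multiplicity.\<close>
    have "lsum n M (cell_weight T j' r' b) (\<mu>(e := \<mu> e + c)) = lsum n M (cell_weight T j' r' b) \<mu>" if "j' = j" "r' = r"
      using False that by (intro lsum_update_0) (auto simp: cell_weight_def x)
    then show ?thesis using False old by (auto simp: less_Suc_eq)
  qed
qed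

lemma counters_hold_step:
  assumes e: "e \<in> pairs n" and j: "j < l" and lev: "in_level T j e" and d: "int d = c mod int M"
    and h: "counters_hold T (\<lambda>j'. if j' < j then \<mu>(e := \<mu> e + c) else \<mu>) m"
  shows "counters_hold T (\<lambda>j'. if j' < Suc j then \<mu>(e := \<mu> e + c) else \<mu>)
    (m(addr 2 j := (m (addr 2 j) + d) mod M))"
proof -
  have "int ((m (addr 2 j) + d) mod M) = lsum n M (count_weight T j) (\<mu>(e := \<mu> e + c))"
  proof (rule lsum_update[OF e])
    show "int (m (addr 2 j)) = lsum n M (count_weight T j) \<mu>" using h j by (simp add: counters_hold_def)
    show "int d = c * count_weight T j e mod int M" using lev d by (simp add: count_weight_def)
  qed
  then show ?thesis using h unfolding counters_hold_def by (auto simp: less_Suc_eq)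
qed

text \<open>All weights of a level vanish on an edge outside it, so doing nothing is the correct
  update.\<close>

lemma mid_update_skip:
  assumes h: "mid_update T \<mu> e c j j 0 m" and lev: "\<not> in_level T j e"
  shows "mid_update T \<mu> e c (Suc j) (Suc j) 0 m"
proof -
  have 1: "lsum n M (count_weight T j) (\<mu>(e := \<mu> e + c)) = lsum n M (count_weight T j) \<mu>"
    using lev by (intro lsum_update_0) (simp add: count_weight_def)
  have 2: "lsum n M (cell_weight T j r b) (\<mu>(e := \<mu> e + c)) = lsum n M (cell_weight T j r b) \<mu>" for r b
    using lev by (intro lsum_update_0) (simp add: cell_weight_def)
  have "counters_hold T (\<lambda>j'. if j' < Suc j then \<mu>(e := \<mu> e + c) else \<mu>) m"
    using h 1 unfolding mid_update_def counters_hold_def by (auto simp: less_Suc_eq)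
  moreover have "cells_hold T (\<lambda>j' r'. if j' < Suc j \<or> j' = Suc j \<and> r' < 0 then \<mu>(e := \<mu> e + c) else \<mu>) m"
    using h 2 unfolding mid_update_def cells_hold_def by (auto simp: less_Suc_eq)
  ultimately show ?thesis using h by (simp add: mid_update_def)
qed

lemma mid_update_R: "mid_update T \<mu> e c (Suc j) j R m \<Longrightarrow> mid_update T \<mu> e c (Suc j) (Suc j) 0 m"
  unfolding mid_update_def cells_hold_def by (auto simp: less_Suc_eq)

lemma triple_cell_step:
  assumes e: "e \<in> pairs n" and j: "j < l" and r: "r < R" and lev: "in_level T j e"
  shows "triple 1 (\<lambda>_ m. m 13 = r \<and> m 11 = j \<and> m 12 = p \<and> mid_update T \<mu> e c (Suc j) j r m) cell_step
    (\<lambda>_ m. m 13 = r \<and> m 11 = j \<and> m 12 = p \<and> mid_update T \<mu> e c (Suc j) j (Suc r) m)"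
proof (rule triple_wp)
  fix xs :: "bool list" and m
  assume m: "m 13 = r \<and> m 11 = j \<and> m 12 = p \<and> mid_update T \<mu> e c (Suc j) j r m"
  have en: "fst e < n" "snd e < n" using e by (auto simp: pairs_def)
  have regs: "m 0 = n" "m 7 = K" "m 8 = R * K" "m 10 = M" "m 15 = fst e" "m 16 = snd e" "m 13 = r" "m 11 = j"
    using m by (simp_all add: mid_update_def env_def)
  have tab: "m (addr 0 i) = T i" if "i < cells" for i
    using m that by (simp add: mid_update_def env_def)
  define x where "x = j * (R * K) + (r * K + bucket n K T r e)"
  have x: "eval_expr (V 11 [*] V 8 [+] (V 13 [*] V 7 [+]
      (Reg (arr 0 ((Const 2 [*] V 13 [+] Const 1) [*] V 0 [+] V 15)) [+]
       Reg (arr 0 ((Const 2 [*] V 13 [+] Const 2) [*] V 0 [+] V 16))) [mod] V 7)) m = x"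
    using tab[OF table_index_less(1)[OF r en(1)]] tab[OF table_index_less(2)[OF r en(2)]]
    by (simp add: regs x_def bucket_def)
  have xl: "x < l * (R * K)" unfolding x_def by (rule cell_index_less[OF j r bucket_less])
  have "cells_hold T (\<lambda>j' r'. if j' < j \<or> j' = j \<and> r' < Suc r then \<mu>(e := \<mu> e + c) else \<mu>)
    (m(addr 6 x := (m (addr 6 x) + m 17) mod M))"
    by (rule cells_hold_step[OF e j r lev x_def]) (use m in \<open>auto simp: mid_update_def\<close>)
  then have "mid_update T \<mu> e c (Suc j) j (Suc r) (m(addr 6 x := (m (addr 6 x) + m 17) mod M))"
    using m by (simp add: mid_update_def)
  then have post: "mid_update T \<mu> e c (Suc j) j (Suc r) (m(19 := x, addr 6 x := (m (addr 6 x) + m 17) mod M))"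
    by (subst fun_upd_twist) auto
  have "addr 6 x < D" using xl by (intro addr_less) auto
  moreover have "x < W" using xl by (intro index_less_W) auto
  moreover have "19 < D" by (rule scalar_less) simp
  moreover have "(m (addr 6 x) + m 17) mod M < W" using M_less_W M0 by (meson less_trans mod_less_divisor)
  ultimately show "wp cell_step (\<lambda>_ m. m 13 = r \<and> m 11 = j \<and> m 12 = p \<and> mid_update T \<mu> e c (Suc j) j (Suc r) m) xs m"
    unfolding cell_step_def wp.simps x using m post by (simp add: regs)
qed simp

lemma R_less_W: "R < W"
  using R_le by (intro less_W_pow[of _ 5 1]) auto

lemma triple_cells_loop:
  assumes e: "e \<in> pairs n" and j: "j < l" and lev: "in_level T j e"
  shows "triple (Suc R) (\<lambda>_ m. m 11 = j \<and> m 12 = p \<and> mid_update T \<mu> e c (Suc j) j 0 m) (For 13 (V 6) cell_step)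
    (\<lambda>_ m. m 11 = j \<and> m 12 = p \<and> mid_update T \<mu> e c (Suc j) (Suc j) 0 m)"
proof -
  let ?I = "\<lambda>r _ m. m 11 = j \<and> m 12 = p \<and> mid_update T \<mu> e c (Suc j) j r m"
  have "triple (Suc R * 1) (\<lambda>xs m. ?I 0 xs (m(13 := 0))) (For 13 (V 6) cell_step) (\<lambda>xs m. m 13 = R \<and> ?I R xs m)"
  proof (rule triple_For[OF order_refl _ R_less_W])
    show "13 < D" by (rule scalar_less) simp
    fix r assume r: "r < R"
    show "triple 1 (\<lambda>xs m. m 13 = r \<and> ?I r xs m) cell_step (\<lambda>xs m. m 13 = r \<and> ?I (Suc r) xs (m(13 := Suc r)))"
      by (rule triple_conseq[OF triple_cell_step[OF e j r lev]]) auto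
  qed (auto simp: mid_update_def env_def)
  then show ?thesis by (rule triple_conseq) (auto intro: mid_update_R)
qed

lemma triple_level_step:
  assumes e: "e \<in> pairs n" and j: "j < l"
  shows "triple (Suc R) (\<lambda>_ m. m 11 = j \<and> m 12 = 2 ^ j \<and> mid_update T \<mu> e c j j 0 m) level_step
     (\<lambda>_ m. m 11 = j \<and> m 12 = 2 ^ Suc j \<and> mid_update T \<mu> e c (Suc j) (Suc j) 0 m)"
  unfolding level_step_def
proof (rule triple_Seq)
  have en: "fst e < cells" "snd e < cells" using e n_le_cells by (auto simp: pairs_def)
  let ?P = "\<lambda>_ m. m 11 = j \<and> m 12 = 2 ^ j \<and> mid_update T \<mu> e c j j 0 m"
  let ?Q = "\<lambda>_ m. m 11 = j \<and> m 12 = 2 ^ j \<and> mid_update T \<mu> e c (Suc j) (Suc j) 0 m"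
  let ?g = "neq (Reg (arr 0 (V 15)) [mod] V 12) (Reg (arr 0 (V 16)) [mod] V 12)"
  have guard: "eval_expr ?g m = 0 \<longleftrightarrow> in_level T j e" if "?P xs m" for xs m
    using that en by (simp add: mid_update_def env_def in_level_def)
  show "triple (Suc R) ?P
    (If ?g Skip (Assign (arr 2 (V 11)) ((Reg (arr 2 (V 11)) [+] V 18) [mod] V 10) ;; For 13 (V 6) cell_step)) ?Q"
  proof (rule triple_If)
    show "triple (Suc R) (\<lambda>xs m. ?P xs m \<and> eval_expr ?g m \<noteq> 0) Skip ?Q"
    proof (rule triple_conseq[OF triple_Skip[OF order_refl, of ?Q]])
      fix xs :: "bool list" and m assume m: "?P xs m \<and> eval_expr ?g m \<noteq> 0"
      then have "\<not> in_level T j e" using guard[OF conjunct1[OF m]] conjunct2[OF m] by (simp del: eval_neq)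
      with m mid_update_skip[of T \<mu> e c j m] show "?Q xs m" by simp
    qed simp_all
    show "triple (Suc R) (\<lambda>xs m. ?P xs m \<and> eval_expr ?g m = 0)
      (Assign (arr 2 (V 11)) ((Reg (arr 2 (V 11)) [+] V 18) [mod] V 10) ;; For 13 (V 6) cell_step) ?Q"
    proof (cases "in_level T j e")
      case True
      let ?R = "\<lambda>_ m. m 11 = j \<and> m 12 = 2 ^ j \<and> mid_update T \<mu> e c (Suc j) j 0 m"
      show ?thesis
      proof (rule triple_Seq[OF _ triple_cells_loop[OF e j True]], rule triple_wp)
        fix xs :: "bool list" and m assume "?P xs m \<and> eval_expr ?g m = 0"
        then have m: "m 11 = j" "m 12 = 2 ^ j" "mid_update T \<mu> e c j j 0 m" by simp_all
        have "counters_hold T (\<lambda>j'. if j' < Suc j then \<mu>(e := \<mu> e + c) else \<mu>)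
          (m(addr 2 j := (m (addr 2 j) + m 18) mod M))"
          by (rule counters_hold_step[OF e j True]) (use m in \<open>auto simp: mid_update_def\<close>)
        then have "mid_update T \<mu> e c (Suc j) j 0 (m(addr 2 j := (m (addr 2 j) + m 18) mod M))"
          using m by (simp add: mid_update_def)
        moreover have "m 10 = M" using m by (simp add: mid_update_def env_def)
        moreover have "addr 2 j < D"
        proof (rule addr_less)
          have "l * 1 \<le> l * (R * K)" using R0 K0 by (intro mult_left_mono) auto
          then show "j \<le> l * (R * K) + cells" using j by linarith
        qed simp
        moreover have "(m (addr 2 j) + m 18) mod M < W" using M_less_W M0 by (meson less_trans mod_less_divisor)
        ultimately show "wp (Assign (arr 2 (V 11)) ((Reg (arr 2 (V 11)) [+] V 18) [mod] V 10)) ?R xs m"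
          using m by simp
      qed simp
    next
      case False
      then have "\<not> (?P xs m \<and> eval_expr ?g m = 0)" for xs m using guard[of m] by (auto simp del: eval_neq)
      then show ?thesis by (rule triple_vacuous)
    qed
  qed simp
  show "triple (Suc R) ?Q (12 [:=] Const 2 [*] V 12)
    (\<lambda>_ m. m 11 = j \<and> m 12 = 2 ^ Suc j \<and> mid_update T \<mu> e c (Suc j) (Suc j) 0 m)"
  proof (rule triple_wp)
    have "(2 :: nat) ^ Suc j \<le> 2 ^ l" using j by (intro power_increasing) auto
    then have "2 * 2 ^ j < W" using pow2_less_W by simp
    then show "wp (12 [:=] Const 2 [*] V 12) (\<lambda>_ m. m 11 = j \<and> m 12 = 2 ^ Suc j \<and> mid_update T \<mu> e c (Suc j) (Suc j) 0 m) xs m"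
      if "?Q xs m" for xs m
      using that scalar_less[of 12] by simp
  qed simp
qed

definition edge_pair :: "update \<Rightarrow> nat \<times> nat" where
  "edge_pair a = (min (src a) (tgt a), max (src a) (tgt a))"

definition sign_of :: "update \<Rightarrow> int" where
  "sign_of a = (if is_ins a then 1 else - 1)"

lemma triple_prepare_update:
  assumes a: "src a < n" "tgt a < n" "src a \<noteq> tgt a"
  shows "triple 1 (\<lambda>_ m. env T m \<and> sketches T \<mu> m \<and> m 2 = of_bool (is_ins a) \<and> m 3 = src a \<and> m 4 = tgt a)
    prepare_update (\<lambda>_ m. m 12 = 1 \<and> mid_update T \<mu> (edge_pair a) (sign_of a) 0 0 0 m)"
proof (rule triple_wp)
  fix xs :: "bool list" and m
  assume m: "env T m \<and> sketches T \<mu> m \<and> m 2 = of_bool (is_ins a) \<and> m 3 = src a \<and> m 4 = tgt a"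
  let ?e = "edge_pair a"
  have e: "?e \<in> pairs n" using a by (auto simp: edge_pair_def pairs_def)
  have regs: "m 0 = n" "m 9 = N" "m 10 = M" using m by (simp_all add: env_def)
  have wtM: "wt ?e < M" "0 < wt ?e" using wt_less[OF e] wt_pos by auto
  have "1 \<le> n ^ 6" using n1 by simp
  then have M2: "1 < M" unfolding M_def by linarith
  have "n ^ 1 \<le> n ^ 6" by (rule pow_le) simp
  then have nW: "src a < W" "tgt a < W" "M < W" "wt ?e < W" "1 < W"
    using a wtM M_less_W M2 by (auto simp: M_def)
  have neg: "int (M - x) = (- 1 * int x) mod int M" if "0 < x" "x < M" for x
  proof -
    have "(- 1 * int x) mod int M = (int M - int x) mod int M" by simp
    also have "\<dots> = int M - int x" using that by (intro mod_pos_pos_trivial) auto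
    finally show ?thesis using that by (simp add: of_nat_diff)
  qed
  define m' where "m' = m(15 := fst ?e, 16 := snd ?e, 17 := (if is_ins a then wt ?e else M - wt ?e),
    18 := (if is_ins a then 1 else M - 1), 12 := 1)"
  have "mid_update T \<mu> ?e (sign_of a) 0 0 0 m'"
    using m wtM M2 neg[of "wt ?e"] neg[of 1]
    by (simp add: mid_update_def m'_def sketches_def sign_of_def)
  moreover have "m' 12 = 1" by (simp add: m'_def)
  ultimately have post: "m' 12 = 1 \<and> mid_update T \<mu> ?e (sign_of a) 0 0 0 m'" by simp
  have *: "wp prepare_update Q xs m" if Q: "Q xs m'" for Q
  proof (cases "is_ins a")
    case True
    then show ?thesis using m regs nW scalar_less M2 Q
      by (auto simp: prepare_update_def m'_def edge_pair_def wt_def min_def max_def fun_upd_twist split: if_splits)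
  next
    case False
    then show ?thesis using m regs nW scalar_less M2 Q
      by (auto simp: prepare_update_def m'_def edge_pair_def wt_def min_def max_def fun_upd_twist split: if_splits)
  qed
  show "wp prepare_update (\<lambda>_ m. m 12 = 1 \<and> mid_update T \<mu> (edge_pair a) (sign_of a) 0 0 0 m) xs m"
    by (rule *[of "\<lambda>_ m. m 12 = 1 \<and> mid_update T \<mu> (edge_pair a) (sign_of a) 0 0 0 m"]) (rule post)
qed simp

lemma triple_update_program:
  assumes a: "src a < n" "tgt a < n" "src a \<noteq> tgt a"
  shows "triple (Suc l * Suc R)
    (\<lambda>_ m. env T m \<and> sketches T \<mu> m \<and> m 2 = of_bool (is_ins a) \<and> m 3 = src a \<and> m 4 = tgt a)
    update_program
    (\<lambda>_ m. env T m \<and> sketches T (\<mu>(edge_pair a := \<mu> (edge_pair a) + sign_of a)) m)"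
  unfolding update_program_def
proof (rule triple_Seq)
  let ?e = "edge_pair a" and ?c = "sign_of a"
  have e: "?e \<in> pairs n" using a by (auto simp: edge_pair_def pairs_def)
  show "triple (Suc l * Suc R)
    (\<lambda>_ m. env T m \<and> sketches T \<mu> m \<and> m 2 = of_bool (is_ins a) \<and> m 3 = src a \<and> m 4 = tgt a)
    prepare_update (\<lambda>_ m. m 12 = 1 \<and> mid_update T \<mu> ?e ?c 0 0 0 m)"
    by (rule triple_conseq[OF triple_prepare_update[OF a]]) auto
  let ?I = "\<lambda>j _ m. m 12 = 2 ^ j \<and> mid_update T \<mu> ?e ?c j j 0 m"
  have lW: "l < W" using l_le_n by (intro less_W_pow[of _ 1 1]) auto
  have loop: "triple (Suc l * Suc R) (\<lambda>xs m. ?I 0 xs (m(11 := 0))) (For 11 (V 5) level_step) (\<lambda>xs m. m 11 = l \<and> ?I l xs m)"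
  proof (rule triple_For[OF _ _ lW])
    show "11 < D" by (rule scalar_less) simp
    show "triple (Suc R) (\<lambda>xs m. m 11 = j \<and> ?I j xs m) level_step (\<lambda>xs m. m 11 = j \<and> ?I (Suc j) xs (m(11 := Suc j)))"
      if "j < l" for j
      by (rule triple_conseq[OF triple_level_step[OF e that]]) auto
  qed (auto simp: mid_update_def env_def)
  have final: "sketches T (\<mu>(?e := \<mu> ?e + ?c)) m" if "mid_update T \<mu> ?e ?c l l 0 m" for m
    using that by (simp add: mid_update_def sketches_def counters_hold_def cells_hold_def)
  show "triple (Suc l * Suc R) (\<lambda>_ m. m 12 = 1 \<and> mid_update T \<mu> ?e ?c 0 0 0 m) (For 11 (V 5) level_step)
    (\<lambda>_ m. env T m \<and> sketches T (\<mu>(?e := \<mu> ?e + ?c)) m)"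
    by (rule triple_conseq[OF loop]) (use final in \<open>auto simp: mid_update_def\<close>)
qed

end

section \<open>Decoding the sketch\<close>

text \<open>Registers 16, 17, 18, 20 hold the cell content, the candidate identifier, the list
  length and a duplicate flag. A cell with quotient 1 by \<open>N\<close> contains one edge. The
  linear scan for duplicates is affordable, as post-processing only has to be polynomial.\<close>

definition decode_slot :: com where
  "decode_slot =
    16 [:=] Reg (arr 6 (V 11 [*] V 8 [+] V 13)) ;;
    If (neq (V 16 [div] V 9) (Const 1)) Skip
      (17 [:=] V 16 [mod] V 9 ;;
       20 [:=] Const 0 ;;
       For 14 (V 18) (If (neq (Reg (arr 3 (V 14))) (V 17)) Skip (20 [:=] Const 1)) ;;
       If (V 20) Skip (Assign (arr 3 (V 18)) (V 17) ;; 18 [:=] V 18 [+] Const 1))"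

text \<open>Register 19 freezes the result: once a level is complete, later passes change neither
  the list nor the scale in register 12.\<close>

definition decode_level :: com where
  "decode_level =
    If (V 19) Skip
      (18 [:=] Const 0 ;;
       For 13 (V 8) decode_slot ;;
       If (neq (V 18) (Reg (arr 2 (V 11)))) (12 [:=] Const 2 [*] V 12) (19 [:=] Const 1))"

definition search :: com where
  "search = 19 [:=] Const 0 ;; 12 [:=] Const 1 ;; For 11 (V 5) decode_level"

lemma (in ram) triple_Ex: "(\<And>x. triple T (P x) c Q) \<Longrightarrow> triple T (\<lambda>xs m. \<exists>x. P x xs m) c Q"
  unfolding triple_def by blast

context sketch
begin

definition pair_id :: "nat \<times> nat \<Rightarrow> nat" where
  "pair_id e = fst e * n + snd e"

lemma pair_id_div_mod:
  "e \<in> pairs n \<Longrightarrow> pair_id e div n = fst e" "e \<in> pairs n \<Longrightarrow> pair_id e mod n = snd e"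
  using n1 by (auto simp: pair_id_def pairs_def)

lemma inj_pair_id: "inj_on pair_id (pairs n)"
  by (rule inj_onI) (metis pair_id_div_mod prod_eqI)

definition indicator_int :: "(nat \<times> nat) set \<Rightarrow> nat \<times> nat \<Rightarrow> int" where
  "indicator_int A e = of_bool (e \<in> A)"

text \<open>The index \<open>i\<close> runs through all cells of the level, with repetition
  \<open>i div K\<close> and bucket \<open>i mod K\<close>.\<close>

definition slot :: "(nat \<Rightarrow> nat) \<Rightarrow> (nat \<times> nat) set \<Rightarrow> nat \<Rightarrow> nat \<Rightarrow> (nat \<times> nat) set" where
  "slot T A j i = {e \<in> same_class j T A. bucket n K T (i div K) e = i mod K}"

definition found :: "(nat \<Rightarrow> nat) \<Rightarrow> (nat \<times> nat) set \<Rightarrow> nat \<Rightarrow> nat \<Rightarrow> (nat \<times> nat) set" where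
  "found T A j i = {e. \<exists>i'<i. slot T A j i' = {e}}"

lemma in_same_class: "e \<in> same_class j T A \<longleftrightarrow> e \<in> A \<and> in_level T j e"
  by (cases e) (simp add: same_class_def in_level_def)

lemma found_Suc: "found T A j (Suc i) = found T A j i \<union> {e. slot T A j i = {e}}"
  by (auto simp: found_def less_Suc_eq)

lemma found_subset: "found T A j i \<subseteq> same_class j T A"
  by (auto simp: found_def slot_def)

lemma decodable_iff_found:
  "decodable n K R T (same_class j T A) \<longleftrightarrow> same_class j T A \<subseteq> found T A j (R * K)"
proof
  assume dec: "decodable n K R T (same_class j T A)"
  show "same_class j T A \<subseteq> found T A j (R * K)"
  proof
    fix e assume e: "e \<in> same_class j T A"
    then obtain r where r: "r < R" "isolated n K T (same_class j T A) r e"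
      using dec by (auto simp: decodable_def)
    define b where "b = bucket n K T r e"
    have b: "b < K" using bucket_less by (simp add: b_def)
    have "Suc r * K \<le> R * K" using r by (intro mult_right_mono) auto
    then have "r * K + b < R * K" using b by simp
    moreover have "slot T A j (r * K + b) = {e}"
      using e r(2) b K0 by (auto simp: slot_def isolated_def b_def)
    ultimately show "e \<in> found T A j (R * K)" by (auto simp: found_def)
  qed
next
  assume sub: "same_class j T A \<subseteq> found T A j (R * K)"
  show "decodable n K R T (same_class j T A)"
    unfolding decodable_def
  proof
    fix e assume "e \<in> same_class j T A"
    then obtain i where i: "i < R * K" "slot T A j i = {e}" using sub by (auto simp: found_def)
    have "i div K < R" using i(1) by (simp add: less_mult_imp_div_less)
    moreover have "isolated n K T (same_class j T A) (i div K) e"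
      unfolding isolated_def
    proof (intro ballI impI)
      fix e' assume e': "e' \<in> same_class j T A" "bucket n K T (i div K) e' = bucket n K T (i div K) e"
      have "e \<in> slot T A j i" using i(2) by simp
      then have "e' \<in> slot T A j i" using e' by (simp add: slot_def)
      then show "e' = e" using i(2) by simp
    qed
    ultimately show "\<exists>r<R. isolated n K T (same_class j T A) r e" by blast
  qed
qed

lemma finite_sub_pairs: "A \<subseteq> pairs n \<Longrightarrow> finite A"
  using finite_pairs finite_subset by blast

lemma card_pairs: "A \<subseteq> pairs n \<Longrightarrow> card A \<le> n\<^sup>2"
proof -
  assume "A \<subseteq> pairs n"
  then have "card A \<le> card ({..<n} \<times> {..<n})" by (intro card_mono) (auto simp: pairs_def)
  then show ?thesis by (simp add: power2_eq_square)
qed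

lemma sum_pair_id_less: "A \<subseteq> pairs n \<Longrightarrow> (\<Sum>e\<in>A. pair_id e) < N"
proof -
  assume A: "A \<subseteq> pairs n"
  have "(\<Sum>e\<in>A. pair_id e) \<le> (\<Sum>e\<in>A. n\<^sup>2 - 1)"
  proof (rule sum_mono)
    fix e assume "e \<in> A"
    then have "pair_id e < n\<^sup>2" using A pair_id_less by (auto simp: pair_id_def)
    then show "pair_id e \<le> n\<^sup>2 - 1" by simp
  qed
  also have "\<dots> \<le> n\<^sup>2 * (n\<^sup>2 - 1)" using card_pairs[OF A] by simp
  also have "\<dots> < n\<^sup>2 * n\<^sup>2" using n1 by (intro mult_strict_left_mono) auto
  also have "\<dots> = N" by (simp add: N_def flip: power_add)
  finally show ?thesis .
qed

lemma sum_wt_less: "A \<subseteq> pairs n \<Longrightarrow> (\<Sum>e\<in>A. wt e) < M"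
proof -
  assume A: "A \<subseteq> pairs n"
  have "(\<Sum>e\<in>A. wt e) = card A * N + (\<Sum>e\<in>A. pair_id e)" by (simp add: wt_def pair_id_def sum.distrib)
  also have "\<dots> < n\<^sup>2 * N + N"
    using card_pairs[OF A] sum_pair_id_less[OF A] by (intro add_le_less_mono mult_right_mono) auto
  also have "\<dots> \<le> n ^ 6 + n ^ 6" using pow_le[of 4 6] by (simp add: N_def flip: power_add)
  finally show ?thesis by (simp add: M_def)
qed

text \<open>With multiplicities 0 and 1 the true sum lies below \<open>M\<close>, so the residue is
  the sum itself.\<close>

lemma lsum_indicator:
  assumes A: "A \<subseteq> pairs n" and g: "\<And>e. g e = of_bool (P e) * int (h e)" and lt: "(\<Sum>e\<in>{e \<in> A. P e}. h e) < M"
  shows "lsum n M g (indicator_int A) = int (\<Sum>e\<in>{e \<in> A. P e}. h e)"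
proof -
  have "(\<Sum>e\<in>pairs n. indicator_int A e * g e) = (\<Sum>e\<in>pairs n. if e \<in> A \<and> P e then int (h e) else 0)"
    by (rule sum.cong) (auto simp: indicator_int_def g)
  also have "\<dots> = (\<Sum>e\<in>{e \<in> A. P e}. int (h e))"
    using A finite_pairs by (subst sum.inter_filter[symmetric]) (auto intro!: sum.cong)
  finally show ?thesis using lt by (simp add: lsum_def zmod_int[symmetric] flip: of_nat_sum)
qed

lemma counter_value:
  assumes A: "A \<subseteq> pairs n" and s: "sketches T (indicator_int A) m" and j: "j < l"
  shows "m (addr 2 j) = card (same_class j T A)"
proof -
  have eq: "{e \<in> A. in_level T j e} = same_class j T A" by (auto simp: in_same_class)
  have "same_class j T A \<subseteq> pairs n" using A same_class_subset by blast
  then have "card (same_class j T A) \<le> n\<^sup>2" by (rule card_pairs)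
  also have "n\<^sup>2 < N + n\<^sup>2" using N0 by simp
  also have "\<dots> \<le> M" by (rule N_n2_le_M)
  finally have lt: "(\<Sum>e\<in>{e \<in> A. in_level T j e}. 1) < M" by (simp add: eq)
  have "int (m (addr 2 j)) = lsum n M (count_weight T j) (indicator_int A)"
    using s j by (simp add: sketches_def counters_hold_def)
  also have "\<dots> = int (\<Sum>e\<in>{e \<in> A. in_level T j e}. 1)"
    by (rule lsum_indicator[OF A _ lt]) (simp add: count_weight_def)
  finally show ?thesis by (simp add: eq)
qed

text \<open>In radix \<open>N\<close> the number of edges and the sum of their identifiers do not
  interfere, by \<open>sum_pair_id_less\<close>.\<close>

lemma cell_value:
  assumes A: "A \<subseteq> pairs n" and s: "sketches T (indicator_int A) m" and j: "j < l" and i: "i < R * K"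
  shows "m (addr 6 (j * (R * K) + i)) div N = card (slot T A j i)"
    "m (addr 6 (j * (R * K) + i)) mod N = (\<Sum>e\<in>slot T A j i. pair_id e)"
proof -
  have ib: "i div K < R" "i mod K < K" using i K0 by (auto simp: less_mult_imp_div_less)
  have eq: "{e \<in> A. in_level T j e \<and> bucket n K T (i div K) e = i mod K} = slot T A j i"
    by (auto simp: in_same_class slot_def)
  have sub: "slot T A j i \<subseteq> pairs n" using A by (auto simp: slot_def in_same_class)
  have "int (m (addr 6 (j * (R * K) + (i div K * K + i mod K)))) =
      lsum n M (cell_weight T j (i div K) (i mod K)) (indicator_int A)"
    using s j ib unfolding sketches_def cells_hold_def by blast
  also have "\<dots> = int (\<Sum>e\<in>slot T A j i. wt e)"
    unfolding eq[symmetric]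
    by (rule lsum_indicator[OF A]) (auto simp: cell_weight_def eq sum_wt_less[OF sub])
  also have "(\<Sum>e\<in>slot T A j i. wt e) = card (slot T A j i) * N + (\<Sum>e\<in>slot T A j i. pair_id e)"
    by (simp add: wt_def pair_id_def sum.distrib)
  finally have "m (addr 6 (j * (R * K) + i)) = card (slot T A j i) * N + (\<Sum>e\<in>slot T A j i. pair_id e)"
    unfolding of_nat_eq_iff div_mult_mod_eq .
  then show "m (addr 6 (j * (R * K) + i)) div N = card (slot T A j i)"
    "m (addr 6 (j * (R * K) + i)) mod N = (\<Sum>e\<in>slot T A j i. pair_id e)"
    using sum_pair_id_less[OF sub] N0 by simp_all
qed

definition list_at :: "nat list \<Rightarrow> memory \<Rightarrow> bool" where
  "list_at ids m \<longleftrightarrow> m 18 = length ids \<and> (\<forall>k<length ids. m (addr 3 k) = ids ! k)"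

lemma list_at_upd [simp]: "x < 32 \<Longrightarrow> x \<noteq> 18 \<Longrightarrow> list_at ids (m(x := y)) = list_at ids m"
  by (simp add: list_at_def)

text \<open>The length bound keeps the list within its array: each slot contributes at most one
  identifier.\<close>

definition decoded :: "(nat \<Rightarrow> nat) \<Rightarrow> (nat \<times> nat) set \<Rightarrow> nat \<Rightarrow> nat \<Rightarrow> nat list \<Rightarrow> memory \<Rightarrow> bool" where
  "decoded T A j i ids m \<longleftrightarrow> distinct ids \<and> set ids = pair_id ` found T A j i \<and> length ids \<le> i \<and> list_at ids m"

lemma decoded_upd [simp]: "x < 32 \<Longrightarrow> x \<noteq> 18 \<Longrightarrow> decoded T A j i ids (m(x := y)) = decoded T A j i ids m"
  by (simp add: decoded_def)

definition base :: "(nat \<Rightarrow> nat) \<Rightarrow> (nat \<times> nat) set \<Rightarrow> nat \<Rightarrow> memory \<Rightarrow> bool" where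
  "base T A p m \<longleftrightarrow> env T m \<and> sketches T (indicator_int A) m \<and> m 12 = p \<and> m 19 = 0"

lemma sketches_upd_scalar [simp]: "x < 32 \<Longrightarrow> sketches T \<mu> (m(x := y)) = sketches T \<mu> m"
  by (simp add: sketches_def)

lemma sketches_upd_arr [simp]: "k \<in> {0, 3, 4, 5} \<Longrightarrow> sketches T \<mu> (m(addr k i := y)) = sketches T \<mu> m"
  by (elim insertE emptyE; simp add: sketches_def)

lemma base_upd_scalar [simp]:
  "x \<in> {11, 13, 14, 15, 16, 17, 18, 20} \<Longrightarrow> base T A p (m(x := y)) = base T A p m"
  by (elim insertE emptyE; simp add: base_def)

lemma base_upd_arr [simp]: "base T A p (m(addr 3 i := y)) = base T A p m"
  by (simp add: base_def)

lemma baseD: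
  "base T A p m \<Longrightarrow> m 0 = n" "base T A p m \<Longrightarrow> m 5 = l" "base T A p m \<Longrightarrow> m 8 = R * K" "base T A p m \<Longrightarrow> m 9 = N"
  "base T A p m \<Longrightarrow> m 12 = p" "base T A p m \<Longrightarrow> m 19 = 0"
  by (simp_all add: base_def env_def)

lemma N_less_W: "N < W" by (rule less_W_pow[of _ 1 4]) (auto simp: N_def)

lemma triple_dup_loop:
  assumes ids: "length ids \<le> R * K"
  shows "triple (Suc (R * K))
    (\<lambda>_ m. base T A p m \<and> m 11 = j \<and> m 13 = i \<and> m 17 = x \<and> m 20 = 0 \<and> decoded T A j i ids m)
    (For 14 (V 18) (If (neq (Reg (arr 3 (V 14))) (V 17)) Skip (20 [:=] Const 1)))
    (\<lambda>_ m. base T A p m \<and> m 11 = j \<and> m 13 = i \<and> m 17 = x \<and> (m 20 = 0 \<longleftrightarrow> x \<notin> set ids) \<and> decoded T A j i ids m)"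
proof -
  let ?I = "\<lambda>k _ m. base T A p m \<and> m 11 = j \<and> m 13 = i \<and> m 17 = x \<and> decoded T A j i ids m \<and>
    (m 20 = 0 \<longleftrightarrow> x \<notin> set (take k ids))"
  have "length ids \<le> l * (R * K) + cells" using ids RK_le_index by linarith
  then have lenW: "length ids < W" by (rule index_less_W)
  have loop: "triple (Suc (length ids) * 1) (\<lambda>xs m. ?I 0 xs (m(14 := 0)))
    (For 14 (V 18) (If (neq (Reg (arr 3 (V 14))) (V 17)) Skip (20 [:=] Const 1)))
    (\<lambda>xs m. m 14 = length ids \<and> ?I (length ids) xs m)"
  proof (rule triple_For[OF order_refl _ lenW])
    show "14 < D" by (rule scalar_less) simp
    fix k assume k: "k < length ids"
    have tk: "take (Suc k) ids = take k ids @ [ids ! k]" using k by (rule take_Suc_conv_app_nth)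
    show "triple 1 (\<lambda>xs m. m 14 = k \<and> ?I k xs m) (If (neq (Reg (arr 3 (V 14))) (V 17)) Skip (20 [:=] Const 1))
      (\<lambda>xs m. m 14 = k \<and> ?I (Suc k) xs (m(14 := Suc k)))"
    proof (rule triple_wp)
      fix xs :: "bool list" and m assume m: "m 14 = k \<and> ?I k xs m"
      have "m (addr 3 k) = ids ! k" using m k by (simp add: decoded_def list_at_def)
      then show "wp (If (neq (Reg (arr 3 (V 14))) (V 17)) Skip (20 [:=] Const 1))
          (\<lambda>xs m. m 14 = k \<and> ?I (Suc k) xs (m(14 := Suc k))) xs m"
        using m W scalar_less[of 20] by (auto simp: tk base_def decoded_def)
    qed simp
  qed (auto simp: decoded_def list_at_def)
  show ?thesis by (rule triple_conseq[OF loop]) (use ids in auto)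
qed

lemma decoded_skip:
  assumes "\<not> is_singleton (slot T A j i)" "decoded T A j i ids m"
  shows "decoded T A j (Suc i) ids m"
  using assms by (auto simp: decoded_def found_Suc is_singleton_def)

lemma decoded_dup:
  assumes "slot T A j i = {e}" "decoded T A j i ids m" "pair_id e \<in> set ids"
  shows "decoded T A j (Suc i) ids m"
proof -
  have "{e'. slot T A j i = {e'}} = {e}" using assms(1) by auto
  then have "found T A j (Suc i) = insert e (found T A j i)" by (simp add: found_Suc)
  then show ?thesis using assms(2,3) by (auto simp: decoded_def)
qed

lemma decoded_add:
  assumes "slot T A j i = {e}" "decoded T A j i ids m" "pair_id e \<notin> set ids"
  shows "decoded T A j (Suc i) (ids @ [pair_id e]) (m(addr 3 (m 18) := pair_id e, 18 := Suc (m 18)))"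
proof -
  have "{e'. slot T A j i = {e'}} = {e}" using assms(1) by auto
  then have "found T A j (Suc i) = insert e (found T A j i)" by (simp add: found_Suc)
  moreover have "list_at (ids @ [pair_id e]) (m(addr 3 (m 18) := pair_id e, 18 := Suc (m 18)))"
    using assms(2) by (auto simp: decoded_def list_at_def nth_append less_Suc_eq)
  ultimately show ?thesis using assms(2,3) by (auto simp: decoded_def)
qed

lemma triple_decode_slot:
  assumes A: "A \<subseteq> pairs n" and j: "j < l" and i: "i < R * K"
  shows "triple (Suc (R * K))
    (\<lambda>_ m. m 13 = i \<and> m 11 = j \<and> base T A p m \<and> (\<exists>ids. decoded T A j i ids m)) decode_slot
    (\<lambda>_ m. m 13 = i \<and> m 11 = j \<and> base T A p m \<and> (\<exists>ids. decoded T A j (Suc i) ids m))"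
proof -
  let ?B = "\<lambda>m. m 13 = i \<and> m 11 = j \<and> base T A p m"
  let ?Q = "\<lambda>_ m. ?B m \<and> (\<exists>ids. decoded T A j (Suc i) ids m)"
  let ?v = "\<lambda>m. m (addr 6 (j * (R * K) + i))"
  have jRK: "j * (R * K) + i < l * (R * K)"
  proof -
    have "Suc j * (R * K) \<le> l * (R * K)" using j by (intro mult_right_mono) auto
    then show ?thesis using i by simp
  qed
  \<comment> \<open>The triple is proved for a fixed list, so that loop bounds and assertions can
    mention it; \<open>triple_Ex\<close> restores the quantifier at the end.\<close>
  have fixed: "triple (Suc (R * K)) (\<lambda>_ m. ?B m \<and> decoded T A j i ids m) decode_slot ?Q" for ids
  proof (cases "length ids \<le> R * K")
    case False
    then show ?thesis using i by (intro triple_vacuous) (auto simp: decoded_def)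
  next
    case len: True
    let ?P1 = "\<lambda>_ m. ?B m \<and> decoded T A j i ids m \<and>
      m 16 div N = card (slot T A j i) \<and> m 16 mod N = (\<Sum>e\<in>slot T A j i. pair_id e)"
    show ?thesis
      unfolding decode_slot_def
    proof (rule triple_Seq[of _ _ _ ?P1])
      show "triple (Suc (R * K)) (\<lambda>_ m. ?B m \<and> decoded T A j i ids m) (16 [:=] Reg (arr 6 (V 11 [*] V 8 [+] V 13))) ?P1"
      proof (rule triple_wp)
        fix xs :: "bool list" and m assume okm: "ok m" and m: "?B m \<and> decoded T A j i ids m"
        have "?v m < W" using okm by (simp add: ok_def)
        moreover have "?v m div N = card (slot T A j i)" "?v m mod N = (\<Sum>e\<in>slot T A j i. pair_id e)"
          using m cell_value[OF A _ j i, of T m] by (auto simp: base_def)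
        ultimately show "wp (16 [:=] Reg (arr 6 (V 11 [*] V 8 [+] V 13))) ?P1 xs m"
          using m scalar_less[of 16] by (simp add: baseD(3)[of T A p])
      qed simp
      show "triple (Suc (R * K)) ?P1 (If (neq (V 16 [div] V 9) (Const 1)) Skip
        (17 [:=] V 16 [mod] V 9 ;; 20 [:=] Const 0 ;;
         For 14 (V 18) (If (neq (Reg (arr 3 (V 14))) (V 17)) Skip (20 [:=] Const 1)) ;;
         If (V 20) Skip (Assign (arr 3 (V 18)) (V 17) ;; 18 [:=] V 18 [+] Const 1))) ?Q"
      proof (rule triple_If)
        show "triple (Suc (R * K)) (\<lambda>xs m. ?P1 xs m \<and> eval_expr (neq (V 16 [div] V 9) (Const 1)) m \<noteq> 0) Skip ?Q"
        proof (rule triple_conseq[OF triple_Skip[OF order_refl, of ?Q]])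
          fix xs :: "bool list" and m
          assume m: "?P1 xs m \<and> eval_expr (neq (V 16 [div] V 9) (Const 1)) m \<noteq> 0"
          then have "card (slot T A j i) \<noteq> 1" by (auto simp: baseD(4)[of T A p])
          then have "\<not> is_singleton (slot T A j i)" by (simp add: is_singleton_altdef)
          then show "?Q xs m" using m decoded_skip by blast
        qed simp_all
        show "triple (Suc (R * K)) (\<lambda>xs m. ?P1 xs m \<and> eval_expr (neq (V 16 [div] V 9) (Const 1)) m = 0)
          (17 [:=] V 16 [mod] V 9 ;; 20 [:=] Const 0 ;;
           For 14 (V 18) (If (neq (Reg (arr 3 (V 14))) (V 17)) Skip (20 [:=] Const 1)) ;;
           If (V 20) Skip (Assign (arr 3 (V 18)) (V 17) ;; 18 [:=] V 18 [+] Const 1)) ?Q"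
        proof (cases "card (slot T A j i) = 1")
          case False
          then show ?thesis by (intro triple_vacuous) (auto simp: baseD(4)[of T A p])
        next
          case True
          then obtain e where e: "slot T A j i = {e}" by (auto simp: card_1_singleton_iff)
          then have "e \<in> pairs n" using A by (auto simp: slot_def in_same_class)
          then have xW: "pair_id e < W" using sum_pair_id_less[of "{e}"] N_less_W by simp
          let ?P2 = "\<lambda>_ m. ?B m \<and> m 17 = pair_id e \<and> decoded T A j i ids m"
          let ?P3 = "\<lambda>_ m. base T A p m \<and> m 11 = j \<and> m 13 = i \<and> m 17 = pair_id e \<and> m 20 = 0 \<and> decoded T A j i ids m"
          show ?thesis
          proof (rule triple_Seq[of _ _ _ ?P2])
            show "triple (Suc (R * K)) (\<lambda>xs m. ?P1 xs m \<and> eval_expr (neq (V 16 [div] V 9) (Const 1)) m = 0)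
              (17 [:=] V 16 [mod] V 9) ?P2"
              by (rule triple_wp) (use e xW scalar_less[of 17] in \<open>auto simp: baseD(4)[of T A p]\<close>)
            show "triple (Suc (R * K)) ?P2 (20 [:=] Const 0 ;;
               For 14 (V 18) (If (neq (Reg (arr 3 (V 14))) (V 17)) Skip (20 [:=] Const 1)) ;;
               If (V 20) Skip (Assign (arr 3 (V 18)) (V 17) ;; 18 [:=] V 18 [+] Const 1)) ?Q"
            proof (rule triple_Seq[of _ _ _ ?P3], rule triple_wp)
              show "wp (20 [:=] Const 0) ?P3 xs m" if "?P2 xs m" for xs m
                using that W scalar_less[of 20] by simp
              show "triple (Suc (R * K)) ?P3 (For 14 (V 18) (If (neq (Reg (arr 3 (V 14))) (V 17)) Skip (20 [:=] Const 1)) ;;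
                 If (V 20) Skip (Assign (arr 3 (V 18)) (V 17) ;; 18 [:=] V 18 [+] Const 1)) ?Q"
              proof (rule triple_Seq[OF triple_dup_loop[OF len]], rule triple_wp)
                fix xs :: "bool list" and m
                assume m: "base T A p m \<and> m 11 = j \<and> m 13 = i \<and> m 17 = pair_id e \<and>
                  (m 20 = 0 \<longleftrightarrow> pair_id e \<notin> set ids) \<and> decoded T A j i ids m"
                show "wp (If (V 20) Skip (Assign (arr 3 (V 18)) (V 17) ;; 18 [:=] V 18 [+] Const 1)) ?Q xs m"
                proof (cases "m 20 = 0")
                  case False
                  then have "decoded T A j (Suc i) ids m" using m by (intro decoded_dup[OF e]) auto
                  then show ?thesis using m False by auto
                next
                  case True
                  have *: "decoded T A j (Suc i) (ids @ [pair_id e]) (m(addr 3 (m 18) := pair_id e, 18 := Suc (m 18)))"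
                    using m True by (intro decoded_add[OF e]) auto
                  have "m 18 \<le> i" using m by (simp add: decoded_def list_at_def)
                  then have lt: "m 18 < R * K" using i by simp
                  then have "m 18 \<le> l * (R * K) + cells" "Suc (m 18) \<le> l * (R * K) + cells"
                    using RK_le_index by linarith+
                  then have "addr 3 (m 18) < D" "Suc (m 18) < W"
                    using addr_less index_less_W by auto
                  then show ?thesis using m True * xW scalar_less[of 18] by auto
                qed
              qed simp
            qed simp
          qed
        qed
      qed simp
    qed
  qed
  have "triple (Suc (R * K)) (\<lambda>_ m. \<exists>ids. ?B m \<and> decoded T A j i ids m) decode_slot ?Q"
    by (rule triple_Ex) (rule fixed)
  then show ?thesis by (rule triple_conseq) auto
qed

definition searched :: "(nat \<Rightarrow> nat) \<Rightarrow> (nat \<times> nat) set \<Rightarrow> nat \<Rightarrow> memory \<Rightarrow> bool" where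
  "searched T A j m \<longleftrightarrow> env T m \<and> sketches T (indicator_int A) m \<and>
    (m 19 = 0 \<and> m 12 = 2 ^ j \<and> (\<forall>j'<j. \<not> decodable n K R T (same_class j' T A)) \<or>
     m 19 = 1 \<and> (\<exists>j0<j. decodable n K R T (same_class j0 T A) \<and>
       (\<forall>j'<j0. \<not> decodable n K R T (same_class j' T A)) \<and> m 12 = 2 ^ j0 \<and>
       (\<exists>ids. decoded T A j0 (R * K) ids m)))"

lemma searched_upd [simp]: "searched T A j (m(11 := y)) = searched T A j m"
  by (simp add: searched_def)

text \<open>Found edges always belong to the level, so equal cardinality already means that nothing
  is missing. This justifies the comparison with the level counter.\<close>

lemma card_decoded:
  assumes A: "A \<subseteq> pairs n" and d: "decoded T A j (R * K) ids m"
  shows "length ids = card (same_class j T A) \<longleftrightarrow> decodable n K R T (same_class j T A)"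
proof -
  have sub: "found T A j (R * K) \<subseteq> pairs n" using found_subset A same_class_subset by blast
  have "length ids = card (set ids)" using d unfolding decoded_def by (metis distinct_card)
  also have "\<dots> = card (found T A j (R * K))"
    using d card_image[OF inj_on_subset[OF inj_pair_id sub]] by (simp add: decoded_def)
  finally have len: "length ids = card (found T A j (R * K))" .
  have fin: "finite (same_class j T A)" by (rule finite_sub_pairs) (use A same_class_subset in blast)
  show ?thesis
    unfolding decodable_iff_found len
    using card_subset_eq[OF fin found_subset[of T A j "R * K"]] found_subset[of T A j "R * K"] by auto
qed

lemma triple_decode_level:
  assumes A: "A \<subseteq> pairs n" and j: "j < l"
  shows "triple (Suc (R * K) * Suc (R * K)) (\<lambda>_ m. m 11 = j \<and> searched T A j m) decode_level
    (\<lambda>_ m. m 11 = j \<and> searched T A (Suc j) m)"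
  unfolding decode_level_def
proof (rule triple_If)
  let ?P = "\<lambda>_ m. m 11 = j \<and> searched T A j m" and ?Q = "\<lambda>_ m. m 11 = j \<and> searched T A (Suc j) m"
  let ?T = "Suc (R * K) * Suc (R * K)"
  show "triple ?T (\<lambda>xs m. ?P xs m \<and> eval_expr (V 19) m \<noteq> 0) Skip ?Q"
    by (rule triple_conseq[OF triple_Skip[OF order_refl, of ?Q]]) (auto simp: searched_def less_Suc_eq)
  let ?P1 = "\<lambda>_ m. m 11 = j \<and> base T A (2 ^ j) m \<and> (\<forall>j'<j. \<not> decodable n K R T (same_class j' T A))"
  let ?I = "\<lambda>i _ m. m 11 = j \<and> base T A (2 ^ j) m \<and> (\<exists>ids. decoded T A j i ids m)"
  let ?P2 = "\<lambda>_ m. ?P1 [] m \<and> (\<exists>ids. decoded T A j (R * K) ids m)"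
  show "triple ?T (\<lambda>xs m. ?P xs m \<and> eval_expr (V 19) m = 0) (18 [:=] Const 0 ;; For 13 (V 8) decode_slot ;;
     If (neq (V 18) (Reg (arr 2 (V 11)))) (12 [:=] Const 2 [*] V 12) (19 [:=] Const 1)) ?Q"
  proof (cases "\<forall>j'<j. \<not> decodable n K R T (same_class j' T A)")
    case False
    then show ?thesis by (intro triple_vacuous) (auto simp: searched_def)
  next
    case prev: True
    show ?thesis
    proof (rule triple_Seq[of _ _ _ "?I 0"])
      show "triple ?T (\<lambda>xs m. ?P xs m \<and> eval_expr (V 19) m = 0) (18 [:=] Const 0) (?I 0)"
      proof (rule triple_wp)
        fix xs :: "bool list" and m assume m: "?P xs m \<and> eval_expr (V 19) m = 0"
        have "decoded T A j 0 [] (m(18 := 0))" by (simp add: decoded_def found_def list_at_def)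
        then show "wp (18 [:=] Const 0) (?I 0) xs m"
          using m W scalar_less[of 18] by (auto simp: searched_def base_def)
      qed simp
      have RKW: "R * K < W" using RK_le_index by (intro index_less_W) linarith
      have loop: "triple ?T (\<lambda>xs m. ?I 0 xs (m(13 := 0))) (For 13 (V 8) decode_slot) (\<lambda>xs m. m 13 = R * K \<and> ?I (R * K) xs m)"
      proof (rule triple_For[OF _ _ RKW])
        show "13 < D" by (rule scalar_less) simp
        fix i assume i: "i < R * K"
        show "triple (Suc (R * K)) (\<lambda>xs m. m 13 = i \<and> ?I i xs m) decode_slot (\<lambda>xs m. m 13 = i \<and> ?I (Suc i) xs (m(13 := Suc i)))"
          by (rule triple_conseq[OF triple_decode_slot[OF A j i]]) auto
      qed (auto simp: base_def env_def)
      show "triple ?T (?I 0) (For 13 (V 8) decode_slot ;;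
        If (neq (V 18) (Reg (arr 2 (V 11)))) (12 [:=] Const 2 [*] V 12) (19 [:=] Const 1)) ?Q"
      proof (rule triple_Seq[of _ _ _ "?I (R * K)"])
        show "triple ?T (?I 0) (For 13 (V 8) decode_slot) (?I (R * K))"
          by (rule triple_conseq[OF loop]) auto
        show "triple ?T (?I (R * K)) (If (neq (V 18) (Reg (arr 2 (V 11)))) (12 [:=] Const 2 [*] V 12) (19 [:=] Const 1)) ?Q"
        proof (rule triple_wp)
          fix xs :: "bool list" and m assume m: "?I (R * K) xs m"
          then obtain ids where ids: "decoded T A j (R * K) ids m" by blast
          have "(2 :: nat) ^ Suc j \<le> 2 ^ l" using j by (intro power_increasing) auto
          then have pW: "2 * 2 ^ j < W" using pow2_less_W by simp
          have c: "m (addr 2 j) = card (same_class j T A)"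
            by (rule counter_value[OF A _ j]) (use m in \<open>simp add: base_def\<close>)
          have "m 18 = length ids" using ids by (simp add: decoded_def list_at_def)
          then have iff: "m 18 = m (addr 2 j) \<longleftrightarrow> decodable n K R T (same_class j T A)"
            using card_decoded[OF A ids] by (simp add: c)
          show "wp (If (neq (V 18) (Reg (arr 2 (V 11)))) (12 [:=] Const 2 [*] V 12) (19 [:=] Const 1)) ?Q xs m"
          proof (cases "decodable n K R T (same_class j T A)")
            case True
            have "searched T A (Suc j) (m(19 := 1))"
              using True prev m ids unfolding searched_def base_def by auto
            then show ?thesis using True m iff W scalar_less[of 19] by simp
          next
            case False
            then have "searched T A (Suc j) (m(12 := 2 * 2 ^ j))"
              using prev m by (auto simp: searched_def base_def less_Suc_eq)
            then show ?thesis using False m iff pW scalar_less[of 12] by (simp add: base_def)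
          qed
        qed simp
      qed
    qed
  qed
qed simp

lemma triple_search:
  assumes A: "A \<subseteq> pairs n"
  shows "triple (Suc l * (Suc (R * K) * Suc (R * K)))
    (\<lambda>_ m. env T m \<and> sketches T (indicator_int A) m) search (\<lambda>_ m. searched T A l m)"
  unfolding search_def
proof (rule triple_Seq)
  let ?T = "Suc l * (Suc (R * K) * Suc (R * K))"
  show "triple ?T (\<lambda>_ m. env T m \<and> sketches T (indicator_int A) m) (19 [:=] Const 0)
    (\<lambda>_ m. env T m \<and> sketches T (indicator_int A) m \<and> m 19 = 0)"
    by (rule triple_wp) (use W scalar_less[of 19] in auto)
  have lW: "l < W" using l_le_n by (intro less_W_pow[of _ 1 1]) auto
  have loop: "triple ?T (\<lambda>xs m. (\<lambda>j _. searched T A j) 0 xs (m(11 := 0))) (For 11 (V 5) decode_level)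
    (\<lambda>xs m. m 11 = l \<and> (\<lambda>j _. searched T A j) l xs m)"
  proof (rule triple_For[OF _ _ lW])
    show "11 < D" by (rule scalar_less) simp
    fix j assume j: "j < l"
    show "triple (Suc (R * K) * Suc (R * K)) (\<lambda>xs m. m 11 = j \<and> searched T A j m) decode_level
      (\<lambda>xs m. m 11 = j \<and> searched T A (Suc j) (m(11 := Suc j)))"
      by (rule triple_conseq[OF triple_decode_level[OF A j]]) auto
  qed (auto simp: searched_def env_def)
  show "triple ?T (\<lambda>_ m. env T m \<and> sketches T (indicator_int A) m \<and> m 19 = 0)
    (12 [:=] Const 1 ;; For 11 (V 5) decode_level) (\<lambda>_ m. searched T A l m)"
  proof (rule triple_Seq)
    show "triple ?T (\<lambda>_ m. env T m \<and> sketches T (indicator_int A) m \<and> m 19 = 0) (12 [:=] Const 1) (\<lambda>_ m. searched T A 0 m)"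
      by (rule triple_wp) (use W scalar_less[of 12] in \<open>auto simp: searched_def\<close>)
    show "triple ?T (\<lambda>_ m. searched T A 0 m) (For 11 (V 5) decode_level) (\<lambda>_ m. searched T A l m)"
      by (rule triple_conseq[OF loop]) auto
  qed
qed

end

section \<open>Computing the density of the decoded graph\<close>

definition init_loads :: com where
  "init_loads = For 13 (V 18)
    (15 [:=] Reg (arr 3 (V 13)) [div] V 0 ;;
     Assign (arr 4 (V 13)) (V 9) ;;
     Assign (arr 5 (V 15)) (Reg (arr 5 (V 15)) [+] V 9))"

text \<open>The guards encode comparisons as truncated subtractions and conjunctions as
  products.\<close>

definition balance_step :: com where
  "balance_step =
    15 [:=] Reg (arr 3 (V 13)) [div] V 0 ;;
    16 [:=] Reg (arr 3 (V 13)) [mod] V 0 ;;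
    If (Reg (arr 4 (V 13)) [*] (Reg (arr 5 (V 15)) [-] (Reg (arr 5 (V 16)) [+] Const 1)))
      (Assign (arr 4 (V 13)) (Reg (arr 4 (V 13)) [-] Const 1) ;;
       Assign (arr 5 (V 15)) (Reg (arr 5 (V 15)) [-] Const 1) ;;
       Assign (arr 5 (V 16)) (Reg (arr 5 (V 16)) [+] Const 1))
      (If ((V 9 [-] Reg (arr 4 (V 13))) [*] (Reg (arr 5 (V 16)) [-] (Reg (arr 5 (V 15)) [+] Const 1)))
        (Assign (arr 4 (V 13)) (Reg (arr 4 (V 13)) [+] Const 1) ;;
         Assign (arr 5 (V 15)) (Reg (arr 5 (V 15)) [+] Const 1) ;;
         Assign (arr 5 (V 16)) (Reg (arr 5 (V 16)) [-] Const 1))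
        Skip)"

text \<open>The number of sweeps is the bound (N n^2)^2 = n^12 = N^3 on the initial
  potential.\<close>

definition balance_all :: com where
  "balance_all = For 14 (V 9 [*] V 9 [*] V 9) (For 13 (V 18) balance_step)"

definition max_load :: com where
  "max_load = 17 [:=] Const 0 ;;
    For 13 (V 0) (If (Reg (arr 5 (V 13)) [-] V 17) (17 [:=] Reg (arr 5 (V 13))) Skip)"

text \<open>Denominators 1 to \<open>n\<close> are tested. By \<open>rounding\<close> every accepted
  fraction has the same value, so later hits may overwrite earlier ones. The numerator is rescaled
  by the power of two in register 12.\<close>

definition find_fraction :: com where
  "find_fraction = For 13 (V 0)
    (14 [:=] V 13 [+] Const 1 ;;
     20 [:=] V 17 [*] V 14 [div] V 9 ;;
     If (V 17 [*] V 14 [-] (V 20 [*] V 9 [+] V 0 [*] V 14)) Skip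
       (21 [:=] V 20 [*] V 12 ;; 22 [:=] V 14))"

text \<open>The output 0/1 in the last branch belongs to the failure event in which no level could
  be decoded.\<close>

definition post_program :: com where
  "post_program = search ;;
    If (V 19)
      (init_loads ;; balance_all ;; max_load ;; find_fraction ;; 0 [:=] V 21 ;; 1 [:=] V 22)
      (0 [:=] Const 0 ;; 1 [:=] Const 1)"

definition (in sketch) post_time where
  "post_time = Suc l * (Suc (R * K) * Suc (R * K)) + Suc (N * N * N) * Suc (n\<^sup>2) + Suc n"

text \<open>\<open>p\<close> stands for the factor \<open>2 ^ j\<close> that scales the density of
  the sampled graph back.\<close>

locale decoded_graph = sketch +
  fixes ids :: "nat list" and p :: nat
  assumes ids_edge: "\<And>k. k < length ids \<Longrightarrow> ids ! k div n \<noteq> ids ! k mod n \<and> ids ! k div n < n"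
    and ids_small: "length ids \<le> n\<^sup>2" "length ids \<le> R * K"
    and p: "p \<le> 2 ^ l"
begin

definition s where "s k = ids ! k div n"
definition t where "t k = ids ! k mod n"
abbreviation I where "I \<equiv> {..<length ids}"
abbreviation L where "L \<equiv> load I s t N"

sublocale edge_family I s t n
  using n1 ids_edge by unfold_locales (auto simp: s_def t_def)

definition frame :: "memory \<Rightarrow> bool" where
  "frame m \<longleftrightarrow> m 0 = n \<and> m 9 = N \<and> m 12 = p \<and> list_at ids m"

lemma frame_upd [simp]:
  "x \<in> {11, 13, 14, 15, 16, 17, 19, 20, 21, 22} \<Longrightarrow> frame (m(x := y)) = frame m"
  by (elim insertE emptyE; simp add: frame_def)

lemma frame_upd_arr [simp]: "k \<in> {4, 5} \<Longrightarrow> frame (m(addr k i := y)) = frame m"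
  by (elim insertE emptyE; simp add: frame_def list_at_def)

lemma frameD:
  "frame m \<Longrightarrow> m 0 = n" "frame m \<Longrightarrow> m 9 = N" "frame m \<Longrightarrow> m 12 = p" "frame m \<Longrightarrow> m 18 = length ids"
  "frame m \<Longrightarrow> k < length ids \<Longrightarrow> m (addr 3 k) = ids ! k"
  by (simp_all add: frame_def list_at_def)

definition loads_are :: "(nat \<Rightarrow> nat) \<Rightarrow> memory \<Rightarrow> bool" where
  "loads_are f m \<longleftrightarrow> (\<forall>v<n. m (addr 5 v) = f v)"

lemma loads_are_upd [simp]:
  "x < 32 \<Longrightarrow> loads_are f (m(x := y)) = loads_are f m" "loads_are f (m(addr 4 i := y)) = loads_are f m"
  by (simp_all add: loads_are_def)

lemma loads_are_set: "loads_are f m \<Longrightarrow> loads_are (f(v := y)) (m(addr 5 v := y))"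
  by (simp add: loads_are_def)

definition orient_is :: "nat \<Rightarrow> (nat \<Rightarrow> nat) \<Rightarrow> memory \<Rightarrow> bool" where
  "orient_is i X m \<longleftrightarrow> (\<forall>k<i. m (addr 4 k) = X k)"

lemma orient_is_upd [simp]:
  "x < 32 \<Longrightarrow> orient_is i X (m(x := y)) = orient_is i X m" "orient_is i X (m(addr 5 k := y)) = orient_is i X m"
  by (simp_all add: orient_is_def)

lemma orient_is_set: "orient_is i X m \<Longrightarrow> orient_is i (X(k := y)) (m(addr 4 k := y))"
  by (simp add: orient_is_def)

lemma addr_edge:
  assumes "k < length ids"
  shows "addr 4 k < D"
proof (rule addr_less)
  show "k \<le> l * (R * K) + cells" using assms ids_small(2) RK_le_index by linarith
qed simp

lemma addr_vertex: "v < n \<Longrightarrow> addr 5 v < D"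
  using n_le_cells by (intro addr_less) auto

lemma small_less_W: "x \<le> n \<Longrightarrow> x < W"
  by (rule less_W_pow[of _ 1 1]) auto

lemma len_less_W: "length ids < W"
  by (rule less_W_pow[of _ 1 2]) (use ids_small in auto)

lemma load_bound: "c * N \<le> n\<^sup>2 * N \<Longrightarrow> c * N < W"
  by (rule less_W_pow[of _ 1 6]) (auto simp: N_def simp flip: power_add)

lemma load_le_n6: "(\<And>i. i \<in> I \<Longrightarrow> X i \<le> N) \<Longrightarrow> v < n \<Longrightarrow> L X v \<le> n ^ 6"
proof -
  assume "\<And>i. i \<in> I \<Longrightarrow> X i \<le> N" "v < n"
  then have "L X v \<le> N * card I" by (rule load_le)
  also have "\<dots> \<le> N * n\<^sup>2" using ids_small by simp
  finally show ?thesis by (simp add: N_def flip: power_add)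
qed

lemma triple_init_loads:
  "triple (Suc (n\<^sup>2)) (\<lambda>_ m. frame m \<and> loads_are (\<lambda>_. 0) m) init_loads
    (\<lambda>_ m. frame m \<and> orient_is (length ids) (\<lambda>_. N) m \<and> loads_are (L (\<lambda>_. N)) m)"
proof -
  define f where "f i v = (\<Sum>k<i. if s k = v then N else 0)" for i v
  let ?I = "\<lambda>i _ m. frame m \<and> orient_is i (\<lambda>_. N) m \<and> loads_are (f i) m"
  have loop: "triple (Suc (length ids) * 1) (\<lambda>xs m. ?I 0 xs (m(13 := 0))) init_loads (\<lambda>xs m. m 13 = length ids \<and> ?I (length ids) xs m)"
    unfolding init_loads_def
  proof (rule triple_For[OF order_refl _ len_less_W])
    show "13 < D" by (rule scalar_less) simp
    fix i assume i: "i < length ids"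
    have sn: "s i < n" using edge[of i] i by simp
    show "triple 1 (\<lambda>xs m. m 13 = i \<and> ?I i xs m)
      (15 [:=] Reg (arr 3 (V 13)) [div] V 0 ;; Assign (arr 4 (V 13)) (V 9) ;;
       Assign (arr 5 (V 15)) (Reg (arr 5 (V 15)) [+] V 9))
      (\<lambda>xs m. m 13 = i \<and> ?I (Suc i) xs (m(13 := Suc i)))"
    proof (rule triple_wp)
      fix xs :: "bool list" and m assume m: "m 13 = i \<and> ?I i xs m"
      have v: "m (addr 5 (s i)) = f i (s i)" using m sn by (simp add: loads_are_def)
      have "f i (s i) + N \<le> Suc i * N"
        unfolding f_def using sum_mono[of "{..<i}" "\<lambda>k. if s k = s i then N else 0" "\<lambda>_. N"] by simp
      moreover have "Suc i * N \<le> n\<^sup>2 * N" using i ids_small by (intro mult_right_mono) auto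
      ultimately have lW: "f i (s i) + N < W" using load_bound[of "Suc i"] by linarith
      have fS: "f (Suc i) = (f i)(s i := f i (s i) + N)" by (auto simp: f_def)
      have "loads_are (f (Suc i)) (m(15 := s i, addr 4 i := N, addr 5 (s i) := f i (s i) + N, 13 := Suc i))"
        unfolding fS using m loads_are_set[of "f i" "m(15 := s i, addr 4 i := N)" "s i"] by simp
      moreover have "orient_is (Suc i) (\<lambda>_. N) (m(15 := s i, addr 4 i := N, addr 5 (s i) := f i (s i) + N, 13 := Suc i))"
        using m by (simp add: orient_is_def less_Suc_eq)
      ultimately show "wp (15 [:=] Reg (arr 3 (V 13)) [div] V 0 ;; Assign (arr 4 (V 13)) (V 9) ;;
       Assign (arr 5 (V 15)) (Reg (arr 5 (V 15)) [+] V 9)) (\<lambda>xs m. m 13 = i \<and> ?I (Suc i) xs (m(13 := Suc i))) xs m"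
        using m i sn lW v addr_edge[OF i] addr_vertex[OF sn] N_less_W small_less_W[of "s i"] scalar_less[of 15]
        by (simp add: frameD s_def[symmetric])
    qed simp
  qed (auto simp: frameD)
  have "f (length ids) v = L (\<lambda>_. N) v" for v
    unfolding f_def load_def by (rule sum.cong) auto
  then have fL: "f (length ids) = L (\<lambda>_. N)" by blast
  have f0: "f 0 = (\<lambda>_. 0)" by (rule ext) (simp add: f_def)
  show ?thesis
    by (rule triple_conseq[OF loop]) (use ids_small fL f0 in \<open>auto simp: orient_is_def\<close>)
qed

definition oriented :: "(nat \<Rightarrow> nat) \<Rightarrow> memory \<Rightarrow> bool" where
  "oriented X m \<longleftrightarrow> frame m \<and> orient_is (length ids) X m \<and> loads_are (L X) m \<and> (\<forall>k\<in>I. X k \<le> N)"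

lemma oriented_upd [simp]:
  "x \<in> {11, 13, 14, 15, 16, 17, 19, 20, 21, 22} \<Longrightarrow> oriented X (m(x := y)) = oriented X m"
  by (elim insertE emptyE; simp add: oriented_def)

lemma triple_balance_step:
  assumes i: "i < length ids"
  shows "triple 1 (\<lambda>_ m. m 13 = i \<and> m 14 = j \<and> oriented X m) balance_step
    (\<lambda>_ m. m 13 = i \<and> m 14 = j \<and> oriented (balance I s t N i X) m)"
proof (rule triple_wp)
  fix xs :: "bool list" and m assume m: "m 13 = i \<and> m 14 = j \<and> oriented X m"
  have iI: "i \<in> I" using i by simp
  have e: "s i < n" "t i < n" "s i \<noteq> t i" using edge[OF iI] by auto
  have X: "\<And>k. k \<in> I \<Longrightarrow> X k \<le> N" using m by (simp add: oriented_def)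
  have c: "frame m" using m by (simp add: oriented_def)
  have lx: "m (addr 5 (s i)) = L X (s i)" "m (addr 5 (t i)) = L X (t i)"
    using m e by (simp_all add: oriented_def loads_are_def)
  have x: "m (addr 4 i) = X i" using m i by (simp add: oriented_def orient_is_def)
  have n6: "n ^ 6 + 1 < W"
  proof (rule less_W_pow[of _ 2 6])
    show "n ^ 6 + 1 \<le> 2 * n ^ 6" using pow_le[of 0 6] by simp
  qed auto
  have lW: "Suc (L X (s i)) < W" "Suc (L X (t i)) < W"
    using load_le_n6[of X "s i", OF X] load_le_n6[of X "t i", OF X] e n6 by auto
  have XW: "X i < W" "Suc (X i) < W"
  proof -
    have "N + 1 < W"
    proof (rule less_W_pow[of _ 2 4])
      show "N + 1 \<le> 2 * n ^ 4" using pow_le[of 0 4] by (simp add: N_def)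
    qed auto
    then show "X i < W" "Suc (X i) < W" using X[OF iI] by auto
  qed
  have dW: "X i - 1 < W" "L X (s i) - 1 < W" "L X (t i) - 1 < W" using XW lW by linarith+
  let ?m = "m(15 := s i, 16 := t i)"
  have bX: "balance I s t N i X k \<le> N" if "k \<in> I" for k
    by (rule balance_le[OF X that])
  let ?Q = "\<lambda>_ m. m 13 = i \<and> m 14 = j \<and> oriented (balance I s t N i X) m"
  note sl = scalar_less[of 15] scalar_less[of 16] small_less_W[of "s i"] small_less_W[of "t i"]
    addr_edge[OF i] addr_vertex[OF e(1)] addr_vertex[OF e(2)]
  consider (dec) "X i > 0" "L X (s i) > L X (t i) + 1"
    | (inc) "\<not> (X i > 0 \<and> L X (s i) > L X (t i) + 1)" "X i < N" "L X (t i) > L X (s i) + 1"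
    | (none) "\<not> (X i > 0 \<and> L X (s i) > L X (t i) + 1)" "\<not> (X i < N \<and> L X (t i) > L X (s i) + 1)"
    by (cases "X i > 0 \<and> L X (s i) > L X (t i) + 1"; cases "X i < N \<and> L X (t i) > L X (s i) + 1") simp_all
  then show "wp balance_step ?Q xs m"
  proof cases
    case dec
    have b: "balance I s t N i X = X(i := X i - 1)" using dec by (simp add: balance_def)
    have Lb: "L (X(i := X i - 1)) = (L X)(s i := L X (s i) - 1, t i := L X (t i) + 1)"
      by (rule load_dec[of i X N, OF iI dec(1) X[OF iI]])
    let ?m' = "?m(addr 4 i := X i - 1, addr 5 (s i) := L X (s i) - 1, addr 5 (t i) := L X (t i) + 1)"
    have "loads_are (L (X(i := X i - 1))) ?m'"
      unfolding Lb using m by (intro loads_are_set) (simp add: oriented_def)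
    moreover have "orient_is (length ids) (X(i := X i - 1)) ?m'"
      using m orient_is_set[of "length ids" X ?m i] by (simp add: oriented_def)
    ultimately have "oriented (balance I s t N i X) ?m'"
      using bX c unfolding b by (simp add: oriented_def)
    then show ?thesis
      using m i e dec lW XW dW sl
      by (simp add: balance_step_def frameD[OF c] s_def[symmetric] t_def[symmetric] lx x)
  next
    case inc
    have b: "balance I s t N i X = X(i := X i + 1)" using inc by (auto simp: balance_def)
    have Lb: "L (X(i := X i + 1)) = (L X)(s i := L X (s i) + 1, t i := L X (t i) - 1)"
      by (rule load_inc[of i X N, OF iI inc(2)])
    let ?m' = "?m(addr 4 i := X i + 1, addr 5 (s i) := L X (s i) + 1, addr 5 (t i) := L X (t i) - 1)"
    have "loads_are (L (X(i := X i + 1))) ?m'"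
      unfolding Lb using m by (intro loads_are_set) (simp add: oriented_def)
    moreover have "orient_is (length ids) (X(i := X i + 1)) ?m'"
      using m orient_is_set[of "length ids" X ?m i] by (simp add: oriented_def)
    ultimately have "oriented (balance I s t N i X) ?m'"
      using bX c unfolding b by (simp add: oriented_def)
    then show ?thesis
      using m i e inc lW XW dW sl
      by (auto simp: balance_step_def frameD[OF c] s_def[symmetric] t_def[symmetric] lx x)
  next
    case none
    have b: "balance I s t N i X = X" using none by (auto simp: balance_def)
    then show ?thesis
      using m i e none lW XW dW sl
      by (auto simp: balance_step_def frameD[OF c] s_def[symmetric] t_def[symmetric] lx x)
  qed
qed simp

abbreviation sweep where "sweep \<equiv> fold (balance I s t N) [0..<length ids]"

lemma triple_sweep:
  "triple (Suc (n\<^sup>2)) (\<lambda>_ m. m 14 = j \<and> oriented X m) (For 13 (V 18) balance_step)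
    (\<lambda>_ m. m 14 = j \<and> oriented (sweep X) m)"
proof -
  let ?I = "\<lambda>i _ m. m 14 = j \<and> oriented (fold (balance I s t N) [0..<i] X) m"
  have loop: "triple (Suc (length ids) * 1) (\<lambda>xs m. ?I 0 xs (m(13 := 0))) (For 13 (V 18) balance_step)
    (\<lambda>xs m. m 13 = length ids \<and> ?I (length ids) xs m)"
  proof (rule triple_For[OF order_refl _ len_less_W])
    show "13 < D" by (rule scalar_less) simp
    fix i assume i: "i < length ids"
    show "triple 1 (\<lambda>xs m. m 13 = i \<and> ?I i xs m) balance_step (\<lambda>xs m. m 13 = i \<and> ?I (Suc i) xs (m(13 := Suc i)))"
      by (rule triple_conseq[OF triple_balance_step[OF i]]) auto
  qed (auto simp: oriented_def frameD)
  show ?thesis by (rule triple_conseq[OF loop]) (use ids_small in auto)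
qed

lemma N3_less_W: "N * N * N < W"
  by (rule less_W_pow[of _ 1 12]) (auto simp: N_def simp flip: power_add)

lemma triple_balance_all:
  "triple (Suc (N * N * N) * Suc (n\<^sup>2)) (\<lambda>_ m. oriented X m) balance_all
    (\<lambda>_ m. oriented ((sweep ^^ (N * N * N)) X) m)"
proof -
  let ?I = "\<lambda>j _ m. oriented ((sweep ^^ j) X) m"
  have loop: "triple (Suc (N * N * N) * Suc (n\<^sup>2)) (\<lambda>xs m. ?I 0 xs (m(14 := 0))) balance_all
    (\<lambda>xs m. m 14 = N * N * N \<and> ?I (N * N * N) xs m)"
    unfolding balance_all_def
  proof (rule triple_For[OF _ _ N3_less_W])
    show "14 < D" by (rule scalar_less) simp
    show "triple (Suc (n\<^sup>2)) (\<lambda>xs m. m 14 = j \<and> ?I j xs m) (For 13 (V 18) balance_step)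
      (\<lambda>xs m. m 14 = j \<and> ?I (Suc j) xs (m(14 := Suc j)))" for j
      by (rule triple_conseq[OF triple_sweep]) auto
  qed (auto simp: oriented_def frameD)
  show ?thesis by (rule triple_conseq[OF loop]) auto
qed

lemma stable_balanced: "stable I s t N ((sweep ^^ (N * N * N)) (\<lambda>_. N))"
proof (rule iterate_balance_stable)
  show "set [0..<length ids] = I" by auto
  have "potential N (\<lambda>_. N) \<le> (N * card I)\<^sup>2" by (rule potential_le) simp
  also have "\<dots> \<le> (N * n\<^sup>2)\<^sup>2" using ids_small by (intro power_mono) auto
  also have "\<dots> = N * N * N" by (simp add: N_def power_mult_distrib flip: power_mult power_add)
  finally show "potential N (\<lambda>_. N) \<le> N * N * N" .
qed simp

lemma triple_max_load:
  "triple (Suc n) (\<lambda>_ m. oriented X m) max_load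
    (\<lambda>_ m. oriented X m \<and> m 17 = Max (L X ` {..<n}))"
  unfolding max_load_def
proof (rule triple_Seq)
  let ?I = "\<lambda>i _ m. oriented X m \<and> (\<forall>v<i. L X v \<le> m 17) \<and> (m 17 = 0 \<or> (\<exists>v<n. m 17 = L X v))"
  show "triple (Suc n) (\<lambda>_ m. oriented X m) (17 [:=] Const 0) (\<lambda>xs m. oriented X m \<and> m 17 = 0)"
    by (rule triple_wp) (use W scalar_less[of 17] in auto)
  have nW: "n < W" by (rule small_less_W) simp
  have loop: "triple (Suc n * 1) (\<lambda>xs m. ?I 0 xs (m(13 := 0)))
    (For 13 (V 0) (If (Reg (arr 5 (V 13)) [-] V 17) (17 [:=] Reg (arr 5 (V 13))) Skip))
    (\<lambda>xs m. m 13 = n \<and> ?I n xs m)"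
  proof (rule triple_For[OF order_refl _ nW])
    show "13 < D" by (rule scalar_less) simp
    fix i assume i: "i < n"
    show "triple 1 (\<lambda>xs m. m 13 = i \<and> ?I i xs m) (If (Reg (arr 5 (V 13)) [-] V 17) (17 [:=] Reg (arr 5 (V 13))) Skip)
      (\<lambda>xs m. m 13 = i \<and> ?I (Suc i) xs (m(13 := Suc i)))"
    proof (rule triple_wp)
      fix xs :: "bool list" and m assume okm: "ok m" and m: "m 13 = i \<and> ?I i xs m"
      have v: "m (addr 5 i) = L X i" using m i by (simp add: oriented_def loads_are_def)
      have "m (addr 5 i) < W" using okm by (simp add: ok_def)
      then show "wp (If (Reg (arr 5 (V 13)) [-] V 17) (17 [:=] Reg (arr 5 (V 13))) Skip)
        (\<lambda>xs m. m 13 = i \<and> ?I (Suc i) xs (m(13 := Suc i))) xs m"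
        using m v i scalar_less[of 17] by (force simp: less_Suc_eq)
    qed simp
  qed (auto simp: oriented_def frameD)
  have max: "m 17 = Max (L X ` {..<n})" if "\<forall>v<n. L X v \<le> m 17" "m 17 = 0 \<or> (\<exists>v<n. m 17 = L X v)" for m :: memory
  proof (rule Max_eqI[symmetric])
    have "L X 0 \<le> m 17" using that(1) n1 by auto
    from that(2) show "m 17 \<in> L X ` {..<n}"
    proof
      assume "m 17 = 0"
      then have "m 17 = L X 0" using \<open>L X 0 \<le> m 17\<close> by simp
      then show ?thesis using n1 by auto
    qed auto
  qed (use that(1) in auto)
  show "triple (Suc n) (\<lambda>xs m. oriented X m \<and> m 17 = 0)
    (For 13 (V 0) (If (Reg (arr 5 (V 13)) [-] V 17) (17 [:=] Reg (arr 5 (V 13))) Skip))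
    (\<lambda>_ m. oriented X m \<and> m 17 = Max (L X ` {..<n}))"
    by (rule triple_conseq[OF loop]) (use max in auto)
qed

lemma triple_find_fraction:
  assumes X: "\<And>k. k \<in> I \<Longrightarrow> X k \<le> N" and st: "stable I s t N X"
  shows "triple (Suc n) (\<lambda>_ m. oriented X m \<and> m 17 = Max (L X ` {..<n})) find_fraction
    (\<lambda>_ m. m 22 \<noteq> 0 \<and> real (m 21) / real (m 22) = real p * max_dens n I s t)"
proof -
  define d where "d = max_dens n I s t"
  define Lm where "Lm = Max (L X ` {..<n})"
  obtain e k0 where k0: "1 \<le> k0" "k0 \<le> n" "d = real e / real k0"
    using max_dens_fraction unfolding d_def by blast
  define C where "C k \<longleftrightarrow> Lm * k \<le> Lm * k div N * N + n * k" for k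
  have st1: "real (Lm - n) \<le> real N * d" and st2: "real N * d \<le> real Lm"
    unfolding d_def by (rule stable_max_dens[OF X st N0 Lm_def]; assumption)+
  have C: "C k0 \<and> (\<forall>k. 1 \<le> k \<longrightarrow> k \<le> n \<longrightarrow> C k \<longrightarrow> real (Lm * k div N) / real k = d)"
  proof (cases "n = 1")
    case True
    then have "I = {}" using edge by fastforce
    then have L0: "L X v = 0" for v by (simp add: load_def)
    have "Lm \<in> L X ` {..<n}" unfolding Lm_def by (rule Max_in) (use True in auto)
    then have "Lm = 0" using L0 by auto
    moreover have "d = 0" using st2 N0 max_dens_nonneg[OF n1, of I s t] \<open>Lm = 0\<close> by (simp add: d_def mult_le_0_iff)
    ultimately show ?thesis by (simp add: C_def)
  next
    case False
    then have "n ^ 3 < N" using n1 unfolding N_def by (intro power_strict_increasing) auto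
    from rounding[OF this k0 st1 st2] show ?thesis by (auto simp: C_def)
  qed
  \<comment> \<open>The true denominator \<open>k0\<close> passes the test, so from pass
    \<open>k0\<close> on the registers hold a correct fraction; later overwriting keeps its
    value.\<close>
  let ?I = "\<lambda>i _ m. oriented X m \<and> m 17 = Lm \<and>
    (k0 \<le> i \<longrightarrow> m 22 \<noteq> 0 \<and> real (m 21) / real (m 22) = real p * d)"
  have nW: "n < W" by (rule small_less_W) simp
  have "Lm \<in> L X ` {..<n}" unfolding Lm_def by (rule Max_in) (use n1 in \<open>auto simp: lessThan_empty_iff\<close>)
  then have Lm: "Lm \<le> n ^ 6" using load_le_n6[OF X] by auto
  have loop: "triple (Suc n * 1) (\<lambda>xs m. ?I 0 xs (m(13 := 0))) find_fraction (\<lambda>xs m. m 13 = n \<and> ?I n xs m)"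
    unfolding find_fraction_def
  proof (rule triple_For[OF order_refl _ nW])
    show "13 < D" by (rule scalar_less) simp
    fix i assume i: "i < n"
    define a where "a = Lm * Suc i div N"
    have "a \<le> Lm * Suc i" unfolding a_def by (rule div_le_dividend)
    also have "\<dots> \<le> n ^ 6 * n" using Lm i by (intro mult_mono) auto
    finally have a7: "a \<le> n ^ 7" by (simp add: eval_nat_numeral)
    then have aW: "a < W" by (intro less_W_pow[of _ 1 7]) auto
    have "a * p \<le> n ^ 7 * (2 * n)" using a7 p l(2) by (intro mult_mono) auto
    also have "\<dots> = 2 * (n ^ 7 * n)" by simp
    also have "n ^ 7 * n = n ^ 8" by (simp add: eval_nat_numeral)
    finally have apW: "a * p < W" by (rule less_W_pow) auto
    have aC: "Lm * Suc i - (a * N + n * Suc i) = 0 \<longleftrightarrow> C (Suc i)" by (simp add: C_def a_def)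
    show "triple 1 (\<lambda>xs m. m 13 = i \<and> ?I i xs m)
      (14 [:=] V 13 [+] Const 1 ;; 20 [:=] V 17 [*] V 14 [div] V 9 ;;
       If (V 17 [*] V 14 [-] (V 20 [*] V 9 [+] V 0 [*] V 14)) Skip (21 [:=] V 20 [*] V 12 ;; 22 [:=] V 14))
      (\<lambda>xs m. m 13 = i \<and> ?I (Suc i) xs (m(13 := Suc i)))"
    proof (rule triple_wp)
      fix xs :: "bool list" and m assume m: "m 13 = i \<and> ?I i xs m"
      have c: "frame m" using m by (simp add: oriented_def)
      have guard: "eval_expr (V 17 [*] V 14 [-] (V 20 [*] V 9 [+] V 0 [*] V 14)) (m(14 := Suc i, 20 := a)) =
          Lm * Suc i - (a * N + n * Suc i)"
        using m by (simp add: frameD[OF c])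
      have ev: "eval_expr (V 17 [*] V 14 [div] V 9) (m(14 := Suc i)) = a"
        using m by (simp add: frameD[OF c] a_def)
      have ds: "14 < D" "20 < D" "21 < D" "22 < D" "Suc i < W"
        using i small_less_W[of "Suc i"] by (auto intro: scalar_less)
      show "wp (14 [:=] V 13 [+] Const 1 ;; 20 [:=] V 17 [*] V 14 [div] V 9 ;;
         If (V 17 [*] V 14 [-] (V 20 [*] V 9 [+] V 0 [*] V 14)) Skip (21 [:=] V 20 [*] V 12 ;; 22 [:=] V 14))
        (\<lambda>xs m. m 13 = i \<and> ?I (Suc i) xs (m(13 := Suc i))) xs m"
      proof (cases "C (Suc i)")
        case True
        have "1 \<le> Suc i" "Suc i \<le> n" using i by auto
        then have "real a / real (Suc i) = d" unfolding a_def using C True by blast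
        then have r: "real (a * p) / real (Suc i) = real p * d" by (simp add: field_simps)
        have "wp (If (V 17 [*] V 14 [-] (V 20 [*] V 9 [+] V 0 [*] V 14)) Skip (21 [:=] V 20 [*] V 12 ;; 22 [:=] V 14))
          (\<lambda>xs m. m 13 = i \<and> ?I (Suc i) xs (m(13 := Suc i))) xs (m(14 := Suc i, 20 := a))"
          unfolding wp.simps guard using True aC m ds apW r by (simp add: frameD[OF c])
        then show ?thesis using m ds aW ev by simp
      next
        case False
        then have "k0 \<le> Suc i \<longleftrightarrow> k0 \<le> i" using C by (metis le_Suc_eq)
        then have "wp (If (V 17 [*] V 14 [-] (V 20 [*] V 9 [+] V 0 [*] V 14)) Skip (21 [:=] V 20 [*] V 12 ;; 22 [:=] V 14))
          (\<lambda>xs m. m 13 = i \<and> ?I (Suc i) xs (m(13 := Suc i))) xs (m(14 := Suc i, 20 := a))"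
          unfolding wp.simps guard using False aC m by simp
        then show ?thesis using m ds aW ev by simp
      qed
    qed simp
  qed (auto simp: oriented_def frameD)
  show ?thesis
    by (rule triple_conseq[OF loop]) (use k0 in \<open>auto simp: Lm_def d_def\<close>)
qed

lemma triple_solve:
  "triple post_time (\<lambda>_ m. frame m \<and> loads_are (\<lambda>_. 0) m)
    (init_loads ;; balance_all ;; max_load ;; find_fraction ;; 0 [:=] V 21 ;; 1 [:=] V 22)
    (\<lambda>_ m. m 1 \<noteq> 0 \<and> real (m 0) / real (m 1) = real p * max_dens n I s t)"
proof -
  let ?X = "(sweep ^^ (N * N * N)) (\<lambda>_. N)"
  have le: "Suc (n\<^sup>2) \<le> post_time" "Suc (N * N * N) * Suc (n\<^sup>2) \<le> post_time" "Suc n \<le> post_time" "1 \<le> post_time"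
    by (auto simp: post_time_def)
  have X: "(sweep ^^ j) (\<lambda>_. N) k \<le> N" if "k \<in> I" for j k
    using that by (induction j arbitrary: k) (auto intro!: fold_balance_le)
  let ?Q = "\<lambda>_ m. m 1 \<noteq> 0 \<and> real (m 0) / real (m 1) = real p * max_dens n I s t"
  have 1: "triple post_time (\<lambda>_ m. frame m \<and> loads_are (\<lambda>_. 0) m) init_loads (\<lambda>_. oriented (\<lambda>_. N))"
    by (rule triple_conseq[OF triple_init_loads _ le(1)]) (auto simp: oriented_def)
  have 2: "triple post_time (\<lambda>_. oriented (\<lambda>_. N)) balance_all (\<lambda>_. oriented ?X)"
    by (rule triple_conseq[OF triple_balance_all _ le(2)]) auto
  have 3: "triple post_time (\<lambda>_. oriented ?X) max_load (\<lambda>_ m. oriented ?X m \<and> m 17 = Max (L ?X ` {..<n}))"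
    by (rule triple_conseq[OF triple_max_load _ le(3)]) auto
  have 4: "triple post_time (\<lambda>_ m. oriented ?X m \<and> m 17 = Max (L ?X ` {..<n})) find_fraction
    (\<lambda>_ m. m 22 \<noteq> 0 \<and> real (m 21) / real (m 22) = real p * max_dens n I s t)"
    by (rule triple_conseq[OF triple_find_fraction[OF X stable_balanced] _ le(3)]) auto
  have 5: "triple post_time (\<lambda>_ m. m 22 \<noteq> 0 \<and> real (m 21) / real (m 22) = real p * max_dens n I s t)
    (0 [:=] V 21 ;; 1 [:=] V 22) ?Q"
    by (rule triple_wp[OF le(4)]) (use scalar_less[of 0] scalar_less[of 1] in \<open>auto simp: ok_def\<close>)
  show ?thesis
    by (rule triple_Seq[OF 1 triple_Seq[OF 2 triple_Seq[OF 3 triple_Seq[OF 4 5]]]])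
qed

end

section \<open>Initialization\<close>

definition build_table :: com where
  "build_table = For 11 (V 18)
    (For 13 (V 16)
      (Flip (Const 14) ;;
       Assign (arr 0 (V 11)) (Const 2 [*] Reg (arr 0 (V 11)) [+] V 14)))"

text \<open>Both doubling loops make a number of passes known in advance, \<open>n\<close> and
  \<open>target\<close>, and idle once the power is large enough. Initialization is not charged for
  time.\<close>

definition set_sizes :: com where
  "set_sizes =
    12 [:=] Const 1 ;;
    5 [:=] Const 0 ;;
    For 11 (V 0) (If (V 0 [+] Const 1 [-] V 12) (12 [:=] Const 2 [*] V 12 ;; 5 [:=] V 5 [+] Const 1) Skip) ;;
    17 [:=] Const 1440 [*] V 0 [*] V 1 [*] V 1 [*] V 5 ;;
    7 [:=] Const 1 ;;
    16 [:=] Const 0 ;;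
    For 11 (V 17) (If (V 17 [+] Const 1 [-] V 7) (7 [:=] Const 2 [*] V 7 ;; 16 [:=] V 16 [+] Const 1) Skip)"

definition set_constants :: com where
  "set_constants =
    6 [:=] Const 5 [*] V 5 ;;
    8 [:=] V 6 [*] V 7 ;;
    9 [:=] V 0 [*] V 0 [*] V 0 [*] V 0 ;;
    10 [:=] Const 2 [*] V 9 [*] V 0 [*] V 0 ;;
    18 [:=] (Const 2 [*] V 6 [+] Const 1) [*] V 0"

text \<open>Capping the accuracy at \<open>n\<close> keeps all numbers polynomial in
  \<open>n\<close>, however small \<epsilon> is.\<close>

definition init_program :: com where
  "init_program =
    If (V 1 [-] V 0) (1 [:=] V 0) Skip ;;
    set_sizes ;; set_constants ;; build_table"

context sketch
begin

text \<open>Speaks only about the first decodable level and promises nothing if there is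
  none.\<close>

definition result :: "(nat \<Rightarrow> nat) \<Rightarrow> (nat \<times> nat) set \<Rightarrow> memory \<Rightarrow> bool" where
  "result T A m \<longleftrightarrow> (\<forall>j<l. decodable n K R T (same_class j T A) \<longrightarrow>
     (\<forall>j'<j. \<not> decodable n K R T (same_class j' T A)) \<longrightarrow>
     m 1 \<noteq> 0 \<and> real (m 0) / real (m 1) = 2 ^ j * max_dens n (same_class j T A) fst snd)"

lemma triple_solve_decoded:
  assumes A: "A \<subseteq> pairs n" and j: "j < l" and dec: "decodable n K R T (same_class j T A)"
  shows "triple post_time (\<lambda>_ m. env T m \<and> m 12 = 2 ^ j \<and> decoded T A j (R * K) ids m)
    (init_loads ;; balance_all ;; max_load ;; find_fraction ;; 0 [:=] V 21 ;; 1 [:=] V 22)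
    (\<lambda>_ m. m 1 \<noteq> 0 \<and> real (m 0) / real (m 1) = 2 ^ j * max_dens n (same_class j T A) fst snd)"
proof (cases "distinct ids \<and> set ids = pair_id ` found T A j (R * K) \<and> length ids \<le> R * K")
  case False
  then show ?thesis by (intro triple_vacuous) (auto simp: decoded_def)
next
  case True
  let ?S = "same_class j T A"
  have S: "?S \<subseteq> pairs n" using A same_class_subset by blast
  have F: "found T A j (R * K) = ?S" using dec decodable_iff_found found_subset by blast
  have set_ids: "set ids = pair_id ` ?S" using True F by simp
  have ex: "\<exists>e\<in>?S. ids ! k = pair_id e" if "k < length ids" for k
    using nth_mem[OF that] unfolding set_ids by blast
  have "length ids = card (set ids)" using True by (metis distinct_card)
  also have "\<dots> \<le> card ?S" unfolding set_ids by (rule card_image_le[OF finite_sub_pairs[OF S]])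
  also have "\<dots> \<le> n\<^sup>2" by (rule card_pairs[OF S])
  finally have len: "length ids \<le> n\<^sup>2" .
  interpret decoded_graph W D n q l w ids "2 ^ j"
  proof
    fix k assume "k < length ids"
    then obtain e where e: "e \<in> ?S" "ids ! k = pair_id e" using ex by blast
    then have "e \<in> pairs n" using S by blast
    then show "ids ! k div n \<noteq> ids ! k mod n \<and> ids ! k div n < n"
      using pair_id_div_mod[of e] e(2) by (auto simp: pairs_def)
  next
    show "length ids \<le> n\<^sup>2" by (rule len)
    show "length ids \<le> R * K" using True by blast
    show "(2 :: nat) ^ j \<le> 2 ^ l" using j by (intro power_increasing) auto
  qed
  have "bij_betw (\<lambda>k. ids ! k) I (pair_id ` ?S)"
    using True set_ids bij_betw_nth[of ids I "set ids"] by auto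
  moreover have "bij_betw (\<lambda>x. (x div n, x mod n)) (pair_id ` ?S) ?S"
    by (rule bij_betw_byWitness[where f' = pair_id]) (use S pair_id_div_mod in auto)
  ultimately have bij: "bij_betw ((\<lambda>x. (x div n, x mod n)) \<circ> (\<lambda>k. ids ! k)) I ?S"
    by (rule bij_betw_trans)
  have "max_dens n I s t = max_dens n ?S fst snd"
    by (rule max_dens_cong[OF bij]) (simp add: s_def t_def)
  then show ?thesis
    by (intro triple_conseq[OF triple_solve]) (auto simp: frame_def loads_are_def env_def decoded_def)
qed

lemma triple_post_program:
  assumes A: "A \<subseteq> pairs n"
  shows "triple post_time (\<lambda>_ m. env T m \<and> sketches T (indicator_int A) m) post_program (\<lambda>_. result T A)"
  unfolding post_program_def
proof (rule triple_Seq)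
  show "triple post_time (\<lambda>_ m. env T m \<and> sketches T (indicator_int A) m) search (\<lambda>_ m. searched T A l m)"
    by (rule triple_conseq[OF triple_search[OF A]]) (auto simp: post_time_def)
  have pt: "1 \<le> post_time" by (simp add: post_time_def)
  let ?P = "\<lambda>_ m. searched T A l m"
  let ?c = "init_loads ;; balance_all ;; max_load ;; find_fraction ;; 0 [:=] V 21 ;; 1 [:=] V 22"
  show "triple post_time ?P (If (V 19) ?c (0 [:=] Const 0 ;; 1 [:=] Const 1)) (\<lambda>_. result T A)"
  proof (rule triple_If[OF pt])
    let ?E = "\<lambda>(j, ids) m. j < l \<and> decodable n K R T (same_class j T A) \<and>
      (\<forall>j'<j. \<not> decodable n K R T (same_class j' T A)) \<and>
      env T m \<and> m 12 = 2 ^ j \<and> decoded T A j (R * K) ids m"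
    have "triple post_time (\<lambda>_ m. ?E (j, ids) m) ?c (\<lambda>_. result T A)" for j ids
    proof (cases "j < l \<and> decodable n K R T (same_class j T A) \<and> (\<forall>j'<j. \<not> decodable n K R T (same_class j' T A))")
      case True
      have uniq: "j' = j" if "decodable n K R T (same_class j' T A)"
        "\<forall>j''<j'. \<not> decodable n K R T (same_class j'' T A)" for j'
        using True that by (meson nat_neq_iff)
      have res: "result T A m"
        if "m 1 \<noteq> 0 \<and> real (m 0) / real (m 1) = 2 ^ j * max_dens n (same_class j T A) fst snd" for m
        unfolding result_def using that uniq by blast
      show ?thesis
        by (rule triple_conseq[OF triple_solve_decoded[OF A, of j T ids]]) (use True res in simp_all)
    qed (auto intro: triple_vacuous)
    then have "triple post_time (\<lambda>_ m. ?E x m) ?c (\<lambda>_. result T A)" for x by (cases x) simp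
    then have "triple post_time (\<lambda>_ m. \<exists>x. ?E x m) ?c (\<lambda>_. result T A)" by (rule triple_Ex)
    then show "triple post_time (\<lambda>xs m. ?P xs m \<and> eval_expr (V 19) m \<noteq> 0) ?c (\<lambda>_. result T A)"
      by (rule triple_conseq) (auto simp: searched_def)
    show "triple post_time (\<lambda>xs m. ?P xs m \<and> eval_expr (V 19) m = 0) (0 [:=] Const 0 ;; 1 [:=] Const 1) (\<lambda>_. result T A)"
      by (rule triple_wp[OF pt])
        (use W scalar_less[of 0] scalar_less[of 1] in \<open>auto simp: searched_def result_def\<close>)
  qed
qed

definition zeros :: "memory \<Rightarrow> bool" where
  "zeros m \<longleftrightarrow> (\<forall>k i. 0 < k \<longrightarrow> k < 8 \<longrightarrow> m (addr k i) = 0)"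

lemma zeros_upd [simp]: "x < 32 \<Longrightarrow> zeros (m(x := y)) = zeros m" "zeros (m(addr 0 i := y)) = zeros m"
  by (auto simp: zeros_def)

definition table_at :: "nat \<Rightarrow> nat \<Rightarrow> bool list \<Rightarrow> memory \<Rightarrow> bool" where
  "table_at i h xs m \<longleftrightarrow> length xs = i * w + h \<and> (\<forall>k<i. m (addr 0 k) = cell w xs k) \<and>
     m (addr 0 i) = val (drop (i * w) xs) \<and> (\<forall>k>i. m (addr 0 k) = 0)"

lemma table_at_upd [simp]: "x < 32 \<Longrightarrow> table_at i h xs (m(x := y)) = table_at i h xs m"
  by (simp add: table_at_def)

lemma table_at_flip:
  assumes "table_at i h xs m"
  shows "table_at i (Suc h) (xs @ [b]) (m(addr 0 i := 2 * m (addr 0 i) + of_bool b))"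
proof -
  have "cell w (xs @ [b]) k = cell w xs k" if "k < i" for k
  proof -
    have "Suc k * w \<le> i * w" using that by (intro mult_right_mono) auto
    then show ?thesis using assms by (simp add: cell_def table_at_def)
  qed
  then show ?thesis using assms by (auto simp: table_at_def)
qed

lemma table_at_next: "table_at i w xs m \<Longrightarrow> table_at (Suc i) 0 xs m"
  by (auto simp: table_at_def less_Suc_eq cell_def add.commute)

definition settings :: "memory \<Rightarrow> bool" where
  "settings m \<longleftrightarrow> m 0 = n \<and> m 5 = l \<and> m 6 = R \<and> m 7 = K \<and> m 8 = R * K \<and> m 9 = N \<and> m 10 = M \<and>
    m 16 = w \<and> m 18 = cells \<and> zeros m"

lemma settings_upd [simp]:
  "x \<in> {11, 13, 14} \<Longrightarrow> settings (m(x := y)) = settings m"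
  by (elim insertE emptyE; simp add: settings_def)

lemma settings_upd_arr [simp]: "settings (m(addr 0 i := y)) = settings m"
  by (simp add: settings_def)

lemma w_less_W: "w < W" and K_less_W: "K < W"
proof -
  show "K < W" by (rule less_W_pow[OF K_le]) auto
  have "w < 2 ^ w" by (rule less_exp)
  also have "\<dots> < W" using \<open>K < W\<close> by (simp add: K_def)
  finally show "w < W" .
qed

lemma cells_less_W: "cells < W" by (rule index_less_W) simp

lemma triple_build_table:
  "triple (Suc cells * Suc w) (\<lambda>xs m. settings m \<and> xs = [] \<and> (\<forall>k. m (addr 0 k) = 0)) build_table
    (\<lambda>xs m. settings m \<and> length xs = cells * w \<and> (\<forall>k<cells. m (addr 0 k) = cell w xs k))"
proof -
  let ?I = "\<lambda>i xs m. settings m \<and> table_at i 0 xs m"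
  have loop: "triple (Suc cells * Suc w) (\<lambda>xs m. ?I 0 xs (m(11 := 0))) build_table (\<lambda>xs m. m 11 = cells \<and> ?I cells xs m)"
    unfolding build_table_def
  proof (rule triple_For[OF _ _ cells_less_W])
    show "11 < D" by (rule scalar_less) simp
    fix i assume i: "i < cells"
    let ?J = "\<lambda>h xs m. m 11 = i \<and> settings m \<and> table_at i h xs m"
    let ?c = "Flip (Const 14) ;; Assign (arr 0 (V 11)) (Const 2 [*] Reg (arr 0 (V 11)) [+] V 14)"
    have inner: "triple (Suc w * 1) (\<lambda>xs m. ?J 0 xs (m(13 := 0))) (For 13 (V 16) ?c) (\<lambda>xs m. m 13 = w \<and> ?J w xs m)"
    proof (rule triple_For[OF order_refl _ w_less_W])
      show "13 < D" by (rule scalar_less) simp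
      fix h assume h: "h < w"
      show "triple 1 (\<lambda>xs m. m 13 = h \<and> ?J h xs m) ?c (\<lambda>xs m. m 13 = h \<and> ?J (Suc h) xs (m(13 := Suc h)))"
      proof (rule triple_wp)
        fix xs m assume m: "m 13 = h \<and> ?J h xs m"
        have t: "table_at i (Suc h) (xs @ [b]) (m(14 := of_bool b, addr 0 i := 2 * m (addr 0 i) + of_bool b))" for b
          using m table_at_flip[of i h xs m b] by (subst fun_upd_twist) auto
        have "2 * m (addr 0 i) + of_bool b < W" for b
        proof -
          have "2 * m (addr 0 i) + of_bool b = val (drop (i * w) (xs @ [b]))"
            using m by (simp add: table_at_def)
          also have "\<dots> < 2 ^ length (drop (i * w) (xs @ [b]))" by (rule val_less)
          also have "\<dots> \<le> 2 ^ w" using m h by (intro power_increasing) (auto simp: table_at_def)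
          finally show ?thesis using K_less_W by (simp add: K_def)
        qed
        moreover have "addr 0 i < D" using i by (intro addr_less) auto
        ultimately show "wp ?c (\<lambda>xs m. m 13 = h \<and> ?J (Suc h) xs (m(13 := Suc h))) xs m"
          using m t scalar_less[of 14] by (simp del: of_bool_eq_1_iff)
      qed simp
    qed (auto simp: settings_def)
    show "triple (Suc w) (\<lambda>xs m. m 11 = i \<and> ?I i xs m) (For 13 (V 16) ?c)
      (\<lambda>xs m. m 11 = i \<and> ?I (Suc i) xs (m(11 := Suc i)))"
      by (rule triple_conseq[OF inner]) (simp, simp, simp add: table_at_next)
  qed (auto simp: settings_def)
  show ?thesis
    by (rule triple_conseq[OF loop]) (auto simp: table_at_def)
qed

lemma triple_doubling:
  assumes xy: "x < 32" "y < 32" "b < 32" "distinct [x, y, b, 11]"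
    and k: "c < 2 ^ k" "2 ^ k \<le> 2 * c" and W: "2 * c < W" "c < W"
    and P: "\<And>m z v. z \<in> {x, y, 11} \<Longrightarrow> P (m(z := v)) = P m" and b: "\<And>m. P m \<Longrightarrow> m b = c"
  shows "triple (Suc c) (\<lambda>_ m. P m \<and> m x = 1 \<and> m y = 0)
    (For 11 (V b) (If (V b [+] Const 1 [-] V x) (x [:=] Const 2 [*] V x ;; y [:=] V y [+] Const 1) Skip))
    (\<lambda>_ m. P m \<and> m x = 2 ^ k \<and> m y = k)"
proof -
  let ?I = "\<lambda>i _ m. P m \<and> m x = 2 ^ min i k \<and> m y = min i k"
  let ?c = "If (V b [+] Const 1 [-] V x) (x [:=] Const 2 [*] V x ;; y [:=] V y [+] Const 1) Skip"
  have "0 < k"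
  proof (rule ccontr)
    assume "\<not> 0 < k"
    then show False using k by simp
  qed
  then obtain k' where k': "k = Suc k'" by (cases k) auto
  have ck': "2 ^ k' \<le> c" using k(2) k' by simp
  \<comment> \<open>Since 2^(k-1) \<le> c, the \<open>c\<close> passes include the \<open>k\<close>
    doublings.\<close>
  have kc: "k \<le> c" using less_exp[of k'] ck' k' by linarith
  have loop: "triple (Suc c * 1) (\<lambda>xs m. ?I 0 xs (m(11 := 0))) (For 11 (V b) ?c) (\<lambda>xs m. m 11 = c \<and> ?I c xs m)"
  proof (rule triple_For[OF order_refl _ W(2)])
    show "11 < D" by (rule scalar_less) simp
    fix i assume i: "i < c"
    show "triple 1 (\<lambda>xs m. m 11 = i \<and> ?I i xs m) ?c (\<lambda>xs m. m 11 = i \<and> ?I (Suc i) xs (m(11 := Suc i)))"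
    proof (rule triple_wp)
      fix xs :: "bool list" and m assume m: "m 11 = i \<and> ?I i xs m"
      have mb: "m b = c" using m b by blast
      show "wp ?c (\<lambda>xs m. m 11 = i \<and> ?I (Suc i) xs (m(11 := Suc i))) xs m"
      proof (cases "i < k")
        case True
        then have "(2 :: nat) ^ i \<le> 2 ^ k'" unfolding k' by (intro power_increasing) auto
        then have "2 ^ i \<le> c" using ck' by (rule order_trans)
        moreover have "Suc i < W" using i W by simp
        ultimately show ?thesis using m mb True xy W P scalar_less by (simp add: min_def)
      next
        case False
        then show ?thesis using m mb k(1) xy W P by (simp add: min_def)
      qed
    qed simp
  qed (use b in auto)
  show ?thesis
    by (rule triple_conseq[OF loop]) (use kc P xy in \<open>auto simp: min_def\<close>)
qed

end

section \<open>Runs of the algorithm\<close>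

lemma edge_multiplicity_Nil [simp]: "edge_multiplicity [] e = 0"
  by (simp add: edge_multiplicity_def)

lemma edge_multiplicity_Cons: "edge_multiplicity (a # \<sigma>) e = multiplicity_change a e + edge_multiplicity \<sigma> e"
  by (simp add: edge_multiplicity_def)

lemma edge_multiplicity_append: "edge_multiplicity (\<sigma> @ \<rho>) e = edge_multiplicity \<sigma> e + edge_multiplicity \<rho> e"
  by (simp add: edge_multiplicity_def)

text \<open>Induction over prefixes: only a deletion lowers the multiplicity, and validity makes it
  positive at that moment. With the upper bound 1, final multiplicities are 0 or 1.\<close>

lemma edge_multiplicity_nonneg:
  assumes "valid_stream n \<sigma>"
  shows "0 \<le> edge_multiplicity \<sigma> e"
proof -
  have "i \<le> length \<sigma> \<Longrightarrow> 0 \<le> edge_multiplicity (take i \<sigma>) e" for i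
  proof (induction i)
    case (Suc i)
    then have i: "i < length \<sigma>" by simp
    have "edge_multiplicity (take (Suc i) \<sigma>) e = edge_multiplicity (take i \<sigma>) e + multiplicity_change (\<sigma> ! i) e"
      using i by (simp add: take_Suc_conv_app_nth edge_multiplicity_append edge_multiplicity_Cons)
    moreover have "0 < edge_multiplicity (take i \<sigma>) e" if "multiplicity_change (\<sigma> ! i) e < 0"
      using that assms i by (auto simp: multiplicity_change_def valid_stream_def split: if_splits)
    moreover have "- 1 \<le> multiplicity_change (\<sigma> ! i) e" by (simp add: multiplicity_change_def)
    ultimately show ?case using Suc by force
  qed simp
  from this[of "length \<sigma>"] show ?thesis by simp
qed

definition final_pairs :: "nat \<Rightarrow> update list \<Rightarrow> (nat \<times> nat) set" where
  "final_pairs n \<sigma> = {e \<in> pairs n. {fst e, snd e} \<in> final_edges \<sigma>}"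

lemma final_edges_obtain:
  assumes "valid_stream n \<sigma>" "e \<in> final_edges \<sigma>"
  obtains u v where "(u, v) \<in> pairs n" "e = {u, v}"
proof -
  have "\<exists>a\<in>set \<sigma>. {src a, tgt a} = e"
  proof (rule ccontr)
    assume *: "\<not> ?thesis"
    have "edge_multiplicity \<sigma> e = (\<Sum>a\<leftarrow>\<sigma>. 0)"
      unfolding edge_multiplicity_def using *
      by (intro arg_cong[where f = sum_list] map_cong) (auto simp: multiplicity_change_def)
    then show False using assms(2) by (simp add: final_edges_def)
  qed
  then obtain a where a: "a \<in> set \<sigma>" "{src a, tgt a} = e" by blast
  then have "src a < n" "tgt a < n" "src a \<noteq> tgt a" using assms(1) by (auto simp: valid_stream_def)
  then show ?thesis
    using that[of "min (src a) (tgt a)" "max (src a) (tgt a)"] a(2)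
    by (cases "src a < tgt a") (auto simp: pairs_def min_def max_def insert_commute)
qed

lemma max_density_final_edges:
  assumes "valid_stream n \<sigma>"
  shows "max_density n (final_edges \<sigma>) = max_dens n (final_pairs n \<sigma>) fst snd"
proof -
  have "density (final_edges \<sigma>) U = real (card (inner_edges (final_pairs n \<sigma>) fst snd U)) / real (card U)" for U
  proof -
    have "bij_betw (\<lambda>e. {fst e, snd e}) (inner_edges (final_pairs n \<sigma>) fst snd U) {e \<in> final_edges \<sigma>. e \<subseteq> U}"
      unfolding bij_betw_def
    proof
      show "inj_on (\<lambda>e. {fst e, snd e}) (inner_edges (final_pairs n \<sigma>) fst snd U)"
        by (rule inj_onI) (auto simp: inner_edges_def final_pairs_def pairs_def doubleton_eq_iff)
      show "(\<lambda>e. {fst e, snd e}) ` inner_edges (final_pairs n \<sigma>) fst snd U = {e \<in> final_edges \<sigma>. e \<subseteq> U}"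
      proof (intro equalityI subsetI)
        fix e assume e: "e \<in> {e \<in> final_edges \<sigma>. e \<subseteq> U}"
        then obtain u v where "(u, v) \<in> pairs n" "e = {u, v}"
          using final_edges_obtain[OF assms] by blast
        then show "e \<in> (\<lambda>e. {fst e, snd e}) ` inner_edges (final_pairs n \<sigma>) fst snd U"
          using e by (intro image_eqI[of _ _ "(u, v)"]) (auto simp: inner_edges_def final_pairs_def)
      qed (auto simp: inner_edges_def final_pairs_def)
    qed
    from bij_betw_same_card[OF this] show ?thesis by (simp add: density_def)
  qed
  then show ?thesis by (simp add: max_density_def max_dens_def)
qed

primrec flip_free :: "com \<Rightarrow> bool" where
  "flip_free Skip = True"
| "flip_free (Assign a e) = True"
| "flip_free (Flip a) = False"
| "flip_free (Seq c1 c2) = (flip_free c1 \<and> flip_free c2)"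
| "flip_free (If e c1 c2) = (flip_free c1 \<and> flip_free c2)"
| "flip_free (While e c) = flip_free c"

lemma exec_flip_free: "exec c m xs t s m' \<Longrightarrow> flip_free c \<Longrightarrow> xs = []"
  by (induction rule: exec.induct) auto

text \<open>\<open>build_table\<close> has to start with an empty coin history, because its table is
  specified by all coins consumed so far. The commands before it are shown here to keep the history
  empty.\<close>

lemma (in ram) triple_flip_free:
  assumes "flip_free c" "triple T P c Q"
  shows "triple T (\<lambda>xs m. xs = [] \<and> P xs m) c (\<lambda>xs m. xs = [] \<and> Q xs m)"
  unfolding triple_def
proof (intro allI impI)
  fix xs m \<omega> assume m: "ok m" "xs = [] \<and> P xs m"
  then obtain j t s m' where e: "exec c m (stake j \<omega>) t s m'" "t \<le> T * com_cost c * bits W" "s \<le> space"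
    "ok m'" "Q (xs @ stake j \<omega>) m'"
    using assms(2) unfolding triple_def by blast
  moreover have "stake j \<omega> = []" by (rule exec_flip_free[OF e(1) assms(1)])
  ultimately show "\<exists>j t s m'. exec c m (stake j \<omega>) t s m' \<and> t \<le> T * com_cost c * bits W \<and> s \<le> space \<and>
      ok m' \<and> xs @ stake j \<omega> = [] \<and> Q (xs @ stake j \<omega>) m'"
    using m by (metis append_Nil2)
qed

abbreviation algorithm where
  "algorithm \<equiv> Streaming_Algorithm init_program update_program post_program"

context sketch
begin

definition apply_update :: "update \<Rightarrow> (nat \<times> nat \<Rightarrow> int) \<Rightarrow> nat \<times> nat \<Rightarrow> int" where
  "apply_update a \<mu> = \<mu>(edge_pair a := \<mu> (edge_pair a) + sign_of a)"

lemma fold_apply_update: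
  assumes "e \<in> pairs n"
  shows "fold apply_update \<sigma> \<mu> e = \<mu> e + edge_multiplicity \<sigma> {fst e, snd e}"
proof (induction \<sigma> arbitrary: \<mu>)
  case (Cons a \<sigma>)
  have "edge_pair a = e \<longleftrightarrow> {src a, tgt a} = {fst e, snd e}"
    using assms by (cases e; cases "src a \<le> tgt a") (auto simp: edge_pair_def pairs_def doubleton_eq_iff)
  then have "apply_update a \<mu> e = \<mu> e + multiplicity_change a {fst e, snd e}"
    by (auto simp: apply_update_def multiplicity_change_def sign_of_def)
  then show ?case by (simp add: Cons edge_multiplicity_Cons)
qed simp

lemma sketches_cong: "(\<And>e. e \<in> pairs n \<Longrightarrow> \<mu> e = \<nu> e) \<Longrightarrow> sketches T \<mu> m = sketches T \<nu> m"
proof -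
  assume "\<And>e. e \<in> pairs n \<Longrightarrow> \<mu> e = \<nu> e"
  then have "lsum n M g \<mu> = lsum n M g \<nu>" for g
    unfolding lsum_def by (intro arg_cong[where f = "\<lambda>x. x mod int M"] sum.cong) auto
  then show ?thesis by (simp add: sketches_def counters_hold_def cells_hold_def)
qed

lemma sketches_final:
  assumes v: "valid_stream n \<sigma>" and s: "sketches T (fold apply_update \<sigma> (\<lambda>_. 0)) m"
  shows "sketches T (indicator_int (final_pairs n \<sigma>)) m"
proof -
  have "fold apply_update \<sigma> (\<lambda>_. 0) e = indicator_int (final_pairs n \<sigma>) e" if "e \<in> pairs n" for e
  proof -
    have "0 \<le> edge_multiplicity \<sigma> {fst e, snd e}" "edge_multiplicity \<sigma> {fst e, snd e} \<le> 1"
      using edge_multiplicity_nonneg[OF v] v by (auto simp: valid_stream_def)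
    then show ?thesis
      using that by (auto simp: fold_apply_update indicator_int_def final_pairs_def final_edges_def)
  qed
  from sketches_cong[OF this] s show ?thesis by simp
qed

lemma n_less_W: "n < W"
  by (rule less_W_pow[of _ 1 1]) auto

lemma ok_load_update:
  assumes "ok m" "src a < n" "tgt a < n"
  shows "ok (load_update a m)"
  unfolding load_update_def
  using assms W scalar_less n_less_W by (intro ok_upd) (auto simp: of_bool_def)

lemma env_load_update: "env T m \<Longrightarrow> env T (load_update a m)"
  by (simp add: env_def load_update_def)

lemma exec_updates_exist:
  assumes "\<And>a. a \<in> set \<sigma> \<Longrightarrow> src a < n \<and> tgt a < n \<and> src a \<noteq> tgt a"
    and "ok m" "env T m" "sketches T \<mu> m"
  shows "\<exists>j t s m'. exec_updates update_program m \<sigma> (stake j \<omega>) t s m' \<and>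
    t \<le> Suc l * Suc R * com_cost update_program * bits W \<and> s \<le> space \<and>
    ok m' \<and> env T m' \<and> sketches T (fold apply_update \<sigma> \<mu>) m'"
  using assms
proof (induction \<sigma> arbitrary: m \<mu> \<omega>)
  case Nil
  have "exec_updates update_program m [] (stake 0 \<omega>) 0 (memory_bits m) m"
    using exec_updates.Nil by simp
  then show ?case using Nil memory_bits_le[OF Nil(2)] by fastforce
next
  case (Cons a \<sigma>)
  have a: "src a < n" "tgt a < n" "src a \<noteq> tgt a" using Cons.prems(1)[of a] by auto
  have pre: "env T (load_update a m) \<and> sketches T \<mu> (load_update a m) \<and> (load_update a m) 2 = of_bool (is_ins a) \<and>
    (load_update a m) 3 = src a \<and> (load_update a m) 4 = tgt a"
    using Cons.prems(3,4) env_load_update by (simp add: load_update_def)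
  obtain j t s m1 where e1: "exec update_program (load_update a m) (stake j \<omega>) t s m1"
    "t \<le> Suc l * Suc R * com_cost update_program * bits W" "s \<le> space" "ok m1"
    "env T m1 \<and> sketches T (\<mu>(edge_pair a := \<mu> (edge_pair a) + sign_of a)) m1"
    using triple_update_program[OF a, of T \<mu>, unfolded triple_def, rule_format,
      OF ok_load_update[OF Cons.prems(2) a(1,2)] pre, where \<omega> = \<omega>] by blast
  have e1': "env T m1" "sketches T (apply_update a \<mu>) m1" using e1(5) by (simp_all add: apply_update_def)
  obtain k t' s' m2 where e2: "exec_updates update_program m1 \<sigma> (stake k (sdrop j \<omega>)) t' s' m2"
    "t' \<le> Suc l * Suc R * com_cost update_program * bits W" "s' \<le> space" "ok m2" "env T m2"
    "sketches T (fold apply_update \<sigma> (apply_update a \<mu>)) m2"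
    using Cons.IH[OF _ e1(4) e1', of "sdrop j \<omega>"] Cons.prems(1) by auto
  have "exec_updates update_program m (a # \<sigma>) (stake (j + k) \<omega>) (max t t') (max s s') m2"
    using exec_updates.Cons[OF e1(1) e2(1)] by (simp add: stake_add)
  then show ?case using e1(2,3) e2(2-6)
    by (intro exI[of _ "j + k"] exI[of _ "max t t'"] exI[of _ "max s s'"] exI[of _ m2]) simp
qed

definition blank :: "memory \<Rightarrow> bool" where
  "blank m \<longleftrightarrow> m 0 = n \<and> m 1 = q \<and> (\<forall>k i. k < 8 \<longrightarrow> m (addr k i) = 0)"

lemma blank_upd [simp]: "x < 32 \<Longrightarrow> x \<noteq> 0 \<Longrightarrow> x \<noteq> 1 \<Longrightarrow> blank (m(x := y)) = blank m"
  by (simp add: blank_def)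

definition target where "target = 1440 * n * q * q * l"

lemma target_le: "target \<le> 1440 * n ^ 4"
proof -
  have "n * q * q * l \<le> n * n * n * n" using q l_le_n by (intro mult_mono) auto
  also have "\<dots> = n ^ 4" by (simp add: power4_eq_xxxx)
  finally show ?thesis by (simp add: target_def)
qed

lemma target_w: "target < 2 ^ w" "2 ^ w \<le> 2 * target"
  using w by (simp_all add: target_def power2_eq_square mult.assoc)

lemma target_less_W: "2 * target < W" "target < W"
proof -
  show "2 * target < W" by (rule less_W_pow[of _ 2880 4]) (use target_le in auto)
  then show "target < W" by simp
qed

lemma triple_set_sizes:
  "triple (Suc n + Suc target) (\<lambda>_. blank) set_sizes (\<lambda>_ m. blank m \<and> m 5 = l \<and> m 7 = K \<and> m 16 = w)"
proof -
  let ?T = "Suc n + Suc target"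
  have T: "1 \<le> ?T" by simp
  let ?S1 = "\<lambda>m. blank m \<and> m 5 = l \<and> m 17 = target"
  have 1: "triple ?T (\<lambda>_. blank) (12 [:=] Const 1) (\<lambda>_ m. blank m \<and> m 12 = 1)"
    by (rule triple_wp[OF T]) (use W scalar_less[of 12] in auto)
  have 2: "triple ?T (\<lambda>_ m. blank m \<and> m 12 = 1) (5 [:=] Const 0) (\<lambda>_ m. blank m \<and> m 12 = 1 \<and> m 5 = 0)"
    by (rule triple_wp[OF T]) (use W scalar_less[of 5] in auto)
  have nW: "2 * n < W" by (rule less_W_pow[of _ 2 1]) auto
  have 3: "triple ?T (\<lambda>_ m. blank m \<and> m 12 = 1 \<and> m 5 = 0)
    (For 11 (V 0) (If (V 0 [+] Const 1 [-] V 12) (12 [:=] Const 2 [*] V 12 ;; 5 [:=] V 5 [+] Const 1) Skip))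
    (\<lambda>_ m. blank m \<and> m 5 = l)"
    by (rule triple_conseq[OF triple_doubling[of 12 5 0 n l blank]])
      (use l nW n_less_W in \<open>auto simp: blank_def\<close>)
  have 4: "triple ?T (\<lambda>_ m. blank m \<and> m 5 = l) (17 [:=] Const 1440 [*] V 0 [*] V 1 [*] V 1 [*] V 5) (\<lambda>_. ?S1)"
    by (rule triple_wp[OF T]) (use target_less_W scalar_less[of 17] in \<open>auto simp: blank_def target_def\<close>)
  have 5: "triple ?T (\<lambda>_. ?S1) (7 [:=] Const 1) (\<lambda>_ m. ?S1 m \<and> m 7 = 1)"
    by (rule triple_wp[OF T]) (use W scalar_less[of 7] in auto)
  have 6: "triple ?T (\<lambda>_ m. ?S1 m \<and> m 7 = 1) (16 [:=] Const 0) (\<lambda>_ m. ?S1 m \<and> m 7 = 1 \<and> m 16 = 0)"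
    by (rule triple_wp[OF T]) (use W scalar_less[of 16] in auto)
  have 7: "triple ?T (\<lambda>_ m. ?S1 m \<and> m 7 = 1 \<and> m 16 = 0)
    (For 11 (V 17) (If (V 17 [+] Const 1 [-] V 7) (7 [:=] Const 2 [*] V 7 ;; 16 [:=] V 16 [+] Const 1) Skip))
    (\<lambda>_ m. blank m \<and> m 5 = l \<and> m 7 = K \<and> m 16 = w)"
    by (rule triple_conseq[OF triple_doubling[of 7 16 17 target w ?S1]])
      (use target_w target_less_W in \<open>auto simp: K_def\<close>)
  show ?thesis
    unfolding set_sizes_def
    by (rule triple_Seq[OF 1 triple_Seq[OF 2 triple_Seq[OF 3 triple_Seq[OF 4 triple_Seq[OF 5 triple_Seq[OF 6 7]]]]]])
qed

lemma triple_set_constants: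
  "triple 1 (\<lambda>_ m. blank m \<and> m 5 = l \<and> m 7 = K \<and> m 16 = w) set_constants
    (\<lambda>_ m. settings m \<and> (\<forall>k. m (addr 0 k) = 0))"
proof (rule triple_wp)
  fix xs :: "bool list" and m assume m: "blank m \<and> m 5 = l \<and> m 7 = K \<and> m 16 = w"
  have m0: "m 0 = n" using m by (simp add: blank_def)
  have N: "n * n * n * n = N" by (simp add: N_def power4_eq_xxxx)
  have "N * (n * n) = n ^ 6" by (simp add: N_def power2_eq_square[symmetric] flip: power_add)
  then have M: "2 * N * n * n = M" by (simp add: M_def mult.assoc)
  have C: "(2 * R + 1) * n = cells" by (simp add: cells_def)
  have lt: "R < W" "R * K < W" "N < W" "M < W" "cells < W"
    using R_less_W N_less_W M_less_W cells_less_W index_less_W[of "R * K"] RK_le_index by auto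
  define m' where "m' = m(6 := R, 8 := R * K, 9 := N, 10 := M, 18 := cells)"
  have "settings m' \<and> (\<forall>k. m' (addr 0 k) = 0)"
    using m by (simp add: m'_def settings_def blank_def zeros_def)
  then have post: "settings m'" "\<forall>k. m' (addr 0 k) = 0" by blast+
  have *: "wp set_constants Q xs m" if "Q xs m'" for Q
    unfolding set_constants_def wp.simps
    using that m m0 lt N M C scalar_less unfolding m'_def by (simp add: R_def[symmetric] del: mult_Suc mult_Suc_right)
  show "wp set_constants (\<lambda>_ m. settings m \<and> (\<forall>k. m (addr 0 k) = 0)) xs m"
    by (rule *[of "\<lambda>_ m. settings m \<and> (\<forall>k. m (addr 0 k) = 0)"]) (use post in blast)
qed simp

definition init_time where "init_time = Suc n + Suc target + Suc cells * Suc w"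

lemma triple_init:
  "triple init_time (\<lambda>xs m. xs = [] \<and> blank m) (set_sizes ;; set_constants ;; build_table)
    (\<lambda>xs m. length xs = cells * w \<and> env (cell w xs) m \<and> sketches (cell w xs) (\<lambda>_. 0) m)"
proof -
  have T: "Suc n + Suc target \<le> init_time" "1 \<le> init_time" "Suc cells * Suc w \<le> init_time"
    by (simp_all add: init_time_def)
  have final: "env T m \<and> sketches T (\<lambda>_. 0) m" if "settings m" "\<forall>k<cells. m (addr 0 k) = T k" for T m
    using that by (simp add: settings_def env_def zeros_def sketches_def counters_hold_def cells_hold_def lsum_def)
  have ff: "flip_free set_sizes" "flip_free set_constants"
    by (simp_all add: set_sizes_def set_constants_def For_def)
  have 1: "triple init_time (\<lambda>xs m. xs = [] \<and> blank m) set_sizes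
    (\<lambda>xs m. xs = [] \<and> blank m \<and> m 5 = l \<and> m 7 = K \<and> m 16 = w)"
    by (rule triple_flip_free[OF ff(1) triple_conseq[OF triple_set_sizes _ T(1)]]) simp_all
  have 2: "triple init_time (\<lambda>xs m. xs = [] \<and> blank m \<and> m 5 = l \<and> m 7 = K \<and> m 16 = w) set_constants
    (\<lambda>xs m. xs = [] \<and> settings m \<and> (\<forall>k. m (addr 0 k) = 0))"
    by (rule triple_flip_free[OF ff(2) triple_conseq[OF triple_set_constants _ T(2)]]) simp_all
  have 3: "triple init_time (\<lambda>xs m. xs = [] \<and> settings m \<and> (\<forall>k. m (addr 0 k) = 0)) build_table
    (\<lambda>xs m. length xs = cells * w \<and> env (cell w xs) m \<and> sketches (cell w xs) (\<lambda>_. 0) m)"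
    by (rule triple_conseq[OF triple_build_table _ T(3)]) (use final in simp_all)
  show ?thesis by (rule triple_Seq[OF 1 triple_Seq[OF 2 3]])
qed

text \<open>The first command is executed by hand: the given accuracy \<open>q0\<close> may exceed
  \<open>W\<close>, so the initial memory need not be \<open>ok\<close> and its size is charged
  separately.\<close>

lemma exec_init:
  assumes q0: "q = min q0 n"
  shows "\<exists>t s m'. exec init_program (initial_memory n q0) (stake (cells * w) \<omega>) t s m' \<and>
    s \<le> max space (memory_bits (initial_memory n q0)) \<and> ok m' \<and>
    env (cell w (stake (cells * w) \<omega>)) m' \<and> sketches (cell w (stake (cells * w) \<omega>)) (\<lambda>_. 0) m'"
proof -
  let ?start = "initial_memory n q0" and ?m = "initial_memory n q"
  have okm: "ok ?m"
    using n_less_W q scalar_less[of 0] scalar_less[of 1] by (auto simp: ok_def initial_memory_def)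
  have blank: "blank ?m" by (simp add: blank_def initial_memory_def)
  have first: "\<exists>t s. exec (If (V 1 [-] V 0) (1 [:=] V 0) Skip) ?start [] t s ?m \<and>
      s \<le> max space (memory_bits ?start)"
  proof (cases "q0 \<le> n")
    case True
    then have "eval_expr (V 1 [-] V 0) ?start = 0" by (simp add: initial_memory_def)
    then have "exec (If (V 1 [-] V 0) (1 [:=] V 0) Skip) ?start []
        (1 + expr_time (V 1 [-] V 0) ?start + 1) (memory_bits ?start) ?start"
      by (rule exec.IfFalse[OF _ exec.Skip])
    moreover have "q = q0" using True unfolding q0 by (rule min.absorb1)
    then have "?start = ?m" by simp
    ultimately show ?thesis by (metis max.cobounded2)
  next
    case False
    have "q = n" using False unfolding q0 by simp
    then have upd: "?m = ?start(1 := n)" by (simp add: initial_memory_def)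
    have "\<exists>t. exec (If (V 1 [-] V 0) (1 [:=] V 0) Skip) ?start [] t (max (memory_bits ?start) (memory_bits ?m)) ?m"
      by (rule exI, rule exec.IfTrue, use False in \<open>simp add: initial_memory_def\<close>, rule exec.Assign[OF refl refl])
        (simp add: upd, simp add: initial_memory_def)
    then show ?thesis using memory_bits_le[OF okm] by fastforce
  qed
  then obtain t0 s0 where e0: "exec (If (V 1 [-] V 0) (1 [:=] V 0) Skip) ?start [] t0 s0 ?m"
    "s0 \<le> max space (memory_bits ?start)" by blast
  obtain j t s m' where e1: "exec (set_sizes ;; set_constants ;; build_table) ?m (stake j \<omega>) t s m'" "s \<le> space" "ok m'"
    "length ([] @ stake j \<omega>) = cells * w" "env (cell w ([] @ stake j \<omega>)) m'" "sketches (cell w ([] @ stake j \<omega>)) (\<lambda>_. 0) m'"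
    using triple_init[unfolded triple_def, rule_format, OF okm, of "[]" \<omega>] blank by blast
  have j: "j = cells * w" using e1(4) by simp
  have "exec init_program ?start ([] @ stake j \<omega>) (t0 + t) (max s0 s) m'"
    unfolding init_program_def by (rule exec.Seq[OF e0(1) e1(1)])
  then show ?thesis using e0(2) e1 j
    by (intro exI[of _ "t0 + t"] exI[of _ "max s0 s"] exI[of _ m']) auto
qed

text \<open>The postcondition depends on the first \<open>cells * w\<close> coins only, so the
  success probability becomes an average over lists of this length.\<close>

lemma run_exists:
  assumes q0: "q = min q0 n" and v: "valid_stream n \<sigma>"
  shows "\<exists>j tu tp s m. run algorithm n q0 \<sigma> (stake j \<omega>) tu tp s m \<and>
    s \<le> max space (memory_bits (initial_memory n q0)) \<and>
    tu \<le> Suc l * Suc R * com_cost update_program * bits W \<and>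
    tp \<le> post_time * com_cost post_program * bits W \<and>
    result (cell w (stake (cells * w) \<omega>)) (final_pairs n \<sigma>) m"
proof -
  let ?j1 = "cells * w"
  let ?T = "cell w (stake ?j1 \<omega>)"
  obtain t1 s1 m1 where e1: "exec init_program (initial_memory n q0) (stake ?j1 \<omega>) t1 s1 m1"
    "s1 \<le> max space (memory_bits (initial_memory n q0))" "ok m1" "env ?T m1" "sketches ?T (\<lambda>_. 0) m1"
    using exec_init[OF q0, of \<omega>] by blast
  have valid: "src a < n \<and> tgt a < n \<and> src a \<noteq> tgt a" if "a \<in> set \<sigma>" for a
    using v that by (auto simp: valid_stream_def)
  obtain j2 tu s2 m2 where e2: "exec_updates update_program m1 \<sigma> (stake j2 (sdrop ?j1 \<omega>)) tu s2 m2"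
    "tu \<le> Suc l * Suc R * com_cost update_program * bits W" "s2 \<le> space" "ok m2" "env ?T m2"
    "sketches ?T (fold apply_update \<sigma> (\<lambda>_. 0)) m2"
    using exec_updates_exist[OF valid e1(3-5), of \<sigma> "sdrop ?j1 \<omega>"] by blast
  have pre: "env ?T m2 \<and> sketches ?T (indicator_int (final_pairs n \<sigma>)) m2"
    using e2(5) sketches_final[OF v e2(6)] by blast
  have fp: "final_pairs n \<sigma> \<subseteq> pairs n" by (auto simp: final_pairs_def)
  obtain j3 tp s3 m3 where e3: "exec post_program m2 (stake j3 (sdrop j2 (sdrop ?j1 \<omega>))) tp s3 m3"
    "tp \<le> post_time * com_cost post_program * bits W" "s3 \<le> space" "result ?T (final_pairs n \<sigma>) m3"
    using triple_post_program[OF fp, of ?T, unfolded triple_def, rule_format, OF e2(4) pre,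
      where \<omega> = "sdrop j2 (sdrop ?j1 \<omega>)"] by blast
  have "run algorithm n q0 \<sigma> (stake ?j1 \<omega> @ stake j2 (sdrop ?j1 \<omega>) @ stake j3 (sdrop j2 (sdrop ?j1 \<omega>)))
      tu tp (max s1 (max s2 s3)) m3"
    by (rule run.intros) (use e1(1) e2(1) e3(1) in simp_all)
  moreover have "stake ?j1 \<omega> @ stake j2 (sdrop ?j1 \<omega>) @ stake j3 (sdrop j2 (sdrop ?j1 \<omega>)) =
      stake (?j1 + (j2 + j3)) \<omega>"
    by (simp only: stake_add)
  ultimately have "run algorithm n q0 \<sigma> (stake (?j1 + (j2 + j3)) \<omega>) tu tp (max s1 (max s2 s3)) m3" by simp
  then show ?thesis using e1(2) e2(2,3) e3(2-4)
    by (intro exI[of _ "?j1 + (j2 + j3)"] exI[of _ tu] exI[of _ tp] exI[of _ "max s1 (max s2 s3)"] exI[of _ m3]) auto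
qed

end

section \<open>Resources and success probability\<close>

lemma memory_bits_initial: "memory_bits (initial_memory n q) \<le> bits n + 1 + bits q"
proof -
  have "memory_bits (initial_memory n q) \<le> (\<Sum>r\<in>{0, 1}. bits r + bits (initial_memory n q r))"
    unfolding memory_bits_def by (rule sum_mono2) (auto simp: initial_memory_def)
  also have "\<dots> = bits n + 1 + bits q"
    by (simp add: initial_memory_def floorlog_def)
  finally show ?thesis .
qed

lemma bits_le_self: "bits x \<le> x"
  by (rule floorlog_leI) auto

lemma bits_bounds:
  assumes "1 \<le> x"
  shows "x < 2 ^ bits x" "2 ^ bits x \<le> 2 * x"
proof -
  have b: "2 ^ (bits x - 1) \<le> x" "x < 2 ^ bits x" using floorlog_bounds[of x 2] assms by auto
  have "0 < bits x" using assms by (cases "bits x") (use b in auto)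
  then have "(2 :: nat) ^ bits x = 2 * 2 ^ (bits x - 1)" by (cases "bits x") auto
  then show "x < 2 ^ bits x" "2 ^ bits x \<le> 2 * x" using b by auto
qed

lemma accuracy_parameter_bounds:
  assumes "0 < \<epsilon>" "\<epsilon> < 1 / 2"
  shows "1 \<le> accuracy_parameter \<epsilon>" "1 / \<epsilon> \<le> real (accuracy_parameter \<epsilon>)" "real (accuracy_parameter \<epsilon>) \<le> 2 / \<epsilon>"
proof -
  have e: "2 < 1 / \<epsilon>" using assms by (simp add: field_simps)
  have c: "real (accuracy_parameter \<epsilon>) = of_int \<lceil>1 / \<epsilon>\<rceil>"
    using e unfolding accuracy_parameter_def by (intro of_nat_nat) linarith
  show 1: "1 / \<epsilon> \<le> real (accuracy_parameter \<epsilon>)" unfolding c by linarith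
  then show "1 \<le> accuracy_parameter \<epsilon>" using e by linarith
  have "real (accuracy_parameter \<epsilon>) \<le> 1 / \<epsilon> + 1" unfolding c by linarith
  also have "\<dots> \<le> 1 / \<epsilon> + 1 / \<epsilon>" using e by linarith
  finally show "real (accuracy_parameter \<epsilon>) \<le> 2 / \<epsilon>" by simp
qed

text \<open>This is why the program samples with \<delta> = 1/(3q): for \<epsilon> < 1/2, a third of
  \<epsilon> is small enough for the loss \<open>1 - \<delta>\<close> below and for the square of
  \<open>1 + \<delta>\<close> above.\<close>

lemma approximates_concentrated:
  fixes d x \<delta> \<epsilon> :: real
  assumes d: "0 \<le> d" and e: "0 < \<epsilon>" "\<epsilon> < 1 / 2" and \<delta>: "0 < \<delta>" "\<delta> \<le> \<epsilon> / 3"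
    and lo: "(1 - \<delta>) * d \<le> x" and hi: "x \<le> (1 + \<delta>)\<^sup>2 * d"
  shows "approximates \<epsilon> d x"
proof -
  have "1 \<le> (1 - \<epsilon> / 3) * (1 + \<epsilon>)"
  proof -
    have "\<epsilon> * \<epsilon> \<le> \<epsilon> * 1" using e by (intro mult_left_mono) auto
    moreover have "(1 - \<epsilon> / 3) * (1 + \<epsilon>) = 1 + 2 * \<epsilon> / 3 - \<epsilon> * \<epsilon> / 3" by (simp add: field_simps)
    ultimately show ?thesis using e by linarith
  qed
  also have "\<dots> \<le> (1 - \<delta>) * (1 + \<epsilon>)" using e \<delta> by (intro mult_right_mono) auto
  finally have "1 / (1 + \<epsilon>) \<le> 1 - \<delta>" using e by (simp add: field_simps)
  then have "1 / (1 + \<epsilon>) * d \<le> (1 - \<delta>) * d" using d by (rule mult_right_mono)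
  then have 1: "d / (1 + \<epsilon>) \<le> x" using lo by simp
  have "(1 + \<delta>)\<^sup>2 \<le> (1 + \<epsilon> / 3)\<^sup>2" using \<delta> by (intro power_mono) auto
  also have "\<dots> = 1 + 2 * \<epsilon> / 3 + \<epsilon> * \<epsilon> / 9" by (simp add: power2_eq_square field_simps)
  also have "\<dots> \<le> 1 + \<epsilon>"
  proof -
    have "\<epsilon> * \<epsilon> \<le> \<epsilon> * 1" using e by (intro mult_left_mono) auto
    then show ?thesis using e by linarith
  qed
  finally have "(1 + \<delta>)\<^sup>2 * d \<le> (1 + \<epsilon>) * d" using d by (rule mult_right_mono)
  then show ?thesis using 1 hi by (simp add: approximates_def)
qed

context sketch
begin

lemma l_le_log: "real l \<le> 1 + log 2 (real n)"
proof -
  obtain k where k: "l = Suc k" using l0 by (cases l) auto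
  have "2 ^ k \<le> n" using l(2) by (simp add: k)
  then have "real (2 ^ k) \<le> real n" unfolding of_nat_le_iff .
  then have "2 powr real k \<le> real n" by (simp add: powr_realpow)
  then have "real k \<le> log 2 (real n)" using n1 by (simp add: le_log_iff)
  then show ?thesis by (simp add: k)
qed

lemma bits_W_le: "bits W \<le> 61 * l"
proof -
  have "bits W \<le> 20 * l + 41" unfolding W_def by (rule floorlog_leI) (auto intro: power_strict_increasing)
  then show ?thesis using l0 by simp
qed

text \<open>The four factors \<open>l\<close> come from the levels, the repetitions, the number of
  buckets and the word length.\<close>

lemma space_le: "space \<le> 14078800 * (l ^ 4 * n * q\<^sup>2)"
proof -
  define X where "X = l ^ 3 * n * q\<^sup>2"
  have q2: "1 \<le> q\<^sup>2" using q by simp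
  have "1 * 1 * 1 \<le> X" unfolding X_def using l0 n1 q2 by (intro mult_mono) auto
  then have X1: "1 \<le> X" by simp
  have "l ^ 1 \<le> l ^ 3" using l0 by (intro power_increasing) auto
  then have "l * n * 1 \<le> X" unfolding X_def using q2 by (intro mult_mono) auto
  moreover have "1 * n * 1 \<le> X" unfolding X_def using q2 l0 by (intro mult_mono) auto
  moreover have "l * (5 * l * 2 ^ w) \<le> l * (5 * l * (2880 * n * q\<^sup>2 * l))"
    using w(2) by (intro mult_left_mono) auto
  moreover have "l * (5 * l * (2880 * n * q\<^sup>2 * l)) = 14400 * X" by (simp add: X_def power3_eq_cube)
  moreover have "D = 40 + 8 * (l * (5 * l * 2 ^ w)) + 80 * (l * n * 1) + 8 * (1 * n * 1)"
    unfolding D_def by (simp add: algebra_simps)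
  \<comment> \<open>The coefficients add up to 40 + 8 * 14400 + 80 + 8 = 115328.\<close>
  ultimately have "D \<le> 115400 * X" using X1 by linarith
  moreover have "bits D + bits W \<le> 122 * l"
    using bits_W_le floorlog_mono[of D W 2] D_less_W by linarith
  ultimately have "space \<le> (115400 * X) * (122 * l)" unfolding space_def by (intro mult_mono) auto
  also have "\<dots> = 14078800 * (l ^ 4 * n * q\<^sup>2)" by (simp add: X_def power4_eq_xxxx power3_eq_cube)
  finally show ?thesis .
qed

text \<open>The three factors \<open>l\<close> come from the levels, the repetitions and the word
  length.\<close>

lemma update_time_le: "Suc l * Suc R * c * bits W \<le> 732 * c * l ^ 3"
proof -
  have "Suc l * Suc R * c * bits W \<le> (2 * l) * (6 * l) * c * (61 * l)"
    using l0 bits_W_le by (intro mult_mono) (auto simp: R_def)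
  then show ?thesis by (simp add: power3_eq_cube mult_ac)
qed

text \<open>The n^12 sweeps over at most n^2 edges dominate; the last factor \<open>n\<close> is a
  crude bound on the word length.\<close>

lemma post_time_le: "post_time * c * bits W \<le> 30500000000 * c * n ^ 15"
proof -
  have n5: "1 \<le> n ^ 5" and n12: "1 \<le> n ^ 12" and n2: "1 \<le> n\<^sup>2" using n1 by simp_all
  have a: "Suc (R * K) \<le> 14401 * n ^ 5" using RK_le n5 by simp
  have "Suc l * (Suc (R * K) * Suc (R * K)) \<le> (2 * n) * ((14401 * n ^ 5) * (14401 * n ^ 5))"
    using l_le_n n1 by (intro mult_mono a) auto
  also have "\<dots> = 414777602 * (n * (n ^ 5 * n ^ 5))" by simp
  also have "n * (n ^ 5 * n ^ 5) = n ^ 11" by (simp flip: power_add power_Suc)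
  finally have 1: "Suc l * (Suc (R * K) * Suc (R * K)) \<le> 414777602 * n ^ 11" .
  have NNN: "N * N * N = n ^ 12" by (simp add: N_def flip: power_add)
  have "Suc (N * N * N) * Suc (n\<^sup>2) \<le> (2 * n ^ 12) * (2 * n\<^sup>2)"
    unfolding NNN using n12 n2 by (intro mult_mono) auto
  also have "\<dots> = 4 * n ^ 14" by (simp flip: power_add)
  finally have 2: "Suc (N * N * N) * Suc (n\<^sup>2) \<le> 4 * n ^ 14" .
  have "n ^ 11 \<le> n ^ 14" "n ^ 1 \<le> n ^ 14" "n ^ 0 \<le> n ^ 14" by (rule pow_le; simp)+
  then have "post_time \<le> 500000000 * n ^ 14" using 1 2 unfolding post_time_def by simp
  moreover have "bits W \<le> 61 * n" using bits_W_le l_le_n by linarith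
  ultimately have "post_time * c * bits W \<le> (500000000 * n ^ 14) * c * (61 * n)"
    by (intro mult_mono) auto
  also have "\<dots> = 30500000000 * c * (n ^ 14 * n)" by simp
  also have "n ^ 14 * n = n ^ 15" by (simp flip: power_Suc2)
  finally show ?thesis .
qed

text \<open>The program stops at the first decodable level \<open>i\<close>, possibly before the
  promised \<open>j\<close>, hence concentration on all levels up to \<open>j\<close>. Level 0 is
  the graph itself and gives the exact density.\<close>

lemma outputs_if_sampled:
  assumes v: "valid_stream n \<sigma>" and e: "0 < \<epsilon>" "\<epsilon> < 1 / 2" and q0: "q = min (accuracy_parameter \<epsilon>) n"
    and good: "\<exists>j<l. (0 < j \<longrightarrow> 360 * real (q\<^sup>2 * l) \<le> max_dens n (final_pairs n \<sigma>) fst snd) \<and>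
       decodable n (2 ^ w) (5 * l) T (same_class j T (final_pairs n \<sigma>)) \<and>
       (\<forall>i. 0 < i \<and> i \<le> j \<longrightarrow> concentrated n (final_pairs n \<sigma>) (1 / (3 * real q)) i T)"
    and res: "result T (final_pairs n \<sigma>) m"
  shows "outputs_approximation \<epsilon> (max_density n (final_edges \<sigma>)) m"
proof -
  define A where "A = final_pairs n \<sigma>"
  define d where "d = max_dens n A fst snd"
  interpret simple_graph n A
    by unfold_locales (use n1 in \<open>auto simp: A_def final_pairs_def pairs_def\<close>)
  have d0: "0 \<le> d" unfolding d_def by (rule max_dens_nonneg[OF n1])
  let ?dec = "\<lambda>j. decodable n K R T (same_class j T A)"
  from good obtain j where j: "j < l" "0 < j \<longrightarrow> 360 * real (q\<^sup>2 * l) \<le> d" "?dec j"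
    "\<forall>i. 0 < i \<and> i \<le> j \<longrightarrow> concentrated n A (1 / (3 * real q)) i T"
    unfolding K_def R_def A_def d_def by blast
  define i where "i = (LEAST j. ?dec j)"
  have i1: "?dec i" unfolding i_def by (rule LeastI[of ?dec, OF j(3)])
  have i2: "\<not> ?dec j'" if "j' < i" for j' using not_less_Least[of j' ?dec] that by (simp add: i_def)
  have ij: "i \<le> j" unfolding i_def by (rule Least_le[of ?dec, OF j(3)])
  have "i < l" using ij j(1) by simp
  then have m: "m 1 \<noteq> 0 \<and> real (m 0) / real (m 1) = 2 ^ i * max_dens n (same_class i T A) fst snd"
    using res i1 i2 unfolding result_def A_def by blast
  have "approximates \<epsilon> d (2 ^ i * max_dens n (same_class i T A) fst snd)"
  proof (cases "i = 0")
    case True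
    have "d * 1 \<le> d * (1 + \<epsilon>)" using d0 e by (intro mult_left_mono) auto
    then show ?thesis using True e by (simp add: approximates_def d_def divide_le_eq mult.commute)
  next
    case False
    then have "360 * real (q\<^sup>2 * l) \<le> real n" using j(2) ij max_dens_le_n by (auto simp: d_def)
    then have "real (360 * (q\<^sup>2 * l)) \<le> real n" by simp
    then have qn: "360 * (q\<^sup>2 * l) \<le> n" unfolding of_nat_le_iff .
    \<comment> \<open>With \<open>q = n\<close> the threshold would exceed \<open>n\<close>, the
      largest possible density. So a sampled level is used only if \<open>q\<close> is the true
      accuracy parameter.\<close>
    have "q \<noteq> n"
    proof
      assume "q = n"
      have "n * 1 * 1 \<le> n * n * l" using n1 l0 by (intro mult_mono) auto
      then show False using qn n1 unfolding \<open>q = n\<close> power2_eq_square by linarith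
    qed
    then have "q = accuracy_parameter \<epsilon>" using q0 by simp
    then have "1 / \<epsilon> \<le> real q" using accuracy_parameter_bounds[OF e] by simp
    then have "1 / (3 * real q) \<le> \<epsilon> / 3" using e q by (simp add: field_simps)
    moreover have "0 < 1 / (3 * real q)" using q by simp
    moreover have "concentrated n A (1 / (3 * real q)) i T" using j(4) ij False by simp
    ultimately show ?thesis
      using d0 e unfolding concentrated_def d_def[symmetric]
      by (intro approximates_concentrated[of d \<epsilon> "1 / (3 * real q)"]) blast+
  qed
  then show ?thesis
    using m unfolding outputs_approximation_def max_density_final_edges[OF v] d_def A_def by simp
qed

end

text \<open>For a fixed number of consumed coins the event depends on a finite prefix, and there are
  countably many such numbers.\<close>

lemma sets_run_outcome:
  "{\<omega>. \<exists>j tu tp s m. run B n q \<sigma> (stake j \<omega>) tu tp s m \<and> P m} \<in> sets coin_space"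
proof -
  have "{\<omega>. \<exists>j tu tp s m. run B n q \<sigma> (stake j \<omega>) tu tp s m \<and> P m} =
    (\<Union>j. {\<omega>. \<exists>tu tp s m. run B n q \<sigma> (stake j \<omega>) tu tp s m \<and> P m})" by blast
  also have "\<dots> \<in> sets coin_space"
    by (intro sets.countable_UN) (auto intro: sets_stake[of "\<lambda>xs. \<exists>tu tp s m. run B n q \<sigma> xs tu tp s m \<and> P m"])
  finally show ?thesis .
qed

lemma algorithm_correct:
  assumes n: "1 \<le> n" and e: "0 < \<epsilon>" "\<epsilon> < 1 / 2" and v: "valid_stream n \<sigma>"
  shows "\<exists>j tu tp s m. run algorithm n (accuracy_parameter \<epsilon>) \<sigma> (stake j \<omega>) tu tp s m \<and>
      real s \<le> 60000000 * (1 / \<epsilon>\<^sup>2 * real n * polylog 4 n) \<and>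
      real tu \<le> 732 * real (com_cost update_program) * polylog 3 n \<and>
      real tp \<le> 30500000000 * real (com_cost post_program) * real n ^ 15" (is ?resources)
    and "1 - real n powr (- 1) \<le> measure coin_space
      {\<omega>. \<exists>j tu tp s m. run algorithm n (accuracy_parameter \<epsilon>) \<sigma> (stake j \<omega>) tu tp s m \<and>
        outputs_approximation \<epsilon> (max_density n (final_edges \<sigma>)) m}" (is ?probability)
proof -
  define q0 where "q0 = accuracy_parameter \<epsilon>"
  note q0 = accuracy_parameter_bounds[OF e, folded q0_def]
  define q where "q = min q0 n"
  define l where "l = bits n"
  define w where "w = bits (1440 * n * q\<^sup>2 * l)"
  define W where "W = (2 :: nat) ^ (20 * l + 40)"
  define D where "D = 40 + 8 * (l * (5 * l * 2 ^ w) + (2 * (5 * l) + 1) * n)"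
  have l: "n < 2 ^ l" "2 ^ l \<le> 2 * n" unfolding l_def by (rule bits_bounds[OF n])+
  have l1: "1 \<le> l" using l(1) n by (cases l) auto
  have q: "1 \<le> q" "q \<le> n" using q0(1) n by (auto simp: q_def)
  have "1 * 1 * 1 * 1 \<le> 1440 * n * q\<^sup>2 * l" using n q l1 by (intro mult_mono) auto
  then have t: "1 \<le> 1440 * n * q\<^sup>2 * l" by simp
  interpret sketch W D n q l w
  proof
    show "2 \<le> W" using self_le_power[of "2 :: nat" "20 * l + 40"] by (simp add: W_def)
    show "1440 * n * q\<^sup>2 * l < 2 ^ w" unfolding w_def by (rule bits_bounds(1)[OF t])
    show "2 ^ w \<le> 2880 * n * q\<^sup>2 * l" using bits_bounds(2)[OF t] unfolding w_def by simp
  qed (use n l q in \<open>simp_all add: W_def D_def\<close>)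
  define lg where "lg = 1 + log 2 (real n)"
  have ll: "real l \<le> lg" unfolding lg_def by (rule l_le_log)
  have lg1: "1 \<le> lg" using n by (simp add: lg_def)
  define X where "X = 1 / \<epsilon>\<^sup>2 * real n * lg ^ 4"
  have e1: "1 \<le> 1 / \<epsilon>" using e by (simp add: field_simps)
  have e2: "1 / \<epsilon> \<le> 1 / \<epsilon>\<^sup>2"
  proof -
    have "1 / \<epsilon> * 1 \<le> 1 / \<epsilon> * (1 / \<epsilon>)" using e1 e by (intro mult_left_mono) auto
    then show ?thesis by (simp add: power2_eq_square)
  qed
  have lgX: "lg \<le> X" and eX: "1 / \<epsilon> \<le> X"
  proof -
    have lg4: "lg \<le> lg ^ 4" "1 \<le> lg ^ 4" using lg1 self_le_power[of lg 4] by auto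
    have "1 * 1 * lg \<le> X" unfolding X_def using e1 e2 n lg1 lg4 by (intro mult_mono) auto
    then show "lg \<le> X" by simp
    have "1 / \<epsilon> * 1 * 1 \<le> X" unfolding X_def using e e2 n lg4 by (intro mult_mono) auto
    then show "1 / \<epsilon> \<le> X" by simp
  qed
  have space_X: "real space \<le> 56315200 * X"
  proof -
    have "real space \<le> real (14078800 * (l ^ 4 * n * q\<^sup>2))" unfolding of_nat_le_iff by (rule space_le)
    also have "\<dots> = 14078800 * (real l ^ 4 * real n * (real q)\<^sup>2)" by simp
    \<comment> \<open>Rounding 1/\<epsilon> up at most doubles it, which costs a factor 4 after
      squaring.\<close>
    also have "\<dots> \<le> 14078800 * (lg ^ 4 * real n * (2 / \<epsilon>)\<^sup>2)"
    proof (intro mult_left_mono mult_mono power_mono ll)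
      have "real q \<le> real q0" by (simp add: q_def)
      then show "real q \<le> 2 / \<epsilon>" using q0(3) by linarith
    qed (use lg1 in auto)
    also have "\<dots> = 56315200 * X" by (simp add: X_def power2_eq_square)
    finally show ?thesis .
  qed
  have start_X: "real (memory_bits (initial_memory n q0)) \<le> 4 * X"
  proof -
    have "memory_bits (initial_memory n q0) \<le> l + 1 + q0"
      using memory_bits_initial[of n q0] bits_le_self[of q0] unfolding l_def by linarith
    then have "real (memory_bits (initial_memory n q0)) \<le> real l + 1 + real q0" by linarith
    then show ?thesis using ll lgX eX e1 q0(3) by linarith
  qed
  let ?A = "final_pairs n \<sigma>"
  have run: "\<exists>j tu tp s m. run algorithm n q0 \<sigma> (stake j \<omega>) tu tp s m \<and>
    s \<le> max space (memory_bits (initial_memory n q0)) \<and>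
    tu \<le> Suc l * Suc R * com_cost update_program * bits W \<and>
    tp \<le> post_time * com_cost post_program * bits W \<and>
    result (cell w (stake (cells * w) \<omega>)) ?A m" for \<omega>
    by (rule run_exists[OF q_def v])
  show ?resources
  proof -
    obtain j tu tp s m where r: "run algorithm n q0 \<sigma> (stake j \<omega>) tu tp s m"
      "s \<le> max space (memory_bits (initial_memory n q0))"
      "tu \<le> Suc l * Suc R * com_cost update_program * bits W"
      "tp \<le> post_time * com_cost post_program * bits W" using run[of \<omega>] by blast
    have "real s \<le> max (real space) (real (memory_bits (initial_memory n q0)))" using r(2) by linarith
    also have "\<dots> \<le> 60000000 * X" using space_X start_X lgX lg1 by linarith
    finally have s: "real s \<le> 60000000 * (1 / \<epsilon>\<^sup>2 * real n * polylog 4 n)"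
      by (simp add: X_def lg_def polylog_def)
    have "tu \<le> 732 * com_cost update_program * l ^ 3"
      using r(3) update_time_le[of "com_cost update_program"] by linarith
    then have "real tu \<le> real (732 * com_cost update_program * l ^ 3)" unfolding of_nat_le_iff .
    also have "\<dots> = 732 * real (com_cost update_program) * real l ^ 3" by simp
    also have "\<dots> \<le> 732 * real (com_cost update_program) * lg ^ 3"
      by (intro mult_left_mono power_mono ll) auto
    finally have tu: "real tu \<le> 732 * real (com_cost update_program) * polylog 3 n"
      by (simp add: lg_def polylog_def)
    have "tp \<le> 30500000000 * com_cost post_program * n ^ 15"
      using r(4) post_time_le[of "com_cost post_program"] by linarith
    then have "real tp \<le> real (30500000000 * com_cost post_program * n ^ 15)" unfolding of_nat_le_iff .
    then have tp: "real tp \<le> 30500000000 * real (com_cost post_program) * real n ^ 15" by simp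
    show ?thesis using r(1) s tu tp unfolding q0_def by blast
  qed
  show ?probability
  proof -
    interpret simple_graph n ?A
      by unfold_locales (use n in \<open>auto simp: final_pairs_def pairs_def\<close>)
    define good where "good xs \<longleftrightarrow> (\<exists>j<l.
     (0 < j \<longrightarrow> 360 * real (q\<^sup>2 * l) \<le> max_dens n ?A fst snd) \<and>
     decodable n (2 ^ w) (5 * l) (cell w xs) (same_class j (cell w xs) ?A) \<and>
     (\<forall>i. 0 < i \<and> i \<le> j \<longrightarrow> concentrated n ?A (1 / (3 * real q)) i (cell w xs)))" for xs
    let ?N = "cells * w"
    have N: "?N = (2 * (5 * l) + 1) * n * w" by (simp add: cells_def R_def)
    have fails: "avg ?N (\<lambda>xs. of_bool (\<not> good xs)) \<le> 1 / real n"
      unfolding N good_def by (rule avg_sampling_fails[OF l(1) q(1) sketch.w(1)[OF sketch_axioms]])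
    have "avg ?N (\<lambda>xs. of_bool (good xs) + of_bool (\<not> good xs)) = avg ?N (\<lambda>_. 1)"
      by (rule avg_cong) auto
    then have "1 - 1 / real n \<le> avg ?N (\<lambda>xs. of_bool (good xs))" using fails unfolding avg_add by simp
    also have "\<dots> = measure coin_space {\<omega>. good (stake ?N \<omega>)}" by (rule measure_stake[symmetric])
    also have "\<dots> \<le> measure coin_space
      {\<omega>. \<exists>j tu tp s m. run algorithm n (accuracy_parameter \<epsilon>) \<sigma> (stake j \<omega>) tu tp s m \<and>
        outputs_approximation \<epsilon> (max_density n (final_edges \<sigma>)) m}"
    proof (rule coins.finite_measure_mono[OF _ sets_run_outcome], safe)
      fix \<omega> assume g: "good (stake ?N \<omega>)"
      obtain j tu tp s m where r: "run algorithm n q0 \<sigma> (stake j \<omega>) tu tp s m"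
        "result (cell w (stake ?N \<omega>)) ?A m" using run[of \<omega>] by blast
      have "outputs_approximation \<epsilon> (max_density n (final_edges \<sigma>)) m"
        by (rule outputs_if_sampled[OF v e q_def[unfolded q0_def] g[unfolded good_def] r(2)])
      then show "\<exists>j tu tp s m. run algorithm n (accuracy_parameter \<epsilon>) \<sigma> (stake j \<omega>) tu tp s m \<and>
        outputs_approximation \<epsilon> (max_density n (final_edges \<sigma>)) m"
        using r(1) unfolding q0_def by blast
    qed
    finally show ?thesis using n by (simp add: powr_minus_divide)
  qed
qed

theorem theorem2:
  shows "\<exists>A :: streaming_algorithm. \<exists>c > 0 :: real.
    \<exists>(C\<^sub>s :: real) (k\<^sub>s :: nat) (C\<^sub>u :: real) (k\<^sub>u :: nat) (C\<^sub>p :: real) (k\<^sub>p :: nat).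
    \<forall>(n :: nat) (\<epsilon> :: real) (\<sigma> :: update list).
      1 \<le> n \<and> 0 < \<epsilon> \<and> \<epsilon> < 1 / 2 \<and> valid_stream n \<sigma> \<longrightarrow>
        (\<forall>\<omega>. \<exists>j t\<^sub>u t\<^sub>p s m.
           run A n (accuracy_parameter \<epsilon>) \<sigma> (stake j \<omega>) t\<^sub>u t\<^sub>p s m \<and>
           real s \<le> C\<^sub>s * (1 / \<epsilon>\<^sup>2 * real n * polylog k\<^sub>s n) \<and>
           real t\<^sub>u \<le> C\<^sub>u * polylog k\<^sub>u n \<and>
           real t\<^sub>p \<le> C\<^sub>p * real n ^ k\<^sub>p) \<and>
        measure coin_space
          {\<omega>. \<exists>j t\<^sub>u t\<^sub>p s m.
             run A n (accuracy_parameter \<epsilon>) \<sigma> (stake j \<omega>) t\<^sub>u t\<^sub>p s m \<and>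
             outputs_approximation \<epsilon> (max_density n (final_edges \<sigma>)) m}
          \<ge> 1 - real n powr (- c)"
proof (rule exI[of _ algorithm], rule exI[of _ "1 :: real"], rule conjI[OF zero_less_one],
    rule exI[of _ "60000000 :: real"], rule exI[of _ "4 :: nat"],
    rule exI[of _ "732 * real (com_cost update_program)"], rule exI[of _ "3 :: nat"],
    rule exI[of _ "30500000000 * real (com_cost post_program)"], rule exI[of _ "15 :: nat"],
    intro allI impI, elim conjE, intro conjI allI)
qed (rule algorithm_correct; assumption)+

end
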